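(* Let $q$ be an odd prime power and let $G=\mathrm{GL}(2,q)$ and $t:= \begin{bmatrix} -1 & 0 \\ 0 & -1 \end{bmatrix}$. Let $N$ denote the set of non-squares in $\mathbb{F}_{q}^{\times}$ and define $\mathfrak{S}$ to be the set of elements which are conjugate to an element of the set \[\{c_{3}(1,-1)\} \bigcup \left(\bigcup\limits_{x \in \mathbb{F}_{q}^{\times}}c_{2}(x) \right) \bigcup \left( \bigcup\limits_{\substack{z \in \mathbb{F}_{q^{2}}^\times\setminus \mathbb{F}_{q}^\times \\ z^{q+1}\in \{1\} \cup N}} c_{4}(z)\right).\] Then, a perfect state transfer occurs at some time between vertices $x$ and $xt$ of the connected graph $\Gamma:=\mathrm{Cay}(G,\mathfrak{S})$, for all $x\in G$.
   Context: Fix a non-square $\Delta\in\mathbb{F}_q$ and a root $\sqrt{\Delta}\in\mathbb{F}_{q^2}$ of $T^2-\Delta$; write $z\in\mathbb{F}_{q^2}$ as $z=x_z+y_z\sqrt\Delta$ with $x_z,y_z\in\mathbb{F}_q$. Here $c_2(x)=\begin{bmatrix}x&1\\0&x\end{bmatrix}$, $c_3(x,y)=\begin{bmatrix}x&0\\0&y\end{bmatrix}$, and $c_4(z)=\begin{bmatrix}x_z&\Delta y_z\\ y_z&x_z\end{bmatrix}$. Perfect state transfer from vertex $a$ to vertex $b$ at time $\tau$ of a graph with adjacency matrix $A$ means $\exp(-i\tau A)e_a=\gamma e_b$ for some $\gamma\in\mathbb{C}$ with $|\gamma|=1$. *)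

theory Defs
  imports
    "HOL-Analysis.Analysis"
    "HOL-Algebra.Group"
    "HOL-Number_Theory.Prime_Powers"
    "Graph_Theory.Pair_Digraph"
    "Graph_Theory.Digraph_Component"
begin

text \<open>
  Graphs are simple digraphs of \<^theory>\<open>Graph_Theory.Pair_Digraph\<close>, an undirected graph being one
  that satisfies \<^locale>\<open>pair_graph\<close>.  The following constants are meant for graphs whose vertex
  set is the whole (finite) vertex type \<open>'v\<close>, so that the adjacency matrix is indexed by exactly
  the vertices.
\<close>

definition adjacency_matrix :: "'v::finite pair_pre_digraph \<Rightarrow> complex^'v^'v" where
  "adjacency_matrix \<Gamma> = (\<chi> u v. if (u, v) \<in> parcs \<Gamma> then 1 else 0)"

text \<open>
  The power and \<open>exp\<close> of the library are not those of the matrix ring: the product \<open>*\<close> on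
  \<open>'a^'n\<close> is componentwise.
\<close>

primrec matrix_power :: "'a::semiring_1^'v^'v::finite \<Rightarrow> nat \<Rightarrow> 'a^'v^'v" where
  "matrix_power A 0 = mat 1"
| "matrix_power A (Suc n) = A ** matrix_power A n"

definition matrix_exp :: "complex^'v^'v::finite \<Rightarrow> complex^'v^'v" where
  "matrix_exp A = (\<Sum>n. (1 / fact n) *\<^sub>R matrix_power A n)"

definition perfect_state_transfer ::
    "'v::finite pair_pre_digraph \<Rightarrow> real \<Rightarrow> 'v \<Rightarrow> 'v \<Rightarrow> bool" where
  "perfect_state_transfer \<Gamma> \<tau> a b \<longleftrightarrow>
    (\<exists>\<gamma>::complex. cmod \<gamma> = 1 \<and>
      matrix_exp (\<chi> u v. - \<i> * complex_of_real \<tau> * adjacency_matrix \<Gamma> $ u $ v) *v axis a 1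
        = \<gamma> *s axis b 1)"

definition Cay :: "('g, 'm) monoid_scheme \<Rightarrow> 'g set \<Rightarrow> 'g pair_pre_digraph" where
  "Cay G S = \<lparr> pverts = carrier G,
     parcs = {(x, y). x \<in> carrier G \<and> y \<in> carrier G \<and> y \<otimes>\<^bsub>G\<^esub> inv\<^bsub>G\<^esub> x \<in> S} \<rparr>"

typedef (overloaded) 'a gl2 = "{A :: 'a::field^2^2. invertible A}"
  morphisms mat_of_gl2 gl2_of_mat
proof
  show "mat 1 \<in> {A :: 'a^2^2. invertible A}"
    by (auto simp: invertible_def intro: exI[of _ "mat 1"])
qed

instance gl2 :: ("{field, finite}") finite
proof
  have "inj (mat_of_gl2 :: 'a gl2 \<Rightarrow> 'a^2^2)"
    by (simp add: inj_def mat_of_gl2_inject)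
  then show "finite (UNIV :: 'a gl2 set)"
    by (rule finite_imageD[rotated]) simp
qed

definition GL2 :: "'a::field gl2 monoid" where
  "GL2 = \<lparr> carrier = UNIV,
     mult = (\<lambda>x y. gl2_of_mat (mat_of_gl2 x ** mat_of_gl2 y)),
     one = gl2_of_mat (mat 1) \<rparr>"

lemma GL2_simps:
  fixes x y :: "'a::field gl2"
  shows "carrier (GL2 :: 'a gl2 monoid) = UNIV"
    and "mat_of_gl2 (x \<otimes>\<^bsub>GL2\<^esub> y) = mat_of_gl2 x ** mat_of_gl2 y"
    and "mat_of_gl2 (\<one>\<^bsub>GL2\<^esub> :: 'a gl2) = mat 1"
proof -
  have "invertible (mat_of_gl2 x ** mat_of_gl2 y)"
    using mat_of_gl2[of x] mat_of_gl2[of y] by (simp add: invertible_mult)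
  moreover have "invertible (mat 1 :: 'a^2^2)"
    by (auto simp: invertible_def intro: exI[of _ "mat 1"])
  ultimately show "carrier (GL2 :: 'a gl2 monoid) = UNIV"
    and "mat_of_gl2 (x \<otimes>\<^bsub>GL2\<^esub> y) = mat_of_gl2 x ** mat_of_gl2 y"
    and "mat_of_gl2 (\<one>\<^bsub>GL2\<^esub> :: 'a gl2) = mat 1"
    by (simp_all add: GL2_def gl2_of_mat_inverse)
qed

lemma group_GL2: "group (GL2 :: 'a::field gl2 monoid)"
proof (rule groupI)
  fix x :: "'a gl2"
  obtain B where B: "mat_of_gl2 x ** B = mat 1" "B ** mat_of_gl2 x = mat 1"
    using mat_of_gl2[of x] by (auto simp: invertible_def)
  then have "invertible B"
    by (auto simp: invertible_def)
  with B(2) have "gl2_of_mat B \<otimes>\<^bsub>GL2\<^esub> x = \<one>\<^bsub>GL2\<^esub>"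
    by (simp flip: mat_of_gl2_inject add: GL2_simps gl2_of_mat_inverse)
  then show "\<exists>y\<in>carrier GL2. y \<otimes>\<^bsub>GL2\<^esub> x = \<one>\<^bsub>GL2\<^esub>"
    by (auto simp: GL2_simps)
qed (simp_all flip: mat_of_gl2_inject add: GL2_simps matrix_mul_assoc)

definition c2 :: "'a::field \<Rightarrow> 'a^2^2" where
  "c2 x = vector [vector [x, 1], vector [0, x]]"

definition c3 :: "'a::field \<Rightarrow> 'a \<Rightarrow> 'a^2^2" where
  "c3 x y = vector [vector [x, 0], vector [0, y]]"

text \<open>
  The quadratic extension is an arbitrary field \<open>'b\<close> with an embedding \<open>\<iota> :: 'a \<Rightarrow> 'b\<close> and an
  element \<open>s\<close> such that \<open>s\<^sup>2 = \<iota> \<Delta>\<close>; every \<open>z :: 'b\<close> is then uniquely \<open>\<iota> x + \<iota> y * s\<close>.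
\<close>

definition quad_coords :: "('a::field \<Rightarrow> 'b::field) \<Rightarrow> 'b \<Rightarrow> 'b \<Rightarrow> 'a \<times> 'a" where
  "quad_coords \<iota> s z = (THE (x, y). z = \<iota> x + \<iota> y * s)"

definition c4 :: "'a::field \<Rightarrow> ('a \<Rightarrow> 'b::field) \<Rightarrow> 'b \<Rightarrow> 'b \<Rightarrow> 'a^2^2" where
  "c4 \<Delta> \<iota> s z = (case quad_coords \<iota> s z of
     (x, y) \<Rightarrow> vector [vector [x, \<Delta> * y], vector [y, x]])"

definition nonsquares :: "'a::field set" where
  "nonsquares = {a. a \<noteq> 0 \<and> (\<nexists>b. a = b\<^sup>2)}"

definition connection_reps ::
    "'a::{field, finite} \<Rightarrow> ('a \<Rightarrow> 'b::field) \<Rightarrow> 'b \<Rightarrow> ('a^2^2) set" where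
  "connection_reps \<Delta> \<iota> s =
     {c3 1 (- 1)} \<union> (\<Union>x\<in>- {0}. {c2 x}) \<union>
     (\<Union>z\<in>{z. z \<noteq> 0 \<and> z \<notin> range \<iota> \<and> z ^ (CARD('a) + 1) \<in> {1} \<union> \<iota> ` nonsquares}.
        {c4 \<Delta> \<iota> s z})"

definition connection_set ::
    "'a::{field, finite} \<Rightarrow> ('a \<Rightarrow> 'b::field) \<Rightarrow> 'b \<Rightarrow> 'a gl2 set" where
  "connection_set \<Delta> \<iota> s =
     {h \<otimes>\<^bsub>GL2\<^esub> c \<otimes>\<^bsub>GL2\<^esub> inv\<^bsub>GL2\<^esub> h | h c. mat_of_gl2 c \<in> connection_reps \<Delta> \<iota> s}"

end

theory Submission
  imports Defs "HOL-Number_Theory.Residues"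
begin

text \<open>
  The connection set \<open>S\<close> is closed under conjugation, so the adjacency matrix is the image of its
  indicator function under the regular representation of the commutative algebra of class
  functions.  Instead of the character table, that algebra is described by three families: the
  indicators of the scalars and of the determinants, and the functions counting eigenvectors with
  a prescribed eigenvalue (the characters induced from a Borel subgroup).  Counting pairs of
  eigenvectors gives the structure constants, and these split the functions into commuting
  multiples of idempotents, one for each type of irreducible representation.

  In terms of these idempotents the indicator of \<open>S\<close> has integer coefficients, all divisible by 4
  except for the coefficient \<open>2 q\<close> of the projection \<open>(1 + t) / 2\<close>.  Modulo 4 the eigenvalues of the
  adjacency matrix \<open>A\<close> are therefore \<open>2 q\<close> where \<open>t\<close> acts as \<open>1\<close> and \<open>0\<close> where \<open>t\<close> acts as \<open>- 1\<close>;
  as \<open>q\<close> is odd, \<open>exp (- \<i> (\<pi> / 2) A) = - t\<close>.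
\<close>

section \<open>Finite fields of odd order\<close>

text \<open>No irreducible character is ever written down. It is enough that the twelve elements of
  \<open>spectral_list\<close> are nonzero integer multiples of idempotents in a commutative ring:
  every vector is then a sum of vectors on each of which every one of the twelve acts as 0 or as its
  factor. The congruence modulo 4 is a polynomial identity in these twelve bits and is checked for
  all their values, including combinations that no representation realises. Hence neither
  orthogonality nor completeness of the idempotents has to be known. Everything stays integral
  because the connection set is cut out by trace, determinant and squareness, so that the only
  weights in the sums are values of the trivial and of the quadratic character. Denominators are
  cleared twice: by 4 (q - 1) in passing from the indicator of the connection set to
  \<open>cay_cf\<close>, and by q - 1 once more in passing from \<open>eig_cf\<close> to
  \<open>principal_cf\<close>. The divisibility itself comes from q^2 - 1 = 4 k (k + 1) for q = 2 k
  + 1, where k (k + 1) is even.\<close>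

lemma odd_CARD_two_neq_zero:
  assumes "odd CARD('a::{field,finite})"
  shows "(2::'a) \<noteq> 0"
proof
  assume "(2::'a) = 0"
  then have "of_nat 2 = (0::'a)" by simp
  then have "CHAR('a) dvd 2" by (simp only: of_nat_eq_0_iff_char_dvd)
  then have "CHAR('a) \<le> 2" by (auto dest: dvd_imp_le)
  moreover have "CHAR('a) \<noteq> 1" "CHAR('a) > 0"
    by (auto intro: finite_imp_CHAR_pos)
  ultimately have "CHAR('a) = 2" by linarith
  then show False using CHAR_dvd_CARD[where ?'a = 'a] assms by simp
qed

lemma card_nonzero: "card (- {0::'a::{zero,finite}}) = CARD('a) - 1"
  by (simp add: Compl_eq_Diff_UNIV card_Diff_singleton)

lemma card_nonzero_squares:
  assumes "odd CARD('a::{field,finite})"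
  shows "2 * card ((\<lambda>b::'a. b\<^sup>2) ` (- {0})) = CARD('a) - 1"
proof -
  let ?S = "(\<lambda>b::'a. b\<^sup>2) ` (- {0})"
  have two: "(2::'a) \<noteq> 0" by (rule odd_CARD_two_neq_zero[OF assms])
  have fib: "card {b \<in> - {0::'a}. b\<^sup>2 = a} = 2" if "a \<in> ?S" for a
  proof -
    from that obtain b where b: "a = b\<^sup>2" "b \<noteq> 0" by auto
    have "{b \<in> - {0::'a}. b\<^sup>2 = a} = {b, -b}" using b by (auto simp: power2_eq_iff)
    moreover have "b \<noteq> - b"
    proof
      assume "b = - b" then have "2 * b = 0" by (simp add: eq_neg_iff_add_eq_0)
      then show False using two b by simp
    qed
    ultimately show ?thesis by simp
  qed
  have "card (- {0::'a}) = (\<Sum>a\<in>?S. card {b \<in> - {0::'a}. b\<^sup>2 = a})"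
    using sum.image_gen[of "- {0::'a}" "\<lambda>_. 1::nat" "\<lambda>b. b\<^sup>2"] by simp
  also have "\<dots> = (\<Sum>a\<in>?S. 2)" by (rule sum.cong[OF refl fib])
  also have "\<dots> = 2 * card ?S" by simp
  finally show ?thesis by (simp add: card_nonzero)
qed

text \<open>The quadratic character, but with value 1 at 0, since 0 is a square. Hence the
  nonvanishing hypotheses of \<open>qchar_mult\<close> and the separate case of discriminant 0 in
  \<open>root_count\<close>.\<close>

definition qchar :: "'a::field \<Rightarrow> int" where
  "qchar a = (if \<exists>b. a = b\<^sup>2 then 1 else - 1)"

lemma qchar_square [simp]: "qchar (b\<^sup>2) = 1"
  by (auto simp: qchar_def)

lemma qchar_one [simp]: "qchar 1 = 1"
  using qchar_square[of 1] by simp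

lemma qchar_cases: "qchar a = 1 \<or> qchar a = - 1"
  by (simp add: qchar_def)

lemma mem_nonsquares: "a \<in> nonsquares \<longleftrightarrow> a \<noteq> 0 \<and> qchar a = - 1"
  by (auto simp: nonsquares_def qchar_def)

text \<open>Multiplication by \<open>n\<close> maps the nonzero squares injectively into the
  nonsquares, and each of the two sets is half of the nonzero elements. That the nonsquares are a
  single coset also makes a product of two of them a square.\<close>

lemma nonsquares_eq_times:
  fixes n :: "'a::{field,finite}"
  assumes "odd CARD('a)" "n \<in> nonsquares"
  shows "nonsquares = (*) n ` ((\<lambda>b. b\<^sup>2) ` (- {0}))"
proof -
  define S where "S = (\<lambda>b::'a. b\<^sup>2) ` (- {0})"
  have n0: "n \<noteq> 0" using assms by (simp add: nonsquares_def)
  have part: "S \<union> nonsquares = - {0}" "S \<inter> nonsquares = {}"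
    by (auto simp: nonsquares_def S_def)
  have "card S + card (nonsquares :: 'a set) = CARD('a) - 1"
    using card_Un_disjoint[OF _ _ part(2)] by (simp add: part(1) card_nonzero)
  then have card: "card (nonsquares :: 'a set) = card S"
    using card_nonzero_squares[OF assms(1)] by (simp add: S_def)
  have "n * b\<^sup>2 \<in> nonsquares" if b: "b \<noteq> 0" for b
  proof -
    have "n = (c / b)\<^sup>2" if "n * b\<^sup>2 = c\<^sup>2" for c
      using b by (simp add: power_divide flip: that)
    then show ?thesis
      using assms(2) b unfolding nonsquares_def by auto
  qed
  then have "(*) n ` S \<subseteq> nonsquares" by (auto simp: S_def)
  moreover have "card ((*) n ` S) = card S"
    by (rule card_image) (simp add: n0 inj_on_def)
  ultimately have "(*) n ` S = nonsquares" using card by (simp add: card_subset_eq)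
  then show ?thesis by (simp add: S_def)
qed

lemma qchar_mult:
  fixes a b :: "'a::{field,finite}"
  assumes "odd CARD('a)" "a \<noteq> 0" "b \<noteq> 0"
  shows "qchar (a * b) = qchar a * qchar b"
proof -
  have sq: "qchar (a * b) = qchar b" if a: "qchar a = 1" "a \<noteq> 0" for a b :: 'a
  proof -
    obtain c where c: "a = c\<^sup>2" using a(1) unfolding qchar_def by (metis one_neq_neg_one)
    then have c0: "c \<noteq> 0" using a(2) by auto
    have "b = (d / c)\<^sup>2" if "c\<^sup>2 * b = d\<^sup>2" for d
      using c0 by (simp add: power_divide flip: that)
    moreover have "c\<^sup>2 * d\<^sup>2 = (c * d)\<^sup>2" for d by (simp add: power_mult_distrib)
    ultimately show ?thesis unfolding qchar_def c by metis
  qed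
  show ?thesis
  proof (cases "qchar a = 1 \<or> qchar b = 1")
    case True
    then show ?thesis using sq[of a b] sq[of b a] assms by (auto simp: mult.commute)
  next
    case False
    then have ab: "a \<in> nonsquares" "b \<in> nonsquares" "qchar a = -1" "qchar b = -1"
      using qchar_cases[of a] qchar_cases[of b] assms by (auto simp: mem_nonsquares)
    then obtain c where "b = a * c\<^sup>2" using nonsquares_eq_times[OF assms(1) ab(1)] by auto
    then have "a * b = (a * c)\<^sup>2" by (simp add: power2_eq_square algebra_simps)
    then show ?thesis using ab by simp
  qed
qed

text \<open>Multiplication by a nonzero \<open>a\<close> permutes the nonzero elements, so their
  product absorbs the factor \<open>a ^ (CARD('a) - 1)\<close>.\<close>

lemma finite_field_power_card:
  fixes a :: "'a::{field,finite}"
  shows "a ^ CARD('a) = a"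
proof (cases "a = 0")
  case False
  have "bij_betw ((*) a) (- {0}) (- {0})"
    using False by (intro bij_betwI[where g = "\<lambda>x. x / a"]) auto
  then have "(\<Prod>x\<in>- {0::'a}. a * x) = (\<Prod>x\<in>- {0}. x)"
    by (rule prod.reindex_bij_betw)
  moreover have "(\<Prod>x\<in>- {0::'a}. a * x) = a ^ (CARD('a) - 1) * (\<Prod>x\<in>- {0}. x)"
    by (simp add: prod.distrib card_nonzero)
  ultimately have "a ^ (CARD('a) - 1) = 1" by simp
  moreover have "CARD('a) = Suc (CARD('a) - 1)" by simp
  ultimately show ?thesis by (metis mult.right_neutral power_Suc)
qed (simp add: power_0_left)

section \<open>Two by two matrices\<close>

definition mk2 :: "'a \<Rightarrow> 'a \<Rightarrow> 'a \<Rightarrow> 'a \<Rightarrow> 'a::zero^2^2" where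
  "mk2 a b c d = vector [vector [a, b], vector [c, d]]"

lemma mk2_nth [simp]:
  "mk2 a b c d $ 1 $ 1 = a" "mk2 a b c d $ 1 $ 2 = b"
  "mk2 a b c d $ 2 $ 1 = c" "mk2 a b c d $ 2 $ 2 = d"
  by (simp_all add: mk2_def vector_2)

lemma mk2_eta: "mk2 (A$1$1) (A$1$2) (A$2$1) (A$2$2) = A"
  by (simp add: vec_eq_iff forall_2)

lemma mk2_cases: obtains a b c d where "A = mk2 a b c d"
  by (rule that, rule mk2_eta[symmetric])

lemma mk2_eq_iff: "mk2 a b c d = mk2 a' b' c' d' \<longleftrightarrow> a = a' \<and> b = b' \<and> c = c' \<and> d = d'"
proof
  assume eq: "mk2 a b c d = mk2 a' b' c' d'"
  show "a = a' \<and> b = b' \<and> c = c' \<and> d = d'"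
    using arg_cong[OF eq, of "\<lambda>A. A$1$1"] arg_cong[OF eq, of "\<lambda>A. A$1$2"]
      arg_cong[OF eq, of "\<lambda>A. A$2$1"] arg_cong[OF eq, of "\<lambda>A. A$2$2"] by simp
qed simp

lemma mk2_mult:
  "mk2 a b c d ** mk2 a' b' c' d' =
    mk2 (a * a' + b * c') (a * b' + b * d') (c * a' + d * c') (c * b' + d * d' :: 'a::semiring_1)"
  by (simp add: vec_eq_iff forall_2 matrix_matrix_mult_def sum_2)

lemma mk2_vec_nth:
  "(A *v v) $ 1 = A$1$1 * v$1 + A$1$2 * v$2"
  "(A *v v) $ 2 = A$2$1 * v$1 + A$2$2 * v$2"
  for A :: "'a::semiring_1^2^2"
  by (simp_all add: matrix_vector_mult_def sum_2)

lemma mat_eq_mk2: "mat c = mk2 c 0 0 c"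
  by (simp add: vec_eq_iff forall_2 mat_def)

lemma det_mk2: "det (mk2 a b c d) = a * d - b * (c::'a::comm_ring_1)"
  by (simp add: det_2)

lemma trace_mk2: "trace (mk2 a b c d) = a + (d::'a::comm_ring_1)"
  by (simp add: trace_def sum_2)

definition scalar_mat :: "'a::zero^2^2 \<Rightarrow> bool" where
  "scalar_mat A \<longleftrightarrow> (\<exists>c. A = mat c)"

lemma scalar_mk2: "scalar_mat (mk2 a b c d) \<longleftrightarrow> b = 0 \<and> c = 0 \<and> a = d"
  by (auto simp: scalar_mat_def mat_eq_mk2 mk2_eq_iff)

text \<open>A nonscalar matrix has a cyclic vector v = (x, y): the columns of P are v and A v. The
  determinant of P is a quadratic form in x and y, and its values at (1, 0), (0, 1) and (1, 1) all
  vanish only if A is scalar.\<close>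

lemma nonscalar_companion:
  fixes A :: "'a::field^2^2"
  assumes "\<not> scalar_mat A"
  shows "\<exists>P. det P \<noteq> 0 \<and> A ** P = P ** mk2 0 (- det A) 1 (trace A)"
proof -
  obtain a b c d where A: "A = mk2 a b c d" by (rule mk2_cases)
  have key: "A ** mk2 x (a * x + b * y) y (c * x + d * y)
      = mk2 x (a * x + b * y) y (c * x + d * y) ** mk2 0 (- det A) 1 (trace A)" for x y
    by (simp add: A mk2_mult det_mk2 trace_mk2 mk2_eq_iff algebra_simps)
  have "\<exists>x y. x * (c * x + d * y) - (a * x + b * y) * y \<noteq> 0"
  proof (rule ccontr)
    assume "\<not> ?thesis"
    then have *: "x * (c * x + d * y) - (a * x + b * y) * y = 0" for x y by blast
    have "c = 0" "b = 0" "a = d" using *[of 1 0] *[of 0 1] *[of 1 1] by auto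
    then show False using assms by (simp add: A scalar_mk2)
  qed
  then obtain x y where "x * (c * x + d * y) - (a * x + b * y) * y \<noteq> 0" by blast
  then show ?thesis using key[of x y] by (intro exI[of _ "mk2 x (a * x + b * y) y (c * x + d * y)"]) (simp add: det_mk2)
qed

text \<open>Both matrices are similar to the same companion matrix. Trace and determinant thus
  separate the nonscalar conjugacy classes, which turns membership in the connection set into a
  condition on these two values.\<close>

lemma nonscalar_similar:
  fixes A B :: "'a::field^2^2"
  assumes "\<not> scalar_mat A" "\<not> scalar_mat B" "trace A = trace B" "det A = det B"
  shows "\<exists>P. det P \<noteq> 0 \<and> A ** P = P ** B"
proof -
  obtain P where P: "det P \<noteq> 0" "A ** P = P ** mk2 0 (- det A) 1 (trace A)"
    using nonscalar_companion[OF assms(1)] by blast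
  obtain Q where Q: "det Q \<noteq> 0" "B ** Q = Q ** mk2 0 (- det A) 1 (trace A)"
    using nonscalar_companion[OF assms(2)] unfolding assms(3,4) by blast
  obtain Q' where Q': "Q ** Q' = mat 1" "Q' ** Q = mat 1"
    using Q(1) invertible_det_nz[of Q] by (auto simp: invertible_def)
  have "det Q * det Q' = 1" using arg_cong[OF Q'(1), of det] by (simp add: det_mul)
  then have "det (P ** Q') \<noteq> 0" using P(1) by (auto simp: det_mul)
  moreover have "A ** (P ** Q') = (P ** Q') ** B"
  proof -
    have "A ** (P ** Q') = P ** mk2 0 (- det A) 1 (trace A) ** Q'"
      by (simp add: matrix_mul_assoc P(2))
    also have "\<dots> = P ** (Q' ** Q) ** mk2 0 (- det A) 1 (trace A) ** Q'" by (simp add: Q')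
    also have "\<dots> = P ** Q' ** (Q ** mk2 0 (- det A) 1 (trace A)) ** Q'"
      by (simp add: matrix_mul_assoc)
    also have "\<dots> = P ** Q' ** B ** (Q ** Q')" by (simp add: Q(2)[symmetric] matrix_mul_assoc)
    finally show ?thesis by (simp add: Q')
  qed
  ultimately show ?thesis by blast
qed

section \<open>The area form of the plane and counts of matrices by their values on vectors\<close>

definition cross2 :: "'a::comm_ring_1^2 \<Rightarrow> 'a^2 \<Rightarrow> 'a" where
  "cross2 u w = u$1 * w$2 - u$2 * w$1"

lemma cross2_mult: "cross2 (A *v u) (A *v w) = det A * cross2 u w"
  by (simp add: cross2_def mk2_vec_nth det_2 algebra_simps)

lemma cross2_simps [simp]:
  "cross2 u u = 0" "cross2 (c *s u) w = c * cross2 u w" "cross2 u (c *s w) = c * cross2 u w"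
  "cross2 (u + u') w = cross2 u w + cross2 u' w" "cross2 u (w + w') = cross2 u w + cross2 u w'"
  "cross2 (u - u') w = cross2 u w - cross2 u' w" "cross2 u (w - w') = cross2 u w - cross2 u w'"
  "cross2 0 w = 0" "cross2 w 0 = 0"
  by (simp_all add: cross2_def algebra_simps)

lemma cross2_swap: "cross2 w u = - cross2 u w"
  by (simp add: cross2_def)

lemma cross2_eq_0:
  fixes u w :: "'a::field^2"
  assumes "u \<noteq> 0" "cross2 u w = 0"
  shows "\<exists>c. w = c *s u"
proof -
  consider "u$1 \<noteq> 0" | "u$2 \<noteq> 0" using assms(1) by (auto simp: vec_eq_iff forall_2)
  then show ?thesis
  proof cases
    case 1 then show ?thesis using assms(2)
      by (intro exI[of _ "w$1 / u$1"]) (auto simp: vec_eq_iff forall_2 cross2_def field_simps)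
  next
    case 2 then show ?thesis using assms(2)
      by (intro exI[of _ "w$2 / u$2"]) (auto simp: vec_eq_iff forall_2 cross2_def field_simps)
  qed
qed

lemma cross2_ex_one:
  fixes u :: "'a::field^2"
  assumes "u \<noteq> 0"
  shows "\<exists>w. cross2 u w = 1"
proof -
  consider "u$1 \<noteq> 0" | "u$2 \<noteq> 0" using assms(1) by (auto simp: vec_eq_iff forall_2)
  then show ?thesis
  proof cases
    case 1 then show ?thesis
      by (intro exI[of _ "vector [0, 1 / u$1]"]) (auto simp: cross2_def vector_2)
  next
    case 2 then show ?thesis
      by (intro exI[of _ "vector [- 1 / u$2, 0]"]) (auto simp: cross2_def vector_2)
  qed
qed

text \<open>The entries of \<open>?A\<close> are Cramer's rule. For uniqueness, a row that
  annihilates both \<open>u\<close> and \<open>w\<close> has entries that vanish after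
  multiplication by \<open>cross2 u w\<close>.\<close>

lemma matrix_by_basis:
  fixes u w p r :: "'a::field^2"
  assumes "cross2 u w \<noteq> 0"
  shows "\<exists>!A. A *v u = p \<and> A *v w = r"
proof -
  let ?A = "mk2 ((p$1 * w$2 - r$1 * u$2) / cross2 u w) ((r$1 * u$1 - p$1 * w$1) / cross2 u w)
     ((p$2 * w$2 - r$2 * u$2) / cross2 u w) ((r$2 * u$1 - p$2 * w$1) / cross2 u w)"
  have ex: "?A *v u = p \<and> ?A *v w = r"
    using assms by (simp add: vec_eq_iff forall_2 mk2_vec_nth divide_simps)
      (simp add: cross2_def algebra_simps)
  have uniq: "A = B" if AB: "A *v u = B *v u" "A *v w = B *v w" for A B :: "'a^2^2"
  proof -
    have *: "x * cross2 u w = 0 \<and> y * cross2 u w = 0"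
      if "x * u$1 + y * u$2 = 0" "x * w$1 + y * w$2 = 0" for x y
    proof -
      have "x * cross2 u w = w$2 * (x * u$1 + y * u$2) - u$2 * (x * w$1 + y * w$2)"
        "y * cross2 u w = u$1 * (x * w$1 + y * w$2) - w$1 * (x * u$1 + y * u$2)"
        by (simp_all add: cross2_def algebra_simps)
      then show ?thesis using that by simp
    qed
    have "A $ i $ 1 - B $ i $ 1 = 0 \<and> A $ i $ 2 - B $ i $ 2 = 0" for i
      using *[of "A $ i $ 1 - B $ i $ 1" "A $ i $ 2 - B $ i $ 2"] assms
        arg_cong[OF AB(1), of "\<lambda>v. v $ i"] arg_cong[OF AB(2), of "\<lambda>v. v $ i"]
      by (simp add: matrix_vector_mult_def sum_2 algebra_simps)
    then show "A = B" by (simp add: vec_eq_iff forall_2)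
  qed
  show ?thesis
  proof (rule ex1I[of _ ?A], rule ex)
    fix B assume "B *v u = p \<and> B *v w = r"
    then show "B = ?A" using ex by (intro uniq) simp_all
  qed
qed

lemma card_parallel:
  fixes u :: "'a::{field,finite}^2"
  assumes "u \<noteq> 0"
  shows "card {w. w \<noteq> 0 \<and> cross2 u w = 0} = CARD('a) - 1"
proof -
  have "{w. w \<noteq> 0 \<and> cross2 u w = 0} = (\<lambda>c. c *s u) ` (- {0})"
    using cross2_eq_0[OF assms] assms by (fastforce simp: vec.scale_eq_0_iff)
  moreover have "inj_on (\<lambda>c. c *s u) (- {0})"
    using assms by (auto simp: inj_on_def vec.scale_cancel_right)
  ultimately show ?thesis by (simp add: card_image card_nonzero)
qed

lemma card_cross2_eq:
  fixes u :: "'a::{field,finite}^2"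
  assumes "u \<noteq> 0"
  shows "card {w. cross2 u w = d} = CARD('a)"
proof -
  obtain w' where w': "cross2 u w' = 1" using cross2_ex_one[OF assms] by blast
  have "{w. cross2 u w = d} = (\<lambda>c. d *s w' + c *s u) ` UNIV"
  proof (intro Set.set_eqI iffI)
    fix w assume "w \<in> {w. cross2 u w = d}"
    then have "cross2 u (w - d *s w') = 0" by (simp add: w')
    from cross2_eq_0[OF assms this] show "w \<in> (\<lambda>c. d *s w' + c *s u) ` UNIV"
      by (auto simp: algebra_simps)
  qed (auto simp: w')
  moreover have "inj (\<lambda>c. d *s w' + c *s u)"
    using assms by (auto simp: inj_def vec.scale_cancel_right)
  ultimately show ?thesis by (simp add: card_image)
qed

text \<open>Completing \<open>w\<close> by a vector \<open>w'\<close> with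
  \<open>cross2 w w' = 1\<close>, a matrix is given by \<open>p\<close> and r = A w', and its
  determinant is \<open>cross2 p r\<close>. The admissible r form an affine line because
  \<open>p\<close> is not zero.\<close>

lemma card_matrix_eigen_det:
  fixes w :: "'a::{field,finite}^2"
  assumes "w \<noteq> 0" "p \<noteq> 0"
  shows "card {A. A *v w = p \<and> det A = d} = CARD('a)"
proof -
  obtain w' where w': "cross2 w w' = 1" using cross2_ex_one[OF assms(1)] by blast
  then have nz: "cross2 w w' \<noteq> 0" by simp
  have "bij_betw (\<lambda>A. A *v w') {A. A *v w = p \<and> det A = d} {r. cross2 p r = d}"
  proof (rule bij_betwI')
    fix A B assume "A \<in> {A. A *v w = p \<and> det A = d}" "B \<in> {A. A *v w = p \<and> det A = d}"
    then show "A *v w' = B *v w' \<longleftrightarrow> A = B"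
      using matrix_by_basis[OF nz, of p "A *v w'"] by auto
  next
    fix A assume "A \<in> {A. A *v w = p \<and> det A = d}"
    then show "A *v w' \<in> {r. cross2 p r = d}" using cross2_mult[of A w w'] w' by auto
  next
    fix r assume "r \<in> {r. cross2 p r = d}"
    moreover obtain A where "A *v w = p" "A *v w' = r" using matrix_by_basis[OF nz, of p r] by blast
    ultimately show "\<exists>A\<in>{A. A *v w = p \<and> det A = d}. r = A *v w'"
      using cross2_mult[of A w w'] w' by auto
  qed
  then show ?thesis using card_cross2_eq[OF assms(2)] by (simp add: bij_betw_same_card)
qed

section \<open>The algebra of class functions\<close>

interpretation gl2: group "GL2 :: 'a::field gl2 monoid"
  rewrites "carrier (GL2 :: 'a gl2 monoid) = UNIV"
  by (simp_all add: group_GL2 GL2_simps)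

abbreviation gl2_mult :: "'a::field gl2 \<Rightarrow> 'a gl2 \<Rightarrow> 'a gl2" (infixl "\<odot>" 70) where
  "g \<odot> h \<equiv> g \<otimes>\<^bsub>GL2\<^esub> h"

abbreviation gl2_inv :: "'a::field gl2 \<Rightarrow> 'a gl2" where
  "gl2_inv g \<equiv> inv\<^bsub>GL2\<^esub> g"

lemma gl2_inv_cancel [simp]:
  "gl2_inv g \<odot> (g \<odot> h) = h" "g \<odot> (gl2_inv g \<odot> h) = h"
  "h \<odot> gl2_inv g \<odot> g = h" "h \<odot> g \<odot> gl2_inv g = h"
  by (simp_all add: gl2.m_assoc flip: gl2.m_assoc[of "gl2_inv g"] gl2.m_assoc[of g])

lemma gl2_inv_mult: "gl2_inv (g \<odot> h) = gl2_inv h \<odot> gl2_inv g"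
  by (simp add: gl2.inv_mult_group)

lemma gl2_sum_left_translate: "(\<Sum>h\<in>UNIV. F (g \<odot> h)) = (\<Sum>h\<in>UNIV. F h)"
  for F :: "'a::{field,finite} gl2 \<Rightarrow> 'b::comm_monoid_add"
  by (rule sum.reindex_bij_witness[of _ "\<lambda>h. gl2_inv g \<odot> h" "\<lambda>h. g \<odot> h"]) auto

lemma gl2_sum_right_translate: "(\<Sum>h\<in>UNIV. F (h \<odot> g)) = (\<Sum>h\<in>UNIV. F h)"
  for F :: "'a::{field,finite} gl2 \<Rightarrow> 'b::comm_monoid_add"
  by (rule sum.reindex_bij_witness[of _ "\<lambda>h. h \<odot> gl2_inv g" "\<lambda>h. h \<odot> g"]) auto

lemma gl2_sum_inv: "(\<Sum>h\<in>UNIV. F (gl2_inv h)) = (\<Sum>h\<in>UNIV. F h)"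
  for F :: "'a::{field,finite} gl2 \<Rightarrow> 'b::comm_monoid_add"
  by (rule sum.reindex_bij_witness[of _ gl2_inv gl2_inv]) auto

lemma gl2_mult_inv_eq_one: "u \<odot> gl2_inv v = \<one>\<^bsub>GL2\<^esub> \<longleftrightarrow> u = v"
proof
  assume "u \<odot> gl2_inv v = \<one>\<^bsub>GL2\<^esub>"
  then have "u \<odot> gl2_inv v \<odot> v = \<one>\<^bsub>GL2\<^esub> \<odot> v" by simp
  then show "u = v" by simp
qed simp

definition convolution ::
    "('a::{field,finite} gl2 \<Rightarrow> complex) \<Rightarrow> ('a gl2 \<Rightarrow> complex) \<Rightarrow> 'a gl2 \<Rightarrow> complex" where
  "convolution f f' k = (\<Sum>h\<in>UNIV. f (k \<odot> gl2_inv h) * f' h)"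

lemma convolution_assoc: "convolution (convolution a b) c = convolution a (convolution b c)"
proof
  fix k
  have "convolution (convolution a b) c k
      = (\<Sum>h\<in>UNIV. \<Sum>l\<in>UNIV. a (k \<odot> gl2_inv h \<odot> gl2_inv l) * b l * c h)"
    by (simp add: convolution_def sum_distrib_right)
  also have "\<dots> = (\<Sum>h\<in>UNIV. \<Sum>l\<in>UNIV. a (k \<odot> gl2_inv h \<odot> gl2_inv (l \<odot> gl2_inv h)) * b (l \<odot> gl2_inv h) * c h)"
    by (rule sum.cong[OF refl], rule gl2_sum_right_translate[symmetric])
  also have "\<dots> = (\<Sum>l\<in>UNIV. \<Sum>h\<in>UNIV. a (k \<odot> gl2_inv h \<odot> gl2_inv (l \<odot> gl2_inv h)) * b (l \<odot> gl2_inv h) * c h)"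
    by (rule sum.swap)
  also have "\<dots> = convolution a (convolution b c) k"
    by (simp add: convolution_def gl2_inv_mult gl2.m_assoc sum_distrib_left mult.assoc)
  finally show "convolution (convolution a b) c k = convolution a (convolution b c) k" .
qed

text \<open>Class functions are central in the group algebra: replacing h by the inverse of h times
  k exchanges the two factors once the argument of \<open>b\<close> may be rotated.\<close>

lemma convolution_class_commute:
  assumes "\<forall>g h. b (g \<odot> h) = b (h \<odot> g)"
  shows "convolution a b = convolution b a"
proof
  fix k
  have "convolution a b k = (\<Sum>h\<in>UNIV. a (k \<odot> gl2_inv (h \<odot> k)) * b (h \<odot> k))"
    unfolding convolution_def by (rule gl2_sum_right_translate[symmetric])
  also have "\<dots> = (\<Sum>h\<in>UNIV. a (k \<odot> gl2_inv (gl2_inv h \<odot> k)) * b (gl2_inv h \<odot> k))"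
    by (rule gl2_sum_inv[symmetric])
  also have "\<dots> = convolution b a k"
    unfolding convolution_def
  proof (rule sum.cong[OF refl])
    fix h
    have "b (gl2_inv h \<odot> k) = b (k \<odot> gl2_inv h)" using assms by blast
    then show "a (k \<odot> gl2_inv (gl2_inv h \<odot> k)) * b (gl2_inv h \<odot> k) = b (k \<odot> gl2_inv h) * a h"
      by (simp add: gl2_inv_mult)
  qed
  finally show "convolution a b k = convolution b a k" .
qed

lemma convolution_class:
  assumes f: "\<forall>g h. f (g \<odot> h) = f (h \<odot> g)" and f': "\<forall>g h. f' (g \<odot> h) = f' (h \<odot> g)"
  shows "convolution f f' (g \<odot> h) = convolution f f' (h \<odot> g)"
proof -
  have "convolution f f' (g \<odot> h)
    = (\<Sum>k\<in>UNIV. f (g \<odot> h \<odot> gl2_inv (g \<odot> k)) * f' (g \<odot> k))"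
    unfolding convolution_def by (rule gl2_sum_left_translate[symmetric])
  also have "\<dots> = (\<Sum>k\<in>UNIV. f (g \<odot> h \<odot> gl2_inv (g \<odot> (k \<odot> gl2_inv g))) * f' (g \<odot> (k \<odot> gl2_inv g)))"
    by (rule gl2_sum_right_translate[symmetric])
  also have "\<dots> = convolution f f' (h \<odot> g)"
    unfolding convolution_def
  proof (rule sum.cong[OF refl])
    fix k
    have "f (g \<odot> h \<odot> gl2_inv (g \<odot> (k \<odot> gl2_inv g))) = f (g \<odot> (h \<odot> g \<odot> gl2_inv k \<odot> gl2_inv g))"
      by (simp add: gl2_inv_mult gl2.m_assoc)
    also have "\<dots> = f (h \<odot> g \<odot> gl2_inv k \<odot> gl2_inv g \<odot> g)" using f by blast
    finally have 1: "f (g \<odot> h \<odot> gl2_inv (g \<odot> (k \<odot> gl2_inv g))) = f (h \<odot> g \<odot> gl2_inv k)" by simp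
    have "f' (g \<odot> (k \<odot> gl2_inv g)) = f' (k \<odot> gl2_inv g \<odot> g)" using f' by blast
    then show "f (g \<odot> h \<odot> gl2_inv (g \<odot> (k \<odot> gl2_inv g))) * f' (g \<odot> (k \<odot> gl2_inv g))
      = f (h \<odot> g \<odot> gl2_inv k) * f' k" using 1 by simp
  qed
  finally show ?thesis .
qed

lemma convolution_one: "convolution (\<lambda>g. if g = \<one>\<^bsub>GL2\<^esub> then 1 else 0) f = f"
proof
  fix k
  have "convolution (\<lambda>g. if g = \<one>\<^bsub>GL2\<^esub> then 1 else 0) f k = (\<Sum>h\<in>UNIV. if k = h then f h else 0)"
    unfolding convolution_def by (rule sum.cong[OF refl]) (simp add: gl2_mult_inv_eq_one)
  then show "convolution (\<lambda>g. if g = \<one>\<^bsub>GL2\<^esub> then 1 else 0) f k = f k" by simp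
qed

text \<open>A separate type makes the class functions an instance of \<open>comm_ring_1\<close>,
  with convolution as product. Structure constants are then computed by ring normalisation, integer
  scalars being written \<open>of_int n\<close>.\<close>

typedef (overloaded) 'a class_fun =
    "{f :: 'a::{field,finite} gl2 \<Rightarrow> complex. \<forall>g h. f (g \<odot> h) = f (h \<odot> g)}"
  morphisms cf_apply Abs_class_fun
  by (rule exI[of _ "\<lambda>_. 0"]) simp

setup_lifting type_definition_class_fun

lemma gl2_mult_eq_one_commute: "g \<odot> h = \<one>\<^bsub>GL2\<^esub> \<longleftrightarrow> h \<odot> g = \<one>\<^bsub>GL2\<^esub>"
proof -
  have "h \<odot> g = \<one>\<^bsub>GL2\<^esub>" if "g \<odot> h = \<one>\<^bsub>GL2\<^esub>" for g h :: "'a gl2"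
    using gl2.inv_equality[OF that] by auto
  then show ?thesis by blast
qed

instantiation class_fun :: ("{field,finite}") comm_ring_1
begin

lift_definition zero_class_fun :: "'a class_fun" is "\<lambda>_. 0" by simp
lift_definition one_class_fun :: "'a class_fun" is "\<lambda>g. if g = \<one>\<^bsub>GL2\<^esub> then 1 else 0"
  by (subst gl2_mult_eq_one_commute) simp
lift_definition plus_class_fun :: "'a class_fun \<Rightarrow> 'a class_fun \<Rightarrow> 'a class_fun" is
  "\<lambda>f f' g. f g + f' g" by simp
lift_definition minus_class_fun :: "'a class_fun \<Rightarrow> 'a class_fun \<Rightarrow> 'a class_fun" is
  "\<lambda>f f' g. f g - f' g" by simp
lift_definition uminus_class_fun :: "'a class_fun \<Rightarrow> 'a class_fun" is "\<lambda>f g. - f g" by simp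
lift_definition times_class_fun :: "'a class_fun \<Rightarrow> 'a class_fun \<Rightarrow> 'a class_fun" is
  convolution by (rule convolution_class) auto

instance
proof
  fix a b c :: "'a class_fun"
  show "a * b * c = a * (b * c)" by transfer (rule convolution_assoc)
  show "a * b = b * a" by transfer (rule convolution_class_commute)
  show "1 * a = a" by transfer (rule convolution_one)
  show "(a + b) * c = a * c + b * c"
    by transfer (simp add: convolution_def distrib_right sum.distrib fun_eq_iff)
  show "a + b + c = a + (b + c)" by transfer (simp add: add.assoc)
  show "a + b = b + a" by transfer (simp add: add.commute)
  show "0 + a = a" by transfer simp
  show "- a + a = 0" by transfer simp
  show "a - b = a + - b" by transfer simp
  show "(0::'a class_fun) \<noteq> 1" by transfer (auto simp: fun_eq_iff)
qed

end

lemma cf_eqI: "(\<And>g. cf_apply f g = cf_apply f' g) \<Longrightarrow> f = f'"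
  by transfer auto

lemma cf_apply_simps [simp]:
  "cf_apply 0 g = 0"
  "cf_apply (f + f') g = cf_apply f g + cf_apply f' g"
  "cf_apply (f - f') g = cf_apply f g - cf_apply f' g"
  "cf_apply (- f) g = - cf_apply f g"
  by (transfer, simp)+

lemma cf_apply_1: "cf_apply 1 g = (if g = \<one>\<^bsub>GL2\<^esub> then 1 else 0)"
  by transfer simp

lemma cf_apply_mult: "cf_apply (f * f') k = (\<Sum>h\<in>UNIV. cf_apply f (k \<odot> gl2_inv h) * cf_apply f' h)"
  by transfer (rule convolution_def)

lemma cf_apply_sum [simp]: "cf_apply (sum f A) g = (\<Sum>a\<in>A. cf_apply (f a) g)"
  by (induction A rule: infinite_finite_induct) auto

lemma cf_apply_of_nat_mult [simp]: "cf_apply (of_nat n * f) g = of_nat n * cf_apply f g"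
  by (induction n) (auto simp: algebra_simps)

lemma cf_apply_of_int_mult [simp]: "cf_apply (of_int n * f) g = of_int n * cf_apply f g"
  by (cases n rule: int_diff_cases) (simp add: left_diff_distrib)

lemma cf_apply_numeral_mult [simp]: "cf_apply (numeral n * f) g = numeral n * cf_apply f g"
  using cf_apply_of_nat_mult[of "numeral n" f g] by simp

text \<open>Convolution by \<open>f\<close> from the left, as a matrix. For the indicator of a
  connection set this is the adjacency matrix of \<open>Cay\<close>, except that \<open>Cay\<close>
  tests v times the inverse of u for the arc from u to v; the two agree for a set closed under
  inverses.\<close>

definition regular_rep :: "'a::{field,finite} class_fun \<Rightarrow> complex^'a gl2^'a gl2" where
  "regular_rep f = (\<chi> u v. cf_apply f (u \<odot> gl2_inv v))"

lemma regular_rep_simps: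
  "regular_rep 0 = 0"
  "regular_rep (f + f') = regular_rep f + regular_rep f'"
  "regular_rep (f - f') = regular_rep f - regular_rep f'"
  "regular_rep (- f) = - regular_rep f"
  by (simp_all add: regular_rep_def vec_eq_iff)

lemma regular_rep_mult: "regular_rep (f * f') = regular_rep f ** regular_rep f'"
proof (simp add: vec_eq_iff, intro allI)
  fix u v
  have "regular_rep (f * f') $ u $ v
      = (\<Sum>h\<in>UNIV. cf_apply f (u \<odot> gl2_inv v \<odot> gl2_inv h) * cf_apply f' h)"
    by (simp add: regular_rep_def cf_apply_mult)
  also have "\<dots> = (\<Sum>h\<in>UNIV. cf_apply f (u \<odot> gl2_inv v \<odot> gl2_inv (h \<odot> gl2_inv v)) * cf_apply f' (h \<odot> gl2_inv v))"
    by (rule gl2_sum_right_translate[symmetric])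
  also have "\<dots> = (regular_rep f ** regular_rep f') $ u $ v"
    by (simp add: regular_rep_def matrix_matrix_mult_def gl2_inv_mult gl2.m_assoc)
  finally show "regular_rep (f * f') $ u $ v = (regular_rep f ** regular_rep f') $ u $ v" .
qed

lemma regular_rep_of_int: "regular_rep (of_int n) = mat (of_int n)"
proof -
  have "cf_apply (of_int n) g = (if g = \<one>\<^bsub>GL2\<^esub> then of_int n else 0)" for g :: "'a gl2"
    using cf_apply_of_int_mult[of n 1 g] by (simp add: cf_apply_1)
  then show ?thesis by (simp add: regular_rep_def vec_eq_iff mat_def gl2_mult_inv_eq_one)
qed

section \<open>Scalars, determinants and eigenvectors\<close>

abbreviation gl2_act :: "'a::field gl2 \<Rightarrow> 'a^2 \<Rightarrow> 'a^2" (infixr "\<bullet>\<^sub>v" 75) where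
  "g \<bullet>\<^sub>v v \<equiv> mat_of_gl2 g *v v"

abbreviation gl2_det :: "'a::field gl2 \<Rightarrow> 'a" where
  "gl2_det g \<equiv> det (mat_of_gl2 g)"

lemma gl2_det_nz [simp]: "gl2_det g \<noteq> 0"
  using mat_of_gl2[of g] by (simp add: invertible_det_nz)

lemma gl2_det_mult [simp]: "gl2_det (g \<odot> h) = gl2_det g * gl2_det h"
  by (simp add: GL2_simps det_mul)

lemma gl2_det_one [simp]: "gl2_det (\<one>\<^bsub>GL2\<^esub>) = 1"
  by (simp add: GL2_simps)

lemma gl2_det_inv [simp]: "gl2_det (gl2_inv g) = inverse (gl2_det g)"
  using gl2_det_mult[of g "gl2_inv g"] by (simp add: field_simps)

lemma gl2_act_mult: "(g \<odot> h) \<bullet>\<^sub>v v = g \<bullet>\<^sub>v h \<bullet>\<^sub>v v"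
  by (simp add: GL2_simps matrix_vector_mul_assoc)

lemma gl2_act_one [simp]: "\<one>\<^bsub>GL2\<^esub> \<bullet>\<^sub>v v = v"
  by (simp add: GL2_simps)

lemma gl2_act_inv [simp]: "gl2_inv g \<bullet>\<^sub>v g \<bullet>\<^sub>v v = v" "g \<bullet>\<^sub>v gl2_inv g \<bullet>\<^sub>v v = v"
  by (simp_all flip: gl2_act_mult)

lemma gl2_act_eq_iff: "gl2_inv g \<bullet>\<^sub>v v = w \<longleftrightarrow> v = g \<bullet>\<^sub>v w"
  by auto

lemma gl2_act_eq_0 [simp]: "g \<bullet>\<^sub>v v = 0 \<longleftrightarrow> v = 0"
  by (metis gl2_act_inv(1) matrix_vector_mult_0_right)

lemma gl2_act_scale: "g \<bullet>\<^sub>v (c *s v) = c *s (g \<bullet>\<^sub>v v)"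
  by (simp add: vector_scalar_commute)

lemma gl2_obtain_matrix: "det A \<noteq> 0 \<Longrightarrow> \<exists>g. mat_of_gl2 g = A"
  by (metis gl2_of_mat_inverse invertible_det_nz mem_Collect_eq)

text \<open>Turns a sum over the group into a count of matrices; invertibility is not lost because
  the property itself forces a nonzero determinant.\<close>

lemma sum_of_bool_gl2:
  assumes "\<And>A. P A \<Longrightarrow> det A \<noteq> 0"
  shows "(\<Sum>g\<in>UNIV. of_bool (P (mat_of_gl2 (g :: 'a::{field,finite} gl2)))) = (of_nat (card {A. P A}) :: 'b::semiring_1)"
proof -
  have "bij_betw mat_of_gl2 {g. P (mat_of_gl2 g)} {A. P A}"
    using gl2_obtain_matrix assms
    by (fastforce simp: bij_betw_def inj_on_def mat_of_gl2_inject)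
  then have "card {g. P (mat_of_gl2 g)} = card {A. P A}" by (rule bij_betw_same_card)
  then show ?thesis by (simp add: sum_of_bool_eq)
qed

lemma sum_nonzero_act:
  "(\<Sum>v\<in>- {0}. F (g \<bullet>\<^sub>v v)) = (\<Sum>v\<in>- {0}. F v)"
  for g :: "'a::{field,finite} gl2"
  by (rule sum.reindex_bij_witness[of _ "\<lambda>v. gl2_inv g \<bullet>\<^sub>v v" "\<lambda>v. g \<bullet>\<^sub>v v"]) auto

lemma mat_act [simp]: "mat c *v v = c *s (v :: 'a::comm_ring_1^2)"
  by (simp add: mat_eq_mk2 vec_eq_iff forall_2 mk2_vec_nth)

lemma gl2_eq_mat_iff: "mat_of_gl2 g = mat c \<longleftrightarrow> (\<forall>v. g \<bullet>\<^sub>v v = c *s v)"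
  by (simp add: matrix_eq)

lemma gl2_act_eq_act_iff [simp]: "g \<bullet>\<^sub>v v = g \<bullet>\<^sub>v w \<longleftrightarrow> v = w"
proof
  assume "g \<bullet>\<^sub>v v = g \<bullet>\<^sub>v w"
  then have "gl2_inv g \<bullet>\<^sub>v g \<bullet>\<^sub>v v = gl2_inv g \<bullet>\<^sub>v g \<bullet>\<^sub>v w" by simp
  then show "v = w" by simp
qed simp

text \<open>\<open>h\<close> carries the eigenvectors of \<open>g \<odot> h\<close> to those of
  \<open>h \<odot> g\<close>, which is why counting eigenvectors gives a class function.\<close>

lemma gl2_eigen_swap: "(h \<odot> g) \<bullet>\<^sub>v h \<bullet>\<^sub>v v = a *s (h \<bullet>\<^sub>v v) \<longleftrightarrow> (g \<odot> h) \<bullet>\<^sub>v v = a *s v"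
  by (simp add: gl2_act_mult flip: gl2_act_scale)

lemma gl2_scalar_swap: "mat_of_gl2 (g \<odot> h) = mat c \<longleftrightarrow> mat_of_gl2 (h \<odot> g) = mat c"
proof -
  have "mat_of_gl2 (h \<odot> g) = mat c" if "mat_of_gl2 (g \<odot> h) = mat c" for g h :: "'a gl2"
    unfolding gl2_eq_mat_iff
  proof
    fix v
    have "(h \<odot> g) \<bullet>\<^sub>v h \<bullet>\<^sub>v gl2_inv h \<bullet>\<^sub>v v = c *s (h \<bullet>\<^sub>v gl2_inv h \<bullet>\<^sub>v v)"
      unfolding gl2_eigen_swap using that by (simp add: gl2_eq_mat_iff)
    then show "(h \<odot> g) \<bullet>\<^sub>v v = c *s v" by simp
  qed
  then show ?thesis by blast
qed

lemma sum_eigen_swap: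
  "(\<Sum>v\<in>- {0}. of_bool ((g \<odot> h) \<bullet>\<^sub>v v = a *s v)) =
    (\<Sum>v\<in>- {0}. of_bool ((h \<odot> g) \<bullet>\<^sub>v v = a *s v) :: complex)"
  for g h :: "'a::{field,finite} gl2"
  by (subst sum_nonzero_act[of _ h, symmetric]) (simp add: gl2_eigen_swap)

text \<open>
  \<open>eig_cf a b\<close> is \<open>q - 1\<close> times the sum, over all lines \<open>L\<close>, of the indicator of the elements acting
  as \<open>a\<close> on \<open>L\<close> and as \<open>b\<close> on the quotient by \<open>L\<close>; counting vectors in place of lines avoids division.
\<close>

definition scalar_cf :: "'a::{field,finite} \<Rightarrow> 'a class_fun" where
  "scalar_cf c = Abs_class_fun (\<lambda>g. of_bool (mat_of_gl2 g = mat c))"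

definition det_cf :: "'a::{field,finite} \<Rightarrow> 'a class_fun" where
  "det_cf a = Abs_class_fun (\<lambda>g. of_bool (gl2_det g = a))"

definition eig_cf :: "'a::{field,finite} \<Rightarrow> 'a \<Rightarrow> 'a class_fun" where
  "eig_cf a b = Abs_class_fun
    (\<lambda>g. of_bool (gl2_det g = a * b) * (\<Sum>v\<in>- {0}. of_bool (g \<bullet>\<^sub>v v = a *s v)))"

lemma cf_apply_Abs:
  assumes "\<forall>g h. f (g \<odot> h) = f (h \<odot> g)"
  shows "cf_apply (Abs_class_fun f) = f"
  by (rule Abs_class_fun_inverse) (rule CollectI, rule assms)

lemma cf_apply_scalar: "cf_apply (scalar_cf c) g = of_bool (mat_of_gl2 g = mat c)"
proof -
  have "\<forall>g h. of_bool (mat_of_gl2 (g \<odot> h) = mat c) = (of_bool (mat_of_gl2 (h \<odot> g) = mat c) :: complex)"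
    unfolding of_bool_eq_iff using gl2_scalar_swap by blast
  from cf_apply_Abs[OF this] show ?thesis by (simp add: scalar_cf_def)
qed

lemma cf_apply_det: "cf_apply (det_cf a) g = of_bool (gl2_det g = a)"
proof -
  have "\<forall>g h. of_bool (gl2_det (g \<odot> h) = a) = (of_bool (gl2_det (h \<odot> g) = a) :: complex)"
    by (simp add: mult.commute)
  from cf_apply_Abs[OF this] show ?thesis by (simp add: det_cf_def)
qed

lemma cf_apply_eig: "cf_apply (eig_cf a b) g =
    of_bool (gl2_det g = a * b) * (\<Sum>v\<in>- {0}. of_bool (g \<bullet>\<^sub>v v = a *s v))"
proof -
  define f :: "'a gl2 \<Rightarrow> complex" where
    "f = (\<lambda>g. of_bool (gl2_det g = a * b) * (\<Sum>v\<in>- {0}. of_bool (g \<bullet>\<^sub>v v = a *s v)))"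
  have "f (g \<odot> h) = f (h \<odot> g)" for g h
    unfolding f_def sum_eigen_swap[of g h] by (simp add: mult.commute)
  then have "cf_apply (Abs_class_fun f) = f" by (intro cf_apply_Abs allI)
  then show ?thesis unfolding eig_cf_def f_def[symmetric] by simp (simp add: f_def)
qed

lemmas cf_apply_basic = cf_apply_scalar cf_apply_det cf_apply_eig

lemma scalar_cf_one: "scalar_cf 1 = 1"
  by (rule cf_eqI) (auto simp: cf_apply_basic cf_apply_1 GL2_simps simp flip: mat_of_gl2_inject)

lemma cf_apply_scalar_mult:
  assumes "mat_of_gl2 s = mat c"
  shows "cf_apply (f * scalar_cf c) k = cf_apply f (k \<odot> gl2_inv s)"
proof -
  have "mat_of_gl2 h = mat c \<longleftrightarrow> h = s" for h by (simp flip: mat_of_gl2_inject add: assms)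
  then have "cf_apply (f * scalar_cf c) k = (\<Sum>h\<in>UNIV. if h = s then cf_apply f (k \<odot> gl2_inv h) else 0)"
    unfolding cf_apply_mult by (intro sum.cong) (auto simp: cf_apply_basic)
  then show ?thesis by simp
qed

lemma det_scalar: "det (mat c :: 'a::comm_ring_1^2^2) = c\<^sup>2"
  by (simp add: mat_eq_mk2 det_mk2 power2_eq_square)

lemma ex_scalar:
  assumes "(c::'a::field) \<noteq> 0"
  shows "\<exists>s. mat_of_gl2 s = mat c \<and> (\<forall>v. gl2_inv s \<bullet>\<^sub>v v = inverse c *s v) \<and> gl2_det s = c\<^sup>2"
proof -
  obtain s where s: "mat_of_gl2 s = mat c"
    using gl2_obtain_matrix[of "mat c"] assms by (auto simp: det_scalar)
  then show ?thesis using assms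
    by (intro exI[of _ s]) (simp add: gl2_act_eq_iff det_scalar)
qed

lemma inverse_scale_eq_iff:
  assumes "c \<noteq> 0"
  shows "inverse c *s v = w \<longleftrightarrow> v = c *s (w :: 'a::field^'n)"
  using assms by (auto simp: vec.scale_scale)

lemma scalar_scalar:
  assumes "a \<noteq> 0" "b \<noteq> 0"
  shows "scalar_cf a * scalar_cf b = scalar_cf (a * b)"
proof (rule cf_eqI)
  fix k
  obtain s where s: "mat_of_gl2 s = mat b"
    "\<forall>v. gl2_inv s \<bullet>\<^sub>v v = inverse b *s v" "gl2_det s = b\<^sup>2"
    using ex_scalar[OF assms(2)] by blast
  have "mat_of_gl2 (k \<odot> gl2_inv s) = mat a \<longleftrightarrow> mat_of_gl2 k = mat (a * b)"
    unfolding gl2_eq_mat_iff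
    by (simp add: gl2_act_mult s gl2_act_scale inverse_scale_eq_iff[OF assms(2)] mult.commute)
  then show "cf_apply (scalar_cf a * scalar_cf b) k = cf_apply (scalar_cf (a * b)) k"
    unfolding cf_apply_scalar_mult[OF s(1)] by (simp add: cf_apply_basic)
qed

lemma eig_scalar_cf:
  assumes "c \<noteq> 0"
  shows "eig_cf a b * scalar_cf c = eig_cf (a * c) (b * c)"
proof (rule cf_eqI)
  fix k
  obtain s where s: "mat_of_gl2 s = mat c"
    "\<forall>v. gl2_inv s \<bullet>\<^sub>v v = inverse c *s v" "gl2_det s = c\<^sup>2"
    using ex_scalar[OF assms] by blast
  have 1: "gl2_det (k \<odot> gl2_inv s) = a * b \<longleftrightarrow> gl2_det k = (a * c) * (b * c)"
  proof -
    have "d * inverse (c\<^sup>2) = e \<longleftrightarrow> d = e * c\<^sup>2" for d e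
      using assms by (simp add: nonzero_divide_eq_eq flip: divide_inverse)
    moreover have "a * b * c\<^sup>2 = (a * c) * (b * c)" by (simp add: power2_eq_square)
    ultimately show ?thesis by (simp only: gl2_det_mult gl2_det_inv s(3))
  qed
  have 2: "(k \<odot> gl2_inv s) \<bullet>\<^sub>v v = a *s v \<longleftrightarrow> k \<bullet>\<^sub>v v = (a * c) *s v" for v
    by (simp add: gl2_act_mult s(2) gl2_act_scale inverse_scale_eq_iff[OF assms] mult.commute)
  show "cf_apply (eig_cf a b * scalar_cf c) k = cf_apply (eig_cf (a * c) (b * c)) k"
    unfolding cf_apply_scalar_mult[OF s(1)] cf_apply_basic 1 2 by (rule refl)
qed

section \<open>Structure constants of the class algebra\<close>

lemma card_nonzero_of_int:
  "of_nat (card (- {0::'a::{zero,finite}})) = (of_int (int CARD('a) - 1) :: 'b::ring_1)"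
  by (simp add: card_nonzero of_nat_diff Suc_leI)

lemma card_nonzero_vec_of_int:
  "of_nat (card (- {0::'a::{field,finite}^2})) = (of_int (int CARD('a)^2 - 1) :: 'b::ring_1)"
  by (subst card_nonzero_of_int) simp

text \<open>Elements are sorted by the image of one fixed vector: there are q^2 - 1 possible images,
  and each occurs for q matrices of the given determinant.\<close>

lemma sum_gl2_det:
  fixes b :: "'a::{field,finite}"
  assumes "b \<noteq> 0"
  shows "(\<Sum>h\<in>UNIV. of_bool (gl2_det h = b)) =
    (of_int (int CARD('a) * (int CARD('a)^2 - 1)) :: complex)"
proof -
  define e :: "'a^2" where "e = axis 1 1"
  have e: "e \<noteq> 0" by (simp add: e_def axis_eq_0_iff)
  have "of_bool (gl2_det h = b) = (\<Sum>p\<in>- {0}. of_bool (h \<bullet>\<^sub>v e = p \<and> gl2_det h = b) :: complex)" for h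
  proof -
    have "(\<Sum>p\<in>- {0}. of_bool (h \<bullet>\<^sub>v e = p \<and> gl2_det h = b) :: complex)
      = (\<Sum>p\<in>- {0}. if p = h \<bullet>\<^sub>v e then of_bool (gl2_det h = b) else 0)"
      by (rule sum.cong) auto
    then show ?thesis using e by simp
  qed
  then have "(\<Sum>h\<in>UNIV. of_bool (gl2_det h = b)) =
      (\<Sum>h\<in>UNIV. \<Sum>p\<in>- {0}. of_bool (h \<bullet>\<^sub>v e = p \<and> gl2_det h = b) :: complex)"
    by simp
  also have "\<dots> = (\<Sum>p\<in>- {0}. \<Sum>h\<in>UNIV. of_bool (h \<bullet>\<^sub>v e = p \<and> gl2_det h = b))"
    by (rule sum.swap)
  also have "\<dots> = (\<Sum>p\<in>- {0::'a^2}. of_nat CARD('a))"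
  proof (rule sum.cong[OF refl])
    fix p :: "'a^2" assume "p \<in> - {0}"
    then have "card {A. A *v e = p \<and> det A = b} = CARD('a)"
      using card_matrix_eigen_det[OF e] by simp
    then show "(\<Sum>h\<in>UNIV. of_bool (h \<bullet>\<^sub>v e = p \<and> gl2_det h = b)) = (of_nat CARD('a) :: complex)"
      using sum_of_bool_gl2[of "\<lambda>A. A *v e = p \<and> det A = b", where ?'b = complex] assms by simp
  qed
  also have "\<dots> = of_int (int CARD('a) * (int CARD('a)^2 - 1))"
    by (simp add: card_nonzero_vec_of_int)
  finally show ?thesis .
qed

text \<open>Exchanging the sums, each of the q^2 - 1 nonzero vectors is an eigenvector of q matrices
  with the given eigenvalue and determinant. The result does not depend on either of them and equals
  the size of a determinant class.\<close>

lemma sum_gl2_eigen_det: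
  fixes a b :: "'a::{field,finite}"
  assumes "a \<noteq> 0" "b \<noteq> 0"
  shows "(\<Sum>h\<in>UNIV. of_bool (gl2_det h = b) * (\<Sum>v\<in>- {0}. of_bool (h \<bullet>\<^sub>v v = a *s v))) =
    (of_int (int CARD('a) * (int CARD('a)^2 - 1)) :: complex)"
proof -
  have "(\<Sum>h\<in>UNIV. of_bool (gl2_det h = b) * (\<Sum>v\<in>- {0}. of_bool (h \<bullet>\<^sub>v v = a *s v)))
      = (\<Sum>h\<in>UNIV. \<Sum>v\<in>- {0}. of_bool (h \<bullet>\<^sub>v v = a *s v \<and> gl2_det h = b) :: complex)"
    unfolding sum_distrib_left by (intro sum.cong refl) auto
  also have "\<dots> = (\<Sum>v\<in>- {0}. \<Sum>h\<in>UNIV. of_bool (h \<bullet>\<^sub>v v = a *s v \<and> gl2_det h = b))"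
    by (rule sum.swap)
  also have "\<dots> = (\<Sum>v\<in>- {0::'a^2}. of_nat CARD('a))"
  proof (rule sum.cong[OF refl])
    fix v :: "'a^2" assume "v \<in> - {0}"
    then have "card {A. A *v v = a *s v \<and> det A = b} = CARD('a)"
      using card_matrix_eigen_det[of v "a *s v" b] assms by (simp add: vec.scale_eq_0_iff)
    then show "(\<Sum>h\<in>UNIV. of_bool (h \<bullet>\<^sub>v v = a *s v \<and> gl2_det h = b)) = (of_nat CARD('a) :: complex)"
      using sum_of_bool_gl2[of "\<lambda>A. A *v v = a *s v \<and> det A = b", where ?'b = complex] assms by simp
  qed
  also have "\<dots> = of_int (int CARD('a) * (int CARD('a)^2 - 1))"
    by (simp add: card_nonzero_vec_of_int)
  finally show ?thesis .
qed

lemma gl2_det_quotient: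
  assumes "gl2_det h = b"
  shows "gl2_det (k \<odot> gl2_inv h) = a \<longleftrightarrow> gl2_det k = a * b"
proof -
  have "b \<noteq> 0" using assms gl2_det_nz by auto
  then show ?thesis using assms by (simp add: nonzero_divide_eq_eq flip: divide_inverse)
qed

text \<open>\<open>det_cf\<close> is the indicator of a coset of the special linear group, so
  convolution with it sees only the total mass of the other factor on each determinant. The same
  argument proves \<open>det_eig\<close>.\<close>

lemma det_det:
  fixes a b :: "'a::{field,finite}"
  assumes "b \<noteq> 0"
  shows "det_cf a * det_cf b = of_int (int CARD('a) * (int CARD('a)^2 - 1)) * det_cf (a * b)"
proof (rule cf_eqI)
  fix k :: "'a gl2"
  have "cf_apply (det_cf a * det_cf b) k
      = (\<Sum>h\<in>UNIV. of_bool (gl2_det k = a * b) * of_bool (gl2_det h = b))"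
    unfolding cf_apply_mult cf_apply_det
    by (rule sum.cong[OF refl]) (auto simp: gl2_det_quotient simp del: gl2_det_mult gl2_det_inv)
  also have "\<dots> = of_bool (gl2_det k = a * b) * of_int (int CARD('a) * (int CARD('a)^2 - 1))"
    unfolding sum_distrib_left[symmetric] sum_gl2_det[OF assms] ..
  finally show "cf_apply (det_cf a * det_cf b) k
    = cf_apply (of_int (int CARD('a) * (int CARD('a)^2 - 1)) * det_cf (a * b)) k"
    unfolding cf_apply_of_int_mult cf_apply_det by (rule trans) (rule mult.commute)
qed

lemma det_eig:
  fixes a b c :: "'a::{field,finite}"
  assumes "a \<noteq> 0" "b \<noteq> 0"
  shows "det_cf c * eig_cf a b = of_int (int CARD('a) * (int CARD('a)^2 - 1)) * det_cf (a * b * c)"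
proof (rule cf_eqI)
  fix k :: "'a gl2"
  have "cf_apply (det_cf c * eig_cf a b) k
      = (\<Sum>h\<in>UNIV. of_bool (gl2_det k = c * (a * b)) *
          (of_bool (gl2_det h = a * b) * (\<Sum>v\<in>- {0}. of_bool (h \<bullet>\<^sub>v v = a *s v))))"
    unfolding cf_apply_mult cf_apply_det cf_apply_eig
    by (rule sum.cong[OF refl]) (auto simp: gl2_det_quotient simp del: gl2_det_mult gl2_det_inv)
  also have "\<dots> = of_bool (gl2_det k = c * (a * b)) * of_int (int CARD('a) * (int CARD('a)^2 - 1))"
    unfolding sum_distrib_left[symmetric]
    using sum_gl2_eigen_det[of a "a * b"] assms by simp
  finally show "cf_apply (det_cf c * eig_cf a b) k
    = cf_apply (of_int (int CARD('a) * (int CARD('a)^2 - 1)) * det_cf (a * b * c)) k"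
    unfolding cf_apply_of_int_mult cf_apply_det mult.commute[of c "a * b"]
    by (rule trans) (rule mult.commute)
qed

text \<open>
  In \<open>eig_cf a b * eig_cf c d\<close> at \<open>K\<close> one counts factorizations \<open>K = G A\<close> with eigenvectors \<open>v\<close> of
  \<open>G\<close> and \<open>w\<close> of \<open>A\<close>.  With \<open>v = K u\<close>, the condition \<open>G v = a v\<close> reads \<open>a (A u) = K u\<close>, which leaves
  a condition on \<open>A\<close> alone.
\<close>

lemma card_two_eigen_parallel:
  fixes K :: "'a::{field,finite}^2^2"
  assumes "u \<noteq> 0" "w \<noteq> 0" "cross2 u w = 0" "a \<noteq> 0" "c \<noteq> 0"
  shows "card {A. det A = e \<and> a *s (A *v u) = K *v u \<and> A *v w = c *s w} =
    (if K *v u = (a * c) *s u then CARD('a) else 0)"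
proof -
  obtain l where lam: "w = l *s u" using cross2_eq_0[OF assms(1,3)] by blast
  then have l0: "l \<noteq> 0" using assms(2) by auto
  have eq: "A *v w = c *s w \<longleftrightarrow> A *v u = c *s u" for A
  proof -
    have "A *v w = l *s (A *v u)" "c *s w = l *s (c *s u)"
      by (simp_all add: lam vector_scalar_commute mult.commute)
    then have "A *v w = c *s w \<longleftrightarrow> l *s (A *v u) = l *s (c *s u)" by (rule arg_cong2)
    also have "\<dots> \<longleftrightarrow> A *v u = c *s u" using l0 by (simp only: vec.scale_cancel_left) simp
    finally show ?thesis .
  qed
  show ?thesis
  proof (cases "K *v u = (a * c) *s u")
    case True
    have "a *s (A *v u) = K *v u" if "A *v u = c *s u" for A using that True by simp
    then have "{A. det A = e \<and> a *s (A *v u) = K *v u \<and> A *v w = c *s w} =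
        {A. A *v u = c *s u \<and> det A = e}" unfolding eq by blast
    then show ?thesis
      using True card_matrix_eigen_det[of u "c *s u" e] assms by (simp add: vec.scale_eq_0_iff)
  next
    case False
    have "K *v u = (a * c) *s u" if "a *s (A *v u) = K *v u" "A *v u = c *s u" for A
      using that(1) unfolding that(2) by simp
    then have "{A. det A = e \<and> a *s (A *v u) = K *v u \<and> A *v w = c *s w} = {}"
      using False unfolding eq by blast
    then show ?thesis using False by simp
  qed
qed

text \<open>The two vector conditions determine the matrix, so only its determinant is left to test.
  By \<open>cross2_mult\<close> that test becomes the vanishing of a linear form in
  \<open>w\<close>, which makes it possible to sum over \<open>w\<close> afterwards.\<close>

lemma card_two_eigen_basis:
  fixes K :: "'a::{field,finite}^2^2"
  assumes "cross2 u w \<noteq> 0" "a \<noteq> 0" "c \<noteq> 0"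
  shows "card {A. det A = c * d \<and> a *s (A *v u) = K *v u \<and> A *v w = c *s w} =
    of_bool (cross2 (K *v u - (a * d) *s u) w = 0)"
proof -
  have ex: "\<exists>!A. A *v u = inverse a *s (K *v u) \<and> A *v w = c *s w"
    by (rule matrix_by_basis[OF assms(1)])
  define B where "B = (THE A. A *v u = inverse a *s (K *v u) \<and> A *v w = c *s w)"
  have B: "B *v u = inverse a *s (K *v u)" "B *v w = c *s w"
    using theI'[OF ex] by (simp_all add: B_def)
  have uniq: "A = B" if "A *v u = inverse a *s (K *v u) \<and> A *v w = c *s w" for A
    using the1_equality[OF ex that] by (simp add: B_def)
  have eq: "a *s p = r \<longleftrightarrow> p = inverse a *s r" for p r :: "'a^2"
    using inverse_scale_eq_iff[OF assms(2), of r p] by auto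
  have "det B * cross2 u w = inverse a * (c * cross2 (K *v u) w)"
    using cross2_mult[of B u w] by (simp add: B mult.left_commute)
  then have "a * (det B * cross2 u w) = c * cross2 (K *v u) w" using assms by simp
  moreover have "det B = c * d \<longleftrightarrow> a * (det B * cross2 u w) = a * ((c * d) * cross2 u w)"
    using assms by simp
  ultimately have "det B = c * d \<longleftrightarrow> c * cross2 (K *v u) w = a * ((c * d) * cross2 u w)"
    by simp
  also have "a * ((c * d) * cross2 u w) = c * (a * d * cross2 u w)"
    by (simp add: algebra_simps)
  also have "c * cross2 (K *v u) w = c * (a * d * cross2 u w) \<longleftrightarrow> cross2 (K *v u) w = a * d * cross2 u w"
    using assms(3) by simp
  also have "\<dots> \<longleftrightarrow> cross2 (K *v u - (a * d) *s u) w = 0"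
    by simp
  finally have det: "det B = c * d \<longleftrightarrow> cross2 (K *v u - (a * d) *s u) w = 0" .
  have "det A = c * d \<and> a *s (A *v u) = K *v u \<and> A *v w = c *s w \<longleftrightarrow>
      A = B \<and> cross2 (K *v u - (a * d) *s u) w = 0" for A
    unfolding eq det[symmetric] using B uniq[of A] by blast
  then have "{A. det A = c * d \<and> a *s (A *v u) = K *v u \<and> A *v w = c *s w} =
      {A. A = B \<and> cross2 (K *v u - (a * d) *s u) w = 0}" by blast
  also have "card \<dots> = of_bool (cross2 (K *v u - (a * d) *s u) w = 0)"
    by (cases "cross2 (K *v u - (a * d) *s u) w = 0") simp_all
  finally show ?thesis .
qed

text \<open>If p = e u, the second condition is void and w avoids the line of u. If p is another
  multiple of u, the conditions contradict each other. Otherwise w runs over the nonzero vectors of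
  the line of p - e u, none of which is parallel to u.\<close>

lemma card_transversal:
  fixes u p :: "'a::{field,finite}^2"
  assumes "u \<noteq> 0"
  shows "of_nat (card {w. cross2 u w \<noteq> 0 \<and> cross2 (p - e *s u) w = 0}) =
    (of_int (int CARD('a)^2 - int CARD('a)) * of_bool (p = e *s u) +
     of_int (int CARD('a) - 1) * of_bool (\<nexists>f. p = f *s u) :: 'b::ring_1)"
proof (cases "p = e *s u")
  case True
  have "{w. cross2 u w \<noteq> 0} = UNIV - {w. cross2 u w = 0}" by auto
  then have "card {w. cross2 u w \<noteq> 0} = CARD('a)^2 - CARD('a)"
    using card_cross2_eq[OF assms, of 0] by (simp add: card_Diff_subset)
  then show ?thesis using True by (auto simp: of_nat_diff power2_eq_square)
next
  case False
  then have r0: "p - e *s u \<noteq> 0" by simp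
  show ?thesis
  proof (cases "\<exists>f. p = f *s u")
    case True
    then obtain f where f: "p = f *s u" by blast
    then have "f \<noteq> e" using False by auto
    then have "{w. cross2 u w \<noteq> 0 \<and> cross2 (p - e *s u) w = 0} = {}"
      by (auto simp: f simp flip: left_diff_distrib)
    then show ?thesis using False True by auto
  next
    case noeig: False
    have nz: "cross2 (p - e *s u) u \<noteq> 0"
    proof
      assume "cross2 (p - e *s u) u = 0"
      then have "cross2 u p = 0" using cross2_swap[of u p] by simp
      then show False using cross2_eq_0[OF assms] noeig by blast
    qed
    have "cross2 u w \<noteq> 0" if w: "w \<noteq> 0" "cross2 (p - e *s u) w = 0" for w
    proof -
      obtain l where l: "w = l *s (p - e *s u)" using cross2_eq_0[OF r0 w(2)] by blast
      then have "l \<noteq> 0" using w by auto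
      moreover have "cross2 u (p - e *s u) \<noteq> 0" using nz cross2_swap[of u "p - e *s u"] by simp
      ultimately show ?thesis unfolding l cross2_simps(3) by simp
    qed
    then have "{w. cross2 u w \<noteq> 0 \<and> cross2 (p - e *s u) w = 0} = {w. w \<noteq> 0 \<and> cross2 (p - e *s u) w = 0}"
      by auto
    then show ?thesis using card_parallel[OF r0] False noeig by (simp add: of_nat_diff Suc_leI)
  qed
qed

text \<open>The product a c of eigenvalues comes from the q - 1 vectors w on the line of u, the
  product a d from the q^2 - q vectors off it. A vector u that is not an eigenvector of K still
  contributes q - 1.\<close>

lemma sum_card_two_eigen:
  fixes K :: "'a::{field,finite}^2^2"
  assumes "u \<noteq> 0" "a \<noteq> 0" "c \<noteq> 0"
  shows "(\<Sum>w\<in>- {0}. of_nat (card {A. det A = c * d \<and> a *s (A *v u) = K *v u \<and> A *v w = c *s w})) =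
    (of_int ((int CARD('a) - 1) * int CARD('a)) * (of_bool (K *v u = (a * c) *s u) + of_bool (K *v u = (a * d) *s u)) +
     of_int (int CARD('a) - 1) * of_bool (\<nexists>f. K *v u = f *s u) :: complex)"
proof -
  have "of_nat (card {A. det A = c * d \<and> a *s (A *v u) = K *v u \<and> A *v w = c *s w}) =
      (of_nat CARD('a) * of_bool (K *v u = (a * c) *s u) * of_bool (cross2 u w = 0) +
       of_bool (cross2 u w \<noteq> 0 \<and> cross2 (K *v u - (a * d) *s u) w = 0) :: complex)" if "w \<noteq> 0" for w
  proof (cases "cross2 u w = 0")
    case True
    then show ?thesis using card_two_eigen_parallel[OF assms(1) that True assms(2,3), of "c * d" K] by simp
  next
    case False
    then show ?thesis using card_two_eigen_basis[OF False assms(2,3), of d K] by simp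
  qed
  then have "(\<Sum>w\<in>- {0}. of_nat (card {A. det A = c * d \<and> a *s (A *v u) = K *v u \<and> A *v w = c *s w})) =
      (\<Sum>w\<in>- {0}. of_nat CARD('a) * of_bool (K *v u = (a * c) *s u) * of_bool (cross2 u w = 0) +
       of_bool (cross2 u w \<noteq> 0 \<and> cross2 (K *v u - (a * d) *s u) w = 0) :: complex)"
    by (intro sum.cong) auto
  also have "\<dots> = of_nat CARD('a) * of_bool (K *v u = (a * c) *s u) * (\<Sum>w\<in>- {0}. of_bool (cross2 u w = 0)) +
      (\<Sum>w\<in>- {0}. of_bool (cross2 u w \<noteq> 0 \<and> cross2 (K *v u - (a * d) *s u) w = 0))"
    by (simp only: sum.distrib sum_distrib_left)
  also have "(\<Sum>w\<in>- {0}. of_bool (cross2 u w = 0) :: complex) = of_int (int CARD('a) - 1)"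
  proof -
    have "- {0} \<inter> {w. cross2 u w = 0} = {w. w \<noteq> 0 \<and> cross2 u w = 0}" by auto
    then show ?thesis using card_parallel[OF assms(1)]
      by (subst sum_of_bool_eq) (simp_all add: of_nat_diff Suc_leI)
  qed
  also have "(\<Sum>w\<in>- {0}. of_bool (cross2 u w \<noteq> 0 \<and> cross2 (K *v u - (a * d) *s u) w = 0) :: complex) =
      of_nat (card {w. cross2 u w \<noteq> 0 \<and> cross2 (K *v u - (a * d) *s u) w = 0})"
  proof -
    have "- {0} \<inter> {w. cross2 u w \<noteq> 0 \<and> cross2 (K *v u - (a * d) *s u) w = 0} =
        {w. cross2 u w \<noteq> 0 \<and> cross2 (K *v u - (a * d) *s u) w = 0}"
    proof -
      have "w \<noteq> 0" if "cross2 u w \<noteq> 0" for w using that by auto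
      then show ?thesis by blast
    qed
    then show ?thesis by (subst sum_of_bool_eq) simp_all
  qed
  finally show ?thesis
    unfolding card_transversal[OF assms(1)] by (simp add: algebra_simps power2_eq_square)
qed

text \<open>An invertible matrix has at most one eigenvalue on a given nonzero vector, and it is
  nonzero. This expresses the last case of \<open>sum_card_two_eigen\<close> through eigenvector
  counts again, so that the algebra closes.\<close>

lemma of_bool_no_eigen:
  fixes g :: "'a::{field,finite} gl2"
  assumes "u \<noteq> 0"
  shows "of_bool (\<nexists>f. g \<bullet>\<^sub>v u = f *s u) = (1 - (\<Sum>f\<in>- {0}. of_bool (g \<bullet>\<^sub>v u = f *s u)) :: complex)"
proof (cases "\<exists>f. g \<bullet>\<^sub>v u = f *s u")
  case True
  then obtain f where f: "g \<bullet>\<^sub>v u = f *s u" by blast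
  then have "f *s u \<noteq> 0" using assms gl2_act_eq_0[of g u] by simp
  then have "f \<noteq> 0" by auto
  have "g \<bullet>\<^sub>v u = f' *s u \<longleftrightarrow> f' = f" for f'
    unfolding f using assms by (auto simp: vec.scale_cancel_right)
  then have "(\<Sum>f\<in>- {0}. of_bool (g \<bullet>\<^sub>v u = f *s u) :: complex) = (\<Sum>f'\<in>- {0}. if f' = f then 1 else 0)"
    by (intro sum.cong) auto
  then show ?thesis using True \<open>f \<noteq> 0\<close> by simp
next
  case False
  then show ?thesis by simp
qed

lemma gl2_eigen_quotient:
  "(k \<odot> gl2_inv h) \<bullet>\<^sub>v k \<bullet>\<^sub>v u = a *s (k \<bullet>\<^sub>v u) \<longleftrightarrow> a *s (h \<bullet>\<^sub>v u) = k \<bullet>\<^sub>v u"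
proof -
  have "(k \<odot> gl2_inv h) \<bullet>\<^sub>v k \<bullet>\<^sub>v u = a *s (k \<bullet>\<^sub>v u) \<longleftrightarrow> gl2_inv h \<bullet>\<^sub>v k \<bullet>\<^sub>v u = a *s u"
    by (simp add: gl2_act_mult flip: gl2_act_scale)
  also have "\<dots> \<longleftrightarrow> a *s (h \<bullet>\<^sub>v u) = k \<bullet>\<^sub>v u"
    unfolding gl2_act_eq_iff gl2_act_scale by (rule eq_commute)
  finally show ?thesis .
qed

lemma eig_convolution_sum:
  fixes a b c d :: "'a::{field,finite}" and k :: "'a gl2"
  assumes "c \<noteq> 0" "d \<noteq> 0"
  shows "cf_apply (eig_cf a b * eig_cf c d) k = of_bool (gl2_det k = a * b * (c * d)) *
    (\<Sum>u\<in>- {0}. \<Sum>w\<in>- {0}. of_nat (card {A. det A = c * d \<and> a *s (A *v u) = k \<bullet>\<^sub>v u \<and> A *v w = c *s w}))"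
proof -
  define P where "P h u w \<longleftrightarrow> gl2_det h = c * d \<and> a *s (h \<bullet>\<^sub>v u) = k \<bullet>\<^sub>v u \<and> h \<bullet>\<^sub>v w = c *s w" for h u w
  have "cf_apply (eig_cf a b * eig_cf c d) k = (\<Sum>h\<in>UNIV. of_bool (gl2_det k = a * b * (c * d)) *
      (\<Sum>u\<in>- {0}. \<Sum>w\<in>- {0}. of_bool (P h u w)))"
    unfolding cf_apply_mult
  proof (rule sum.cong[OF refl])
    fix h
    have "cf_apply (eig_cf a b) (k \<odot> gl2_inv h) = of_bool (gl2_det (k \<odot> gl2_inv h) = a * b) *
        (\<Sum>u\<in>- {0}. of_bool (a *s (h \<bullet>\<^sub>v u) = k \<bullet>\<^sub>v u))"
      unfolding cf_apply_eig
      by (subst sum_nonzero_act[of _ k, symmetric]) (simp only: gl2_eigen_quotient)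
    then have "cf_apply (eig_cf a b) (k \<odot> gl2_inv h) * cf_apply (eig_cf c d) h =
        (of_bool (gl2_det (k \<odot> gl2_inv h) = a * b) * of_bool (gl2_det h = c * d)) *
        ((\<Sum>u\<in>- {0}. of_bool (a *s (h \<bullet>\<^sub>v u) = k \<bullet>\<^sub>v u)) * (\<Sum>w\<in>- {0}. of_bool (h \<bullet>\<^sub>v w = c *s w)))"
      by (simp only: cf_apply_eig mult.assoc mult.left_commute)
    also have "of_bool (gl2_det (k \<odot> gl2_inv h) = a * b) * of_bool (gl2_det h = c * d) =
        (of_bool (gl2_det k = a * b * (c * d)) * of_bool (gl2_det h = c * d) :: complex)"
      by (auto simp: gl2_det_quotient simp del: gl2_det_mult gl2_det_inv)
    also have "\<dots> * ((\<Sum>u\<in>- {0}. of_bool (a *s (h \<bullet>\<^sub>v u) = k \<bullet>\<^sub>v u)) * (\<Sum>w\<in>- {0}. of_bool (h \<bullet>\<^sub>v w = c *s w))) =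
        of_bool (gl2_det k = a * b * (c * d)) * (\<Sum>u\<in>- {0}. \<Sum>w\<in>- {0}. of_bool (P h u w))"
      unfolding mult.assoc sum_product
      unfolding sum_distrib_left P_def of_bool_conj by (rule refl)
    finally show "cf_apply (eig_cf a b) (k \<odot> gl2_inv h) * cf_apply (eig_cf c d) h =
        of_bool (gl2_det k = a * b * (c * d)) * (\<Sum>u\<in>- {0}. \<Sum>w\<in>- {0}. of_bool (P h u w))" .
  qed
  also have "\<dots> = of_bool (gl2_det k = a * b * (c * d)) *
      (\<Sum>h\<in>UNIV. \<Sum>u\<in>- {0}. \<Sum>w\<in>- {0}. of_bool (P h u w))"
    by (rule sum_distrib_left[symmetric])
  also have "(\<Sum>h\<in>UNIV. \<Sum>u\<in>- {0}. \<Sum>w\<in>- {0}. of_bool (P h u w)) =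
      (\<Sum>u\<in>- {0}. \<Sum>h\<in>UNIV. \<Sum>w\<in>- {0}. of_bool (P h u w) :: complex)"
    by (rule sum.swap)
  also have "\<dots> = (\<Sum>u\<in>- {0}. \<Sum>w\<in>- {0}. \<Sum>h\<in>UNIV. of_bool (P h u w))"
    by (rule sum.cong[OF refl], rule sum.swap)
  also have "\<dots> = (\<Sum>u\<in>- {0}. \<Sum>w\<in>- {0}.
      of_nat (card {A. det A = c * d \<and> a *s (A *v u) = k \<bullet>\<^sub>v u \<and> A *v w = c *s w}))"
  proof (intro sum.cong refl)
    fix u w
    have "det A \<noteq> 0" if "det A = c * d \<and> a *s (A *v u) = k \<bullet>\<^sub>v u \<and> A *v w = c *s w" for A
      using that assms by simp
    from sum_of_bool_gl2[of "\<lambda>A. det A = c * d \<and> a *s (A *v u) = k \<bullet>\<^sub>v u \<and> A *v w = c *s w", OF this]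
    show "(\<Sum>h\<in>UNIV. of_bool (P h u w) :: complex) =
      of_nat (card {A. det A = c * d \<and> a *s (A *v u) = k \<bullet>\<^sub>v u \<and> A *v w = c *s w})"
      unfolding P_def by blast
  qed
  finally show ?thesis .
qed

text \<open>The first bracket comes from eigenvectors u of the product. The vectors that are not
  eigenvectors are counted as all q^2 - 1 nonzero vectors, which gives the \<open>det_cf\<close>
  term, minus the eigenvectors for every eigenvalue, which gives the final sum.\<close>

lemma eig_eig:
  fixes a b c d :: "'a::{field,finite}"
  assumes "a \<noteq> 0" "b \<noteq> 0" "c \<noteq> 0" "d \<noteq> 0"
  shows "eig_cf a b * eig_cf c d =
    of_int ((int CARD('a) - 1) * int CARD('a)) * (eig_cf (a * c) (b * d) + eig_cf (a * d) (b * c)) +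
    of_int ((int CARD('a) - 1) * (int CARD('a)^2 - 1)) * det_cf (a * b * c * d) -
    of_int (int CARD('a) - 1) * (\<Sum>e\<in>- {0}. eig_cf e (a * b * c * d / e))"
proof (rule cf_eqI)
  fix k :: "'a gl2"
  define S where "S f = (\<Sum>u\<in>- {0}. of_bool (k \<bullet>\<^sub>v u = f *s u) :: complex)" for f
  define q where "q = int CARD('a)"
  define \<delta> where "\<delta> = (of_bool (gl2_det k = a * b * c * d) :: complex)"
  have ev: "cf_apply (eig_cf e f) k = \<delta> * S e" if "e * f = a * b * c * d" for e f
    unfolding cf_apply_eig that S_def \<delta>_def by (rule refl)
  have evs: "cf_apply (\<Sum>e\<in>- {0}. eig_cf e (a * b * c * d / e)) k = \<delta> * (\<Sum>e\<in>- {0}. S e)"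
    unfolding cf_apply_sum sum_distrib_left by (intro sum.cong refl ev) simp
  have "cf_apply (eig_cf a b * eig_cf c d) k = \<delta> * (\<Sum>u\<in>- {0}.
      of_int ((q - 1) * q) * (of_bool (k \<bullet>\<^sub>v u = (a * c) *s u) + of_bool (k \<bullet>\<^sub>v u = (a * d) *s u)) +
      of_int (q - 1) * (1 - (\<Sum>f\<in>- {0}. of_bool (k \<bullet>\<^sub>v u = f *s u))))"
    unfolding eig_convolution_sum[OF assms(3,4)] \<delta>_def mult.assoc
    by (intro arg_cong2[of _ _ _ _ "(*)"] sum.cong refl)
      (simp only: Compl_iff singleton_iff not_False_eq_True sum_card_two_eigen[OF _ assms(1,3)] of_bool_no_eigen q_def)
  also have "\<dots> = \<delta> * (of_int ((q - 1) * q) * (S (a * c) + S (a * d)) +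
      of_int (q - 1) * (of_int (q^2 - 1) - (\<Sum>u\<in>- {0}. \<Sum>f\<in>- {0}. of_bool (k \<bullet>\<^sub>v u = f *s u))))"
  proof -
    have one: "(\<Sum>u\<in>- {0::'a^2}. 1) = (of_int (q^2 - 1) :: complex)"
      unfolding sum_constant card_nonzero_vec_of_int q_def by simp
    show ?thesis
      unfolding sum.distrib sum_distrib_left[symmetric] sum_subtractf one S_def by (rule refl)
  qed
  also have "(\<Sum>u\<in>- {0}. \<Sum>f\<in>- {0}. of_bool (k \<bullet>\<^sub>v u = f *s u)) = (\<Sum>f\<in>- {0}. S f)"
    unfolding S_def by (rule sum.swap)
  finally have L: "cf_apply (eig_cf a b * eig_cf c d) k = \<delta> * (of_int ((q - 1) * q) * (S (a * c) + S (a * d)) +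
      of_int (q - 1) * (of_int (q^2 - 1) - (\<Sum>f\<in>- {0}. S f)))" .
  have "cf_apply (eig_cf (a * c) (b * d)) k = \<delta> * S (a * c)" "cf_apply (eig_cf (a * d) (b * c)) k = \<delta> * S (a * d)"
    by (rule ev, simp add: ac_simps)+
  moreover have "cf_apply (det_cf (a * b * c * d)) k = \<delta>" by (simp add: cf_apply_det \<delta>_def)
  ultimately show "cf_apply (eig_cf a b * eig_cf c d) k =
      cf_apply (of_int ((int CARD('a) - 1) * int CARD('a)) * (eig_cf (a * c) (b * d) + eig_cf (a * d) (b * c)) +
    of_int ((int CARD('a) - 1) * (int CARD('a)^2 - 1)) * det_cf (a * b * c * d) -
    of_int (int CARD('a) - 1) * (\<Sum>e\<in>- {0}. eig_cf e (a * b * c * d / e))) k"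
    unfolding L cf_apply_simps cf_apply_of_int_mult evs q_def[symmetric]
    by (simp add: algebra_simps del: of_int_mult of_int_diff) (simp add: algebra_simps)
qed

lemma sum_nonzero_mult: "a \<noteq> 0 \<Longrightarrow> (\<Sum>e\<in>- {0}. F (a * e)) = (\<Sum>e\<in>- {0}. F e)"
  for a :: "'a::{field,finite}"
  by (rule sum.reindex_bij_witness[of _ "\<lambda>e. e / a" "\<lambda>e. a * e"]) auto

lemma sum_nonzero_divide: "a \<noteq> 0 \<Longrightarrow> (\<Sum>e\<in>- {0}. F (a / e)) = (\<Sum>e\<in>- {0}. F e)"
  for a :: "'a::{field,finite}"
  by (rule sum.reindex_bij_witness[of _ "\<lambda>e. a / e" "\<lambda>e. a / e"]) auto

lemma sum_nonzero_const: "(\<Sum>e\<in>- {0::'a::{field,finite}}. c) = of_int (int CARD('a) - 1) * (c :: 'b::ring_1)"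
  unfolding sum_constant card_nonzero_of_int by (rule refl)

text \<open>Every nonzero \<open>a\<close> has \<open>1 + qchar a\<close> square roots.\<close>

lemma sum_nonzero_square:
  fixes F :: "'a::{field,finite} \<Rightarrow> 'b::comm_ring_1"
  assumes "odd CARD('a)"
  shows "(\<Sum>c\<in>- {0}. F (c\<^sup>2)) = (\<Sum>a\<in>- {0}. F a) + (\<Sum>a\<in>- {0}. of_int (qchar a) * F a)"
proof -
  let ?S = "(\<lambda>b::'a. b\<^sup>2) ` (- {0})"
  have two: "(2::'a) \<noteq> 0" by (rule odd_CARD_two_neq_zero[OF assms])
  have fib: "(\<Sum>c\<in>{c \<in> - {0::'a}. c\<^sup>2 = a}. F (c\<^sup>2)) = 2 * F a" if a: "a \<in> ?S" for a
  proof -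
    from a obtain b where b: "a = b\<^sup>2" "b \<noteq> 0" by auto
    have "{c \<in> - {0::'a}. c\<^sup>2 = a} = {b, -b}" using b by (auto simp: power2_eq_iff)
    moreover have "b \<noteq> - b"
    proof
      assume "b = - b" then have "2 * b = 0" by (simp add: eq_neg_iff_add_eq_0)
      then show False using two b by simp
    qed
    ultimately show ?thesis using b by simp
  qed
  have "(\<Sum>c\<in>- {0}. F (c\<^sup>2)) = (\<Sum>a\<in>?S. \<Sum>c\<in>{c \<in> - {0::'a}. c\<^sup>2 = a}. F (c\<^sup>2))"
    by (rule sum.image_gen[of "- {0::'a}" "\<lambda>c. F (c\<^sup>2)" "\<lambda>c. c\<^sup>2"]) simp
  also have "\<dots> = (\<Sum>a\<in>?S. 2 * F a)" by (rule sum.cong[OF refl fib])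
  also have "\<dots> = (\<Sum>a\<in>?S. F a + of_int (qchar a) * F a)"
  proof (rule sum.cong[OF refl])
    fix a assume "a \<in> ?S"
    then have "qchar a = 1" using qchar_square by blast
    then show "2 * F a = F a + of_int (qchar a) * F a" by (simp only: mult_2 of_int_1 mult_1)
  qed
  also have "\<dots> = (\<Sum>a\<in>- {0}. F a + of_int (qchar a) * F a)"
  proof (rule sum.mono_neutral_left)
    show "finite (- {0::'a})" by simp
    show "?S \<subseteq> - {0}" by auto
    show "\<forall>a\<in>- {0} - ?S. F a + of_int (qchar a) * F a = 0"
    proof
      fix a :: 'a assume a: "a \<in> - {0} - ?S"
      then have "\<nexists>b. a = b\<^sup>2" by auto
      then have "qchar a = - 1" by (simp add: qchar_def)
      then show "F a + of_int (qchar a) * F a = 0" by simp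
    qed
  qed
  finally show ?thesis by (simp add: sum.distrib)
qed

text \<open>For a multiplicative family the sum weighted by a character is a multiple of the
  projection to that character: the substitution of a b for b makes the inner sum independent of a,
  and the outer one contributes q - 1.\<close>

lemma character_sum_square:
  fixes \<Phi> :: "'a::{field,finite} \<Rightarrow> 'b::comm_ring_1" and \<psi> :: "'a \<Rightarrow> int"
  assumes \<Phi>: "\<And>a b. a \<noteq> 0 \<Longrightarrow> b \<noteq> 0 \<Longrightarrow> \<Phi> a * \<Phi> b = of_int M * \<Phi> (a * b)"
    and \<psi>: "\<And>a b. a \<noteq> 0 \<Longrightarrow> b \<noteq> 0 \<Longrightarrow> \<psi> (a * b) = \<psi> a * \<psi> b"
  shows "(\<Sum>a\<in>- {0}. of_int (\<psi> a) * \<Phi> a) * (\<Sum>a\<in>- {0}. of_int (\<psi> a) * \<Phi> a) =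
    of_int (M * (int CARD('a) - 1)) * (\<Sum>a\<in>- {0}. of_int (\<psi> a) * \<Phi> a)"
proof -
  let ?P = "\<Sum>a\<in>- {0}. of_int (\<psi> a) * \<Phi> a"
  have "?P * ?P = (\<Sum>a\<in>- {0}. \<Sum>b\<in>- {0}. (of_int (\<psi> a) * \<Phi> a) * (of_int (\<psi> b) * \<Phi> b))"
    by (rule sum_product)
  also have "\<dots> = (\<Sum>a\<in>- {0}. \<Sum>b\<in>- {0}. of_int M * (of_int (\<psi> (a * b)) * \<Phi> (a * b)))"
  proof (intro sum.cong refl)
    fix a b :: 'a assume ab: "a \<in> - {0}" "b \<in> - {0}"
    have "(of_int (\<psi> a) * \<Phi> a) * (of_int (\<psi> b) * \<Phi> b) = of_int (\<psi> a * \<psi> b) * (\<Phi> a * \<Phi> b)"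
      by (simp add: ac_simps)
    also have "\<dots> = of_int (\<psi> (a * b)) * (of_int M * \<Phi> (a * b))" using ab \<Phi> \<psi> by simp
    finally show "(of_int (\<psi> a) * \<Phi> a) * (of_int (\<psi> b) * \<Phi> b) = of_int M * (of_int (\<psi> (a * b)) * \<Phi> (a * b))"
      by (simp add: ac_simps)
  qed
  also have "\<dots> = (\<Sum>a\<in>- {0::'a}. of_int M * ?P)"
  proof (intro sum.cong refl)
    fix a :: 'a assume "a \<in> - {0}"
    then have "(\<Sum>b\<in>- {0}. of_int (\<psi> (a * b)) * \<Phi> (a * b)) = ?P"
      by (intro sum_nonzero_mult[where F = "\<lambda>b. of_int (\<psi> b) * \<Phi> b"]) auto
    then show "(\<Sum>b\<in>- {0}. of_int M * (of_int (\<psi> (a * b)) * \<Phi> (a * b))) = of_int M * ?P"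
      by (simp flip: sum_distrib_left)
  qed
  also have "\<dots> = of_int (M * (int CARD('a) - 1)) * ?P"
    unfolding sum_nonzero_const by (simp add: ac_simps)
  finally show ?thesis .
qed

section \<open>Splitting into idempotents\<close>

text \<open>On elements of determinant \<open>a\<close> this is q - 1 times the number of fixed
  lines, the permutation character of the projective line. That character is the trivial one plus
  the Steinberg character, whence the correction in \<open>steinberg_cf\<close>.\<close>

definition eig_sum :: "'a::{field,finite} \<Rightarrow> 'a class_fun" where
  "eig_sum a = (\<Sum>e\<in>- {0}. eig_cf e (a / e))"

text \<open>
  \<open>steinberg_cf\<close> and \<open>principal_cf\<close> are the parts of \<open>eig_sum\<close> and \<open>eig_cf\<close> that are orthogonal to
  the one-dimensional representations and, for \<open>principal_cf\<close>, to the twists of the Steinberg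
  representation as well.
\<close>

definition steinberg_cf :: "'a::{field,finite} \<Rightarrow> 'a class_fun" where
  "steinberg_cf a = eig_sum a - of_int (int CARD('a) - 1) * det_cf a"

definition principal_cf :: "'a::{field,finite} \<Rightarrow> 'a \<Rightarrow> 'a class_fun" where
  "principal_cf a b = of_int (int CARD('a) - 1) * eig_cf a b - eig_sum (a * b)"

lemma det_eig_sum:
  fixes a c :: "'a::{field,finite}"
  assumes "a \<noteq> 0"
  shows "det_cf c * eig_sum a =
    of_int ((int CARD('a) - 1) * (int CARD('a) * (int CARD('a)^2 - 1))) * det_cf (a * c)"
proof -
  have "det_cf c * eig_sum a = (\<Sum>e\<in>- {0::'a}. of_int (int CARD('a) * (int CARD('a)^2 - 1)) * det_cf (a * c))"
    unfolding eig_sum_def sum_distrib_left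
    by (rule sum.cong[OF refl]) (subst det_eig, use assms in auto)
  then show ?thesis unfolding sum_nonzero_const by (simp only: of_int_mult mult.assoc)
qed

lemma eig_eig_sum:
  fixes a b c :: "'a::{field,finite}"
  assumes "a \<noteq> 0" "b \<noteq> 0" "c \<noteq> 0"
  shows "eig_cf a b * eig_sum c =
    of_int (int CARD('a)^2 - 1) * eig_sum (a * b * c) +
    of_int ((int CARD('a) - 1)^2 * (int CARD('a)^2 - 1)) * det_cf (a * b * c)"
proof -
  define q where "q = int CARD('a)"
  have 1: "(\<Sum>e\<in>- {0}. eig_cf (a * e) (b * (c / e))) = eig_sum (a * b * c)"
  proof -
    have "(\<Sum>e\<in>- {0}. eig_cf (a * e) (b * (c / e))) = (\<Sum>e\<in>- {0}. eig_cf (a * e) (a * b * c / (a * e)))"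
      by (rule sum.cong[OF refl]) (use assms in simp)
    also have "\<dots> = eig_sum (a * b * c)"
      unfolding eig_sum_def by (rule sum_nonzero_mult[where F = "\<lambda>e. eig_cf e (a * b * c / e)", OF assms(1)])
    finally show ?thesis .
  qed
  have 2: "(\<Sum>e\<in>- {0}. eig_cf (a * (c / e)) (b * e)) = eig_sum (a * b * c)"
  proof -
    have "(\<Sum>e\<in>- {0}. eig_cf (a * (c / e)) (b * e)) = (\<Sum>e\<in>- {0}. eig_cf (a * c / e) (a * b * c / (a * c / e)))"
      by (rule sum.cong[OF refl]) (use assms in \<open>simp add: mult.commute\<close>)
    also have "\<dots> = eig_sum (a * b * c)"
      unfolding eig_sum_def
      by (rule sum_nonzero_divide[where F = "\<lambda>e. eig_cf e (a * b * c / e)"]) (use assms in simp)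
    finally show ?thesis .
  qed
  have "eig_cf a b * eig_sum c = (\<Sum>e\<in>- {0}.
      of_int ((q - 1) * q) * (eig_cf (a * e) (b * (c / e)) + eig_cf (a * (c / e)) (b * e)) +
      of_int ((q - 1) * (q^2 - 1)) * det_cf (a * b * c) - of_int (q - 1) * eig_sum (a * b * c))"
    unfolding eig_sum_def[of c] sum_distrib_left
  proof (rule sum.cong[OF refl])
    fix e :: 'a assume "e \<in> - {0}"
    then have e: "e \<noteq> 0" "c / e \<noteq> 0" "a * b * e * (c / e) = a * b * c" using assms by auto
    show "eig_cf a b * eig_cf e (c / e) =
      of_int ((q - 1) * q) * (eig_cf (a * e) (b * (c / e)) + eig_cf (a * (c / e)) (b * e)) +
      of_int ((q - 1) * (q^2 - 1)) * det_cf (a * b * c) - of_int (q - 1) * eig_sum (a * b * c)"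
      unfolding eig_eig[OF assms(1,2) e(1,2)] e(3) eig_sum_def q_def by (rule refl)
  qed
  also have "\<dots> = of_int ((q - 1) * q) * (eig_sum (a * b * c) + eig_sum (a * b * c)) +
      of_int (q - 1) * (of_int ((q - 1) * (q^2 - 1)) * det_cf (a * b * c)) -
      of_int (q - 1) * (of_int (q - 1) * eig_sum (a * b * c))"
    unfolding sum_subtractf sum.distrib sum_distrib_left[symmetric] 1 2 sum_nonzero_const q_def
    by (simp only: mult.left_commute)
  \<comment> \<open>The coefficient of \<open>eig_sum\<close> is 2 q (q - 1) - (q - 1)^2 = q^2 -
    1.\<close>
  finally show ?thesis unfolding q_def[symmetric]
    by (simp add: algebra_simps power2_eq_square)
qed

lemma eig_sum_eig_sum:
  fixes a c :: "'a::{field,finite}"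
  assumes "a \<noteq> 0" "c \<noteq> 0"
  shows "eig_sum a * eig_sum c =
    of_int ((int CARD('a) - 1) * (int CARD('a)^2 - 1)) * eig_sum (a * c) +
    of_int ((int CARD('a) - 1)^3 * (int CARD('a)^2 - 1)) * det_cf (a * c)"
proof -
  define q where "q = int CARD('a)"
  have "eig_sum a * eig_sum c = (\<Sum>e\<in>- {0::'a}.
      of_int (q^2 - 1) * eig_sum (a * c) + of_int ((q - 1)^2 * (q^2 - 1)) * det_cf (a * c))"
    unfolding eig_sum_def[of a] sum_distrib_right
  proof (rule sum.cong[OF refl])
    fix e :: 'a assume "e \<in> - {0}"
    then have e: "e \<noteq> 0" "a / e \<noteq> 0" "e * (a / e) * c = a * c" using assms by auto
    show "eig_cf e (a / e) * eig_sum c =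
      of_int (q^2 - 1) * eig_sum (a * c) + of_int ((q - 1)^2 * (q^2 - 1)) * det_cf (a * c)"
      unfolding eig_eig_sum[OF e(1,2) assms(2)] e(3) q_def by (rule refl)
  qed
  then show ?thesis unfolding sum_nonzero_const q_def[symmetric]
    by (simp add: algebra_simps power2_eq_square power3_eq_cube)
qed

text \<open>The \<open>det_cf\<close> terms of the four products add up to exactly what
  \<open>steinberg_cf (a * c)\<close> requires, so the family is multiplicative up to a constant,
  just like \<open>scalar_cf\<close> and \<open>det_cf\<close>, and \<open>quasi_idem_family\<close>
  applies to all three.\<close>

lemma steinberg_steinberg:
  fixes a c :: "'a::{field,finite}"
  assumes "a \<noteq> 0" "c \<noteq> 0"
  shows "steinberg_cf a * steinberg_cf c =
    of_int ((int CARD('a) - 1) * (int CARD('a)^2 - 1)) * steinberg_cf (a * c)"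
proof -
  define q where "q = int CARD('a)"
  have ca: "det_cf c * eig_sum a = of_int ((q - 1) * (q * (q^2 - 1))) * det_cf (a * c)"
    and ac: "det_cf a * eig_sum c = of_int ((q - 1) * (q * (q^2 - 1))) * det_cf (a * c)"
    using det_eig_sum[OF assms(1), of c] det_eig_sum[OF assms(2), of a]
    by (simp_all only: q_def mult.commute[of c a])
  have "steinberg_cf a * steinberg_cf c = eig_sum a * eig_sum c -
      of_int (q - 1) * (det_cf a * eig_sum c) - of_int (q - 1) * (det_cf c * eig_sum a) +
      of_int ((q - 1)^2) * (det_cf a * det_cf c)"
    unfolding steinberg_cf_def q_def[symmetric] by (simp add: algebra_simps power2_eq_square)
  also have "\<dots> = of_int ((q - 1) * (q^2 - 1)) * steinberg_cf (a * c)"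
    unfolding ca ac eig_sum_eig_sum[OF assms] det_det[OF assms(2)] steinberg_cf_def q_def[symmetric]
    by (simp add: algebra_simps power2_eq_square power3_eq_cube)
  finally show ?thesis by (simp only: q_def)
qed

text \<open>The \<open>det_cf\<close> terms cancel, and the \<open>eig_sum\<close> terms combine to
  -2 q (q - 1)^2, one share for each summand on the right. There are two summands because the pair
  of characters labelling a principal series representation is unordered.\<close>

lemma principal_principal:
  fixes a b c d :: "'a::{field,finite}"
  assumes "a \<noteq> 0" "b \<noteq> 0" "c \<noteq> 0" "d \<noteq> 0"
  shows "principal_cf a b * principal_cf c d =
    of_int ((int CARD('a) - 1)^2 * int CARD('a)) * (principal_cf (a * c) (b * d) + principal_cf (a * d) (b * c))"
proof -
  define q where "q = int CARD('a)"
  define Y where "Y = eig_sum (a * b * c * d)"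
  define D where "D = det_cf (a * b * c * d)"
  have nz: "a * b \<noteq> 0" "c * d \<noteq> 0" using assms by auto
  have 1: "eig_cf a b * eig_sum (c * d) = of_int (q^2 - 1) * Y + of_int ((q - 1)^2 * (q^2 - 1)) * D"
    using eig_eig_sum[OF assms(1,2) nz(2)] by (simp add: q_def Y_def D_def mult.assoc)
  have "c * d * (a * b) = a * b * c * d" by (simp add: ac_simps)
  then have 2: "eig_cf c d * eig_sum (a * b) = of_int (q^2 - 1) * Y + of_int ((q - 1)^2 * (q^2 - 1)) * D"
    using eig_eig_sum[OF assms(3,4) nz(1)] by (simp only: q_def Y_def D_def)
  have 3: "eig_sum (a * b) * eig_sum (c * d) =
      of_int ((q - 1) * (q^2 - 1)) * Y + of_int ((q - 1)^3 * (q^2 - 1)) * D"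
    using eig_sum_eig_sum[OF nz] by (simp add: q_def Y_def D_def mult.assoc)
  have 4: "eig_cf a b * eig_cf c d =
      of_int ((q - 1) * q) * (eig_cf (a * c) (b * d) + eig_cf (a * d) (b * c)) +
      of_int ((q - 1) * (q^2 - 1)) * D - of_int (q - 1) * Y"
    unfolding eig_eig[OF assms] q_def D_def Y_def eig_sum_def by (rule refl)
  have 5: "principal_cf (a * c) (b * d) = of_int (q - 1) * eig_cf (a * c) (b * d) - Y"
    "principal_cf (a * d) (b * c) = of_int (q - 1) * eig_cf (a * d) (b * c) - Y"
    by (simp_all add: principal_cf_def q_def Y_def ac_simps)
  have "principal_cf a b * principal_cf c d = of_int ((q - 1)^2) * (eig_cf a b * eig_cf c d) -
      of_int (q - 1) * (eig_cf a b * eig_sum (c * d)) - of_int (q - 1) * (eig_cf c d * eig_sum (a * b)) +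
      eig_sum (a * b) * eig_sum (c * d)"
    unfolding principal_cf_def q_def[symmetric] by (simp add: algebra_simps power2_eq_square)
  also have "\<dots> = of_int ((q - 1)^2 * q) * (principal_cf (a * c) (b * d) + principal_cf (a * d) (b * c))"
    unfolding 1 2 3 4 5 by (simp add: algebra_simps power2_eq_square power3_eq_cube)
  finally show ?thesis by (simp only: q_def)
qed

lemma eig_sum_scalar:
  fixes a c :: "'a::{field,finite}"
  assumes "c \<noteq> 0"
  shows "eig_sum a * scalar_cf c = eig_sum (a * c\<^sup>2)"
proof -
  have "eig_sum a * scalar_cf c = (\<Sum>e\<in>- {0}. eig_cf (c * e) (a * c\<^sup>2 / (c * e)))"
    unfolding eig_sum_def sum_distrib_right eig_scalar_cf[OF assms]
    by (rule sum.cong[OF refl]) (use assms in \<open>simp add: power2_eq_square mult.commute\<close>)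
  also have "\<dots> = eig_sum (a * c\<^sup>2)"
    unfolding eig_sum_def by (rule sum_nonzero_mult[where F = "\<lambda>e. eig_cf e (a * c\<^sup>2 / e)", OF assms])
  finally show ?thesis .
qed

lemma principal_scalar:
  fixes a b c :: "'a::{field,finite}"
  assumes "c \<noteq> 0"
  shows "principal_cf a b * scalar_cf c = principal_cf (a * c) (b * c)"
proof -
  have "a * b * c\<^sup>2 = a * c * (b * c)" by (simp add: power2_eq_square ac_simps)
  then show ?thesis
    unfolding principal_cf_def left_diff_distrib mult.assoc[of _ _ "scalar_cf c"]
      eig_scalar_cf[OF assms] eig_sum_scalar[OF assms] by (simp only:)
qed

section \<open>Explicit values of the eigenvector counts\<close>

lemma sum_eigen_matrix:
  fixes A :: "'a::{field,finite}^2^2"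
  shows "(\<Sum>v\<in>- {0}. of_bool (A *v v = a *s v)) =
    (of_int (if A = mat a then int CARD('a)^2 - 1
      else if a\<^sup>2 - trace A * a + det A = 0 then int CARD('a) - 1 else 0) :: complex)"
proof (cases "A = mat a")
  case True
  then have "(\<Sum>v\<in>- {0}. of_bool (A *v v = a *s v) :: complex) = (\<Sum>v\<in>- {0::'a^2}. 1)" by simp
  then show ?thesis using True unfolding sum_constant card_nonzero_vec_of_int by simp
next
  case False
  define M where "M = A - mat a"
  \<comment> \<open>Row i of M, rotated so that \<open>cross2 (r i) v\<close> is entry i of M v; the
    eigenvectors are then the vectors parallel to both \<open>r 1\<close> and
    \<open>r 2\<close>.\<close>
  define r where "r i = (vector [M$i$2, - (M$i$1)] :: 'a^2)" for i
  have Mv: "A *v v = a *s v \<longleftrightarrow> cross2 (r 1) v = 0 \<and> cross2 (r 2) v = 0" for v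
  proof -
    have "A *v v = a *s v \<longleftrightarrow> M *v v = 0"
      by (simp add: M_def matrix_vector_mult_diff_rdistrib)
    also have "\<dots> \<longleftrightarrow> cross2 (r 1) v = 0 \<and> cross2 (r 2) v = 0"
      by (simp add: vec_eq_iff forall_2 mk2_vec_nth cross2_def r_def vector_2 add.commute)
    finally show ?thesis .
  qed
  have detM: "cross2 (r 1) (r 2) = a\<^sup>2 - trace A * a + det A"
    by (simp add: cross2_def r_def vector_2 M_def det_2 trace_def sum_2 mat_def power2_eq_square algebra_simps)
  have "r 1 \<noteq> 0 \<or> r 2 \<noteq> 0"
  proof (rule ccontr)
    assume "\<not> ?thesis"
    then have "M = 0" by (simp add: r_def vec_eq_iff forall_2 vector_2)
    then show False using False by (simp add: M_def)
  qed
  then obtain i j where ij: "r i \<noteq> 0" "{i, j} = {1, 2 :: 2}" by (metis insert_commute)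
  then have Mv': "A *v v = a *s v \<longleftrightarrow> cross2 (r i) v = 0 \<and> cross2 (r j) v = 0" for v
    unfolding Mv by (auto simp: doubleton_eq_iff)
  have det': "cross2 (r i) (r j) = 0 \<longleftrightarrow> a\<^sup>2 - trace A * a + det A = 0"
    unfolding detM[symmetric] using ij(2) cross2_swap[of "r 1" "r 2"] by (auto simp: doubleton_eq_iff)
  show ?thesis
  proof (cases "cross2 (r i) (r j) = 0")
    case True
    then obtain c where "r j = c *s r i" using cross2_eq_0[OF ij(1)] by blast
    then have "- {0} \<inter> {v. A *v v = a *s v} = {v. v \<noteq> 0 \<and> cross2 (r i) v = 0}"
      unfolding Mv' by auto
    then show ?thesis using card_parallel[OF ij(1)] True False det'
      by (subst sum_of_bool_eq) (simp_all add: of_nat_diff Suc_leI)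
  next
    case nz: False
    have "v = 0" if v: "cross2 (r i) v = 0" "cross2 (r j) v = 0" for v
    proof -
      obtain c where c: "v = c *s r i" using cross2_eq_0[OF ij(1) v(1)] by blast
      have "c * cross2 (r j) (r i) = 0" using v(2) unfolding c by simp
      then have "c = 0" using nz cross2_swap[of "r i" "r j"] by simp
      then show "v = 0" using c by simp
    qed
    then have "- {0} \<inter> {v. A *v v = a *s v} = {}"
      unfolding Mv' by auto
    then show ?thesis using nz False det'
      by (subst sum_of_bool_eq) (simp_all)
  qed
qed

lemma trace_scalar: "trace (mat c :: 'a::comm_ring_1^2^2) = 2 * c"
  unfolding mat_eq_mk2 trace_mk2 mult_2 by (rule refl)

abbreviation gl2_trace :: "'a::field gl2 \<Rightarrow> 'a" where
  "gl2_trace g \<equiv> trace (mat_of_gl2 g)"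

text \<open>On determinant a b, the value a is an eigenvalue exactly if the trace is a + b. The
  resulting expression is symmetric in a and b, so it does not matter which of them is taken on the
  line and which on the quotient.\<close>

lemma cf_apply_eig_explicit:
  fixes a b :: "'a::{field,finite}"
  assumes "odd CARD('a)" "a \<noteq> 0"
  shows "cf_apply (eig_cf a b) g = of_bool (gl2_det g = a * b \<and> gl2_trace g = a + b) *
    of_int (if scalar_mat (mat_of_gl2 g) then int CARD('a)^2 - 1 else int CARD('a) - 1)"
proof (cases "gl2_det g = a * b")
  case True
  have two: "(2::'a) \<noteq> 0" by (rule odd_CARD_two_neq_zero[OF assms(1)])
  have "a\<^sup>2 - gl2_trace g * a + gl2_det g = a * (a + b - gl2_trace g)"
    unfolding True by (simp add: power2_eq_square algebra_simps)
  then have root: "a\<^sup>2 - gl2_trace g * a + gl2_det g = 0 \<longleftrightarrow> gl2_trace g = a + b"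
    using assms(2) by (simp only: mult_eq_0_iff right_minus_eq) auto
  have sc: "mat_of_gl2 g = mat a \<longleftrightarrow> scalar_mat (mat_of_gl2 g) \<and> gl2_trace g = a + b"
  proof
    assume m: "mat_of_gl2 g = mat a"
    then have "a * b = a * a" using True by (simp only: det_scalar power2_eq_square)
    then have "b = a" using assms(2) by (simp only: mult_cancel_left) simp
    then show "scalar_mat (mat_of_gl2 g) \<and> gl2_trace g = a + b"
      using m unfolding scalar_mat_def m by (auto simp: trace_scalar)
  next
    assume s: "scalar_mat (mat_of_gl2 g) \<and> gl2_trace g = a + b"
    then obtain c where c: "mat_of_gl2 g = mat c" unfolding scalar_mat_def by blast
    then have tr: "2 * c = a + b" using s by (simp only: trace_scalar)
    have dt: "c * c = a * b" using True unfolding c by (simp only: det_scalar power2_eq_square)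
    have "(a - b) * (a - b) = (a + b) * (a + b) - 4 * (a * b)" by (simp add: algebra_simps)
    also have "\<dots> = 0" unfolding tr[symmetric] dt[symmetric] by (simp add: algebra_simps)
    finally have "a = b" by (simp only: mult_eq_0_iff right_minus_eq) simp
    then have "2 * c = 2 * a" unfolding tr by (simp only: mult_2)
    then have "c = a" using two by (simp only: mult_cancel_left) simp
    then show "mat_of_gl2 g = mat a" using c by simp
  qed
  show ?thesis unfolding cf_apply_eig sum_eigen_matrix root sc using True
    by (cases "gl2_trace g = a + b"; cases "scalar_mat (mat_of_gl2 g)") simp_all
qed (simp add: cf_apply_eig)

lemma eig_cf_commute:
  fixes a b :: "'a::{field,finite}"
  assumes "odd CARD('a)" "a \<noteq> 0" "b \<noteq> 0"
  shows "eig_cf a b = eig_cf b a"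
  by (rule cf_eqI) (simp add: cf_apply_eig_explicit assms ac_simps)

lemma principal_cf_commute:
  fixes a b :: "'a::{field,finite}"
  assumes "odd CARD('a)" "a \<noteq> 0" "b \<noteq> 0"
  shows "principal_cf a b = principal_cf b a"
  by (simp add: principal_cf_def eig_cf_commute[OF assms] mult.commute)

text \<open>For a multiplicative family, the unnormalised projection to the quadratic character;
  \<open>total_sum\<close> is the one to the trivial character.\<close>

definition sign_sum :: "('a::{field,finite} \<Rightarrow> 'b::comm_ring_1) \<Rightarrow> 'b" where
  "sign_sum \<Phi> = (\<Sum>a\<in>- {0}. of_int (qchar a) * \<Phi> a)"

definition total_sum :: "('a::{field,finite} \<Rightarrow> 'b::comm_ring_1) \<Rightarrow> 'b" where
  "total_sum \<Phi> = (\<Sum>a\<in>- {0}. \<Phi> a)"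

text \<open>An idempotent left unnormalised, because the ring has no division by n and the later
  congruence needs integer coefficients.\<close>

definition quasi_idem :: "int \<Rightarrow> 'b::comm_ring_1 \<Rightarrow> bool" where
  "quasi_idem n B \<longleftrightarrow> n \<noteq> 0 \<and> B * B = of_int n * B"

lemma two_le_CARD_field: "2 \<le> CARD('a::{field,finite})"
  using card_mono[of UNIV "{0, 1 :: 'a}"] by simp

lemma quasi_idem_family:
  fixes \<Phi> :: "'a::{field,finite} \<Rightarrow> 'b::comm_ring_1"
  assumes \<Phi>: "\<forall>a b. a \<noteq> 0 \<longrightarrow> b \<noteq> 0 \<longrightarrow> \<Phi> a * \<Phi> b = of_int M * \<Phi> (a * b)"
    and "odd CARD('a)" "M \<noteq> 0"
  shows "quasi_idem M (\<Phi> 1)" "quasi_idem (2 * M) (\<Phi> 1 - \<Phi> (- 1))" "quasi_idem (2 * M) (\<Phi> 1 + \<Phi> (- 1))"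
    "quasi_idem (M * (int CARD('a) - 1)) (total_sum \<Phi>)"
    "quasi_idem (M * (int CARD('a) - 1)) (sign_sum \<Phi>)"
proof -
  have mult: "\<Phi> a * \<Phi> b = of_int M * \<Phi> (a * b)" if "a \<noteq> 0" "b \<noteq> 0" for a b
    using \<Phi> that by blast
  have q1: "int CARD('a) - 1 \<noteq> 0" using two_le_CARD_field[where 'a = 'a] by simp
  show "quasi_idem M (\<Phi> 1)" using mult[of 1 1] assms(3) by (simp add: quasi_idem_def)
  show "quasi_idem (2 * M) (\<Phi> 1 - \<Phi> (- 1))" "quasi_idem (2 * M) (\<Phi> 1 + \<Phi> (- 1))"
    using mult[of 1 1] mult[of 1 "- 1"] mult[of "- 1" 1] mult[of "- 1" "- 1"] assms(3)
    by (simp_all add: quasi_idem_def algebra_simps)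
  show "quasi_idem (M * (int CARD('a) - 1)) (total_sum \<Phi>)"
    using character_sum_square[of \<Phi> M "\<lambda>_. 1", OF mult] q1 assms(3)
    by (simp add: quasi_idem_def total_sum_def)
  show "quasi_idem (M * (int CARD('a) - 1)) (sign_sum \<Phi>)"
    using character_sum_square[of \<Phi> M qchar, OF mult qchar_mult[OF assms(2)]] q1 assms(3)
    unfolding quasi_idem_def sign_sum_def by simp
qed

text \<open>
  A multiple of the projection to the principal series with parameters \<open>\<alpha>, \<beta>\<close> such that
  \<open>\<alpha> (- 1) = \<beta> (- 1) = - 1\<close>.
\<close>

definition parity_cf :: "'a::{field,finite} class_fun" where
  "parity_cf = principal_cf 1 1 + principal_cf (- 1) (- 1) - 2 * principal_cf 1 (- 1)"

text \<open>A multiple of the projection to the principal series with trivial central character: the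
  first factor projects to that central character, the second to the whole principal series.\<close>

definition even_principal_cf :: "'a::{field,finite} class_fun" where
  "even_principal_cf = total_sum scalar_cf * principal_cf 1 1"

text \<open>The projections overlap, for instance \<open>total_sum det_cf\<close> lies inside
  \<open>det_cf 1\<close>. The position in the list is the index of the bits \<open>e 0\<close> to
  \<open>e 11\<close> in \<open>spectral_arithmetic\<close>.\<close>

definition spectral_list :: "(int \<times> 'a::{field,finite} class_fun) list" where
  "spectral_list = (let q = int CARD('a); m = q * (q^2 - 1); n = (q - 1) * (q^2 - 1) in
    [(2, scalar_cf 1 + scalar_cf (- 1)), (q - 1, total_sum scalar_cf),
     (m, det_cf 1), (n, steinberg_cf 1),
     (m * (q - 1), total_sum det_cf), (m * (q - 1), sign_sum det_cf),
     (n * (q - 1), total_sum steinberg_cf), (n * (q - 1), sign_sum steinberg_cf),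
     (8 * (q - 1)^2 * q, parity_cf),
     (2 * n, steinberg_cf 1 - steinberg_cf (- 1)), (2 * m, det_cf 1 - det_cf (- 1)),
     (2 * (q - 1)^3 * q, even_principal_cf)])"

text \<open>The three summands span a subring: by \<open>principal_principal\<close> every product
  of two of them is a combination of them. The symmetry of \<open>principal_cf\<close> identifies
  the two mixed elements, and collecting terms gives the factor 8.\<close>

lemma quasi_idem_parity:
  assumes odd: "odd CARD('a::{field,finite})"
  shows "quasi_idem (8 * (int CARD('a) - 1)^2 * int CARD('a)) (parity_cf :: 'a class_fun)"
proof -
  define c where "c = (int CARD('a) - 1)^2 * int CARD('a)"
  have c0: "c \<noteq> 0" using two_le_CARD_field[where 'a = 'a] by (simp add: c_def)
  let ?P = "principal_cf 1 1 :: 'a class_fun" and ?P' = "principal_cf (- 1) (- 1) :: 'a class_fun"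
    and ?H = "principal_cf 1 (- 1) :: 'a class_fun"
  have sym: "principal_cf (- 1) 1 = ?H" by (rule principal_cf_commute[OF odd]) auto
  note pp = principal_principal[where 'a = 'a, folded c_def]
  have "?P * ?P = of_int c * (?P + ?P)" "?P * ?P' = of_int c * (?P' + ?P')" "?P' * ?P' = of_int c * (?P + ?P)"
    "?P * ?H = of_int c * (?H + ?H)" "?P' * ?H = of_int c * (?H + ?H)" "?H * ?H = of_int c * (?P + ?P')"
    using pp[of 1 1 1 1] pp[of 1 1 "- 1" "- 1"] pp[of "- 1" "- 1" "- 1" "- 1"] pp[of 1 1 1 "- 1"]
      pp[of "- 1" "- 1" 1 "- 1"] pp[of 1 "- 1" 1 "- 1"]
    by (simp_all add: sym)
  then have "parity_cf * parity_cf = of_int (8 * c) * (parity_cf :: 'a class_fun)"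
    unfolding parity_cf_def by (simp add: algebra_simps) algebra
  then show ?thesis using c0 by (simp add: quasi_idem_def c_def mult.assoc)
qed

lemma quasi_idem_spectral_list:
  assumes odd: "odd CARD('a::{field,finite})"
    and "(n, B) \<in> set (spectral_list :: (int \<times> 'a class_fun) list)"
  shows "quasi_idem n B"
proof -
  define q where "q = int CARD('a)"
  have q: "q \<ge> 2" using two_le_CARD_field[where 'a = 'a] by (simp add: q_def)
  then have "q * q > 1" using mult_mono[of 2 q 2 q] by simp
  then have nz: "q * (q^2 - 1) \<noteq> 0" "(q - 1) * (q^2 - 1) \<noteq> 0"
    using q by (simp_all add: power2_eq_square)
  have "\<forall>a b :: 'a. a \<noteq> 0 \<longrightarrow> b \<noteq> 0 \<longrightarrow> scalar_cf a * scalar_cf b = of_int 1 * scalar_cf (a * b)"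
    by (simp add: scalar_scalar)
  from quasi_idem_family[of scalar_cf 1, OF this odd]
  have S: "quasi_idem 2 (scalar_cf 1 + scalar_cf (- 1) :: 'a class_fun)"
    "quasi_idem (q - 1) (total_sum scalar_cf :: 'a class_fun)" by (simp_all add: q_def)
  have "\<forall>a b :: 'a. a \<noteq> 0 \<longrightarrow> b \<noteq> 0 \<longrightarrow> det_cf a * det_cf b = of_int (q * (q^2 - 1)) * det_cf (a * b)"
    unfolding q_def by (intro allI impI det_det)
  note D = quasi_idem_family[of det_cf "q * (q^2 - 1)", OF this odd nz(1), folded q_def]
  have "\<forall>a b :: 'a. a \<noteq> 0 \<longrightarrow> b \<noteq> 0 \<longrightarrow>
      steinberg_cf a * steinberg_cf b = of_int ((q - 1) * (q^2 - 1)) * steinberg_cf (a * b)"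
    unfolding q_def by (intro allI impI steinberg_steinberg)
  note T = quasi_idem_family[of steinberg_cf "(q - 1) * (q^2 - 1)", OF this odd nz(2), folded q_def]
  have E: "quasi_idem (2 * (q - 1)^3 * q) (even_principal_cf :: 'a class_fun)"
  proof -
    have Z: "total_sum scalar_cf * total_sum scalar_cf = of_int (q - 1) * (total_sum scalar_cf :: 'a class_fun)"
      using S(2) by (simp add: quasi_idem_def)
    have P: "principal_cf 1 1 * principal_cf 1 1 = of_int (2 * ((q - 1)^2 * q)) * (principal_cf 1 1 :: 'a class_fun)"
      using principal_principal[of 1 1 1 "1::'a", folded q_def] by simp
    have "even_principal_cf * even_principal_cf =
        (total_sum scalar_cf * total_sum scalar_cf) * (principal_cf 1 1 * principal_cf 1 (1::'a))"
      unfolding even_principal_cf_def by (simp only: ac_simps)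
    also have "\<dots> = of_int ((q - 1) * (2 * ((q - 1)^2 * q))) * even_principal_cf"
      unfolding Z P even_principal_cf_def of_int_mult by (simp only: ac_simps)
    also have "(q - 1) * (2 * ((q - 1)^2 * q)) = 2 * (q - 1)^3 * q"
      by (simp add: power2_eq_square power3_eq_cube)
    finally show ?thesis using q by (simp add: quasi_idem_def)
  qed
  note K = quasi_idem_parity[OF odd, folded q_def]
  show ?thesis
    using assms(2) unfolding spectral_list_def Let_def q_def[symmetric] list.set insert_iff empty_iff prod.inject
    by (elim disjE conjE FalseE) (simp_all only: S D T E K)
qed

section \<open>Joint eigenvectors in the regular representation\<close>

lemma regular_rep_of_int_mult:
  "regular_rep (of_int n * f) *v w = of_int n *s (regular_rep f *v w)"
  by (simp add: regular_rep_def matrix_vector_mult_def vec_eq_iff sum_distrib_left mult.assoc)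

lemma regular_rep_act_add: "regular_rep (f + f') *v w = regular_rep f *v w + regular_rep f' *v w"
  by (simp add: regular_rep_simps matrix_vector_mult_add_rdistrib)

lemma regular_rep_act_diff: "regular_rep (f - f') *v w = regular_rep f *v w - regular_rep f' *v w"
  by (simp add: regular_rep_simps matrix_vector_mult_diff_rdistrib)

lemma regular_rep_act_mult: "regular_rep (f * f') *v w = regular_rep f *v (regular_rep f' *v w)"
  by (simp add: regular_rep_mult matrix_vector_mul_assoc)

definition rep_eigen :: "int \<times> 'a::{field,finite} class_fun \<Rightarrow> complex^'a gl2 \<Rightarrow> bool" where
  "rep_eigen p w \<longleftrightarrow> regular_rep (snd p) *v w = 0 \<or> regular_rep (snd p) *v w = of_int (fst p) *s w"

lemma rep_eigen_image:
  assumes "rep_eigen p v"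
  shows "rep_eigen p (c *s (regular_rep B *v v))"
proof -
  have *: "regular_rep (snd p) *v (c *s (regular_rep B *v v)) = c *s (regular_rep B *v (regular_rep (snd p) *v v))"
    by (simp add: vector_scalar_commute mult.commute flip: regular_rep_act_mult)
  from assms show ?thesis unfolding rep_eigen_def *
    by (auto simp: vector_scalar_commute mult.commute)
qed

lemma rep_eigen_diff_image:
  assumes "rep_eigen p v"
  shows "rep_eigen p (v - c *s (regular_rep B *v v))"
proof -
  have *: "regular_rep (snd p) *v (c *s (regular_rep B *v v)) = c *s (regular_rep B *v (regular_rep (snd p) *v v))"
    by (simp add: vector_scalar_commute mult.commute flip: regular_rep_act_mult)
  from assms show ?thesis unfolding rep_eigen_def matrix_vector_mult_diff_distrib *
    by (auto simp: vector_scalar_commute mult.commute vec.scale_right_diff_distrib)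
qed

text \<open>With x = B v / n, the vector v is x + (v - x), where B acts as n on x and as 0 on v - x.
  As the ring is commutative, both parts keep the eigenvalue property for the elements already
  treated, which are collected in \<open>M\<close>. An additive predicate \<open>Q\<close> takes the
  place of a direct sum decomposition.\<close>

lemma joint_eigen_decomposition:
  assumes "\<forall>(n, B)\<in>set L. quasi_idem n B"
    and add: "\<And>u v. Q u \<Longrightarrow> Q v \<Longrightarrow> Q (u + v)"
    and "\<And>w. (\<forall>p\<in>M \<union> set L. rep_eigen p w) \<Longrightarrow> Q w"
    and "\<forall>p\<in>M. rep_eigen p v"
  shows "Q v"
  using assms(1,3,4)
proof (induction L arbitrary: M v)
  case Nil
  then show ?case by simp
next
  case (Cons p L)
  obtain n B where p: "p = (n, B)" by (cases p)
  have n: "n \<noteq> 0" and BB: "B * B = of_int n * B" using Cons.prems(1) by (auto simp: p quasi_idem_def)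
  define x where "x = inverse (of_int n) *s (regular_rep B *v v)"
  have Bx: "regular_rep B *v x = regular_rep B *v v"
    using n by (simp add: x_def vector_scalar_commute regular_rep_of_int_mult BB flip: regular_rep_act_mult)
  have x: "regular_rep B *v v = of_int n *s x"
    using n by (simp add: x_def)
  have IH: "Q w" if w: "\<forall>p'\<in>insert p M. rep_eigen p' w" for w
  proof (rule Cons.IH[of "insert p M"])
    show "\<forall>(n, B)\<in>set L. quasi_idem n B" using Cons.prems(1) by simp
    show "Q w" if "\<forall>p'\<in>insert p M \<union> set L. rep_eigen p' w" for w
      by (rule Cons.prems(2)) (use that in auto)
  qed (rule w)
  have "rep_eigen p x" unfolding rep_eigen_def p using Bx x by simp
  moreover have "rep_eigen p (v - x)"
    unfolding rep_eigen_def p by (simp add: matrix_vector_mult_diff_distrib Bx)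
  moreover have "rep_eigen p' x" "rep_eigen p' (v - x)" if "p' \<in> M" for p'
    unfolding x_def using Cons.prems(3) that by (auto intro: rep_eigen_image rep_eigen_diff_image)
  ultimately have "Q x" "Q (v - x)" by (auto intro!: IH)
  then show ?case using add[of x "v - x"] by simp
qed

section \<open>The spectrum of the Cayley graph\<close>

text \<open>\<open>4 (q - 1)\<close> times the indicator of the connection set (\<open>cay_cf_apply\<close>).\<close>

definition cay_cf :: "'a::{field,finite} class_fun" where
  "cay_cf = (let q = int CARD('a) in
    of_int (4 * (q - 1) * q) * (scalar_cf 1 + scalar_cf (- 1)) - of_int (4 * (q^2 - 1)) * total_sum scalar_cf +
    of_int (4 * (q - 1)) * det_cf 1 + of_int (2 * (q - 1)) * (total_sum det_cf - sign_sum det_cf) +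
    4 * eig_cf 1 (- 1) - 2 * (eig_cf 1 1 + eig_cf (- 1) (- 1)) + 4 * total_sum (\<lambda>c. eig_cf c c) -
    2 * eig_sum 1 - (total_sum eig_sum - sign_sum eig_sum))"

text \<open>The factor q - 1 allows every \<open>eig_cf\<close> to be replaced by
  \<open>principal_cf\<close> plus \<open>eig_sum\<close>, and every \<open>eig_sum\<close> is then
  split into a Steinberg and a determinant part. The diagonal sum of \<open>eig_cf c c\<close>
  yields sums over squares c^2, which \<open>sum_nonzero_square\<close> turns into the trivial and
  the quadratic projection.\<close>

lemma cay_cf_spectral:
  fixes q :: int
  assumes odd: "odd CARD('a::{field,finite})" and q: "q = int CARD('a)"
  shows "of_int (q - 1) * (cay_cf :: 'a class_fun) =
    of_int (4 * (q - 1)^2 * q) * (scalar_cf 1 + scalar_cf (- 1)) -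
    of_int (4 * (q - 1)^2 * (q + 1)) * total_sum scalar_cf +
    of_int (2 * (q - 1)^2) * det_cf 1 - of_int (2 * (q - 1)) * steinberg_cf 1 +
    of_int ((q - 1)^2) * (total_sum det_cf - sign_sum det_cf) -
    of_int (q - 1) * (total_sum steinberg_cf - sign_sum steinberg_cf) - 2 * parity_cf -
    4 * (steinberg_cf 1 - steinberg_cf (- 1)) - of_int (4 * (q - 1)) * (det_cf 1 - det_cf (- 1)) +
    4 * even_principal_cf + 4 * (total_sum steinberg_cf + sign_sum steinberg_cf) +
    of_int (4 * (q - 1)) * (total_sum det_cf + sign_sum det_cf)"
proof -
  define r :: "'a class_fun" where "r = of_int (q - 1)"
  have Y: "eig_sum a = steinberg_cf a + r * det_cf a" for a :: 'a
    by (simp add: steinberg_cf_def r_def q)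
  have Yt: "total_sum eig_sum = total_sum steinberg_cf + r * (total_sum det_cf :: 'a class_fun)"
    unfolding total_sum_def by (simp add: Y sum.distrib sum_distrib_left)
  have Ys: "sign_sum eig_sum = sign_sum steinberg_cf + r * (sign_sum det_cf :: 'a class_fun)"
    unfolding sign_sum_def by (simp add: Y sum.distrib sum_distrib_left algebra_simps)
  have E: "r * eig_cf 1 (- 1) = principal_cf 1 (- 1) + eig_sum (- 1 :: 'a)"
    "r * eig_cf 1 1 = principal_cf 1 1 + eig_sum (1 :: 'a)"
    "r * eig_cf (- 1) (- 1) = principal_cf (- 1) (- 1) + eig_sum (1 :: 'a)"
    by (simp_all add: principal_cf_def r_def q)
  have "even_principal_cf = (\<Sum>c\<in>- {0::'a}. principal_cf 1 1 * scalar_cf c)"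
    unfolding even_principal_cf_def total_sum_def sum_distrib_right by (simp only: mult.commute)
  also have "\<dots> = (\<Sum>c\<in>- {0::'a}. principal_cf c c)"
    by (rule sum.cong[OF refl]) (simp add: principal_scalar)
  also have "\<dots> = r * total_sum (\<lambda>c. eig_cf c c) - (\<Sum>c\<in>- {0::'a}. eig_sum (c\<^sup>2))"
    unfolding principal_cf_def total_sum_def sum_subtractf sum_distrib_left r_def q power2_eq_square by (rule refl)
  also have "(\<Sum>c\<in>- {0::'a}. eig_sum (c\<^sup>2)) = total_sum eig_sum + sign_sum eig_sum"
    unfolding total_sum_def sign_sum_def by (rule sum_nonzero_square[OF odd])
  finally have V: "r * total_sum (\<lambda>c. eig_cf c c) = even_principal_cf + total_sum eig_sum + sign_sum (eig_sum :: 'a \<Rightarrow> _)"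
    by (simp add: algebra_simps)
  have "r * (cay_cf :: 'a class_fun) = r * (of_int (4 * (q - 1) * q) * (scalar_cf 1 + scalar_cf (- 1)) -
      of_int (4 * (q^2 - 1)) * total_sum scalar_cf +
      4 * r * det_cf 1 + 2 * r * (total_sum det_cf - sign_sum det_cf)) +
      4 * (r * eig_cf 1 (- 1)) - 2 * (r * eig_cf 1 1 + r * eig_cf (- 1) (- 1)) + 4 * (r * total_sum (\<lambda>c. eig_cf c c)) -
      2 * r * eig_sum 1 - r * (total_sum eig_sum - sign_sum eig_sum)"
    unfolding cay_cf_def Let_def q[symmetric] r_def by (simp add: algebra_simps)
  also have "\<dots> = r * (of_int (4 * (q - 1) * q) * (scalar_cf 1 + scalar_cf (- 1)) -
      of_int (4 * (q^2 - 1)) * total_sum scalar_cf) +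
      2 * r * r * det_cf 1 - 2 * r * steinberg_cf 1 + r * r * (total_sum det_cf - sign_sum det_cf) -
    r * (total_sum steinberg_cf - sign_sum steinberg_cf) - 2 * parity_cf -
    4 * (steinberg_cf 1 - steinberg_cf (- 1)) - 4 * r * (det_cf 1 - det_cf (- 1)) +
    4 * even_principal_cf + 4 * (total_sum steinberg_cf + sign_sum steinberg_cf) +
    4 * r * (total_sum det_cf + sign_sum det_cf)"
    unfolding E V Yt Ys Y parity_cf_def by (simp add: algebra_simps)
  also have "r * (of_int (4 * (q - 1) * q) * (scalar_cf 1 + scalar_cf (- 1)) -
      of_int (4 * (q^2 - 1)) * total_sum scalar_cf) =
      of_int (4 * (q - 1)^2 * q) * (scalar_cf 1 + scalar_cf (- 1)) -
      of_int (4 * (q - 1)^2 * (q + 1)) * total_sum scalar_cf"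
    unfolding r_def by (simp add: algebra_simps power2_eq_square)
  finally show ?thesis
    unfolding r_def by (simp add: algebra_simps power2_eq_square)
qed

text \<open>The left side is \<open>cay_cf_spectral\<close> with each element replaced by its factor
  times a bit. Here q - 1 = 2 k and q + 1 = 2 (k + 1), so that all coefficients share the factor 4
  (q - 1)^2.\<close>

lemma spectral_arithmetic:
  fixes k l :: int and e :: "nat \<Rightarrow> int"
  assumes l: "k * (k + 1) = 2 * l" and q: "q = 2 * k + 1" and m: "m = q * (q^2 - 1)" and n: "n = (q - 1) * (q^2 - 1)"
  shows "4 * (q - 1)^2 * q * (2 * e 0) - 4 * (q - 1)^2 * (q + 1) * ((q - 1) * e 1) +
    2 * (q - 1)^2 * (m * e 2) - 2 * (q - 1) * (n * e 3) +
    (q - 1)^2 * (m * (q - 1) * e 4 - m * (q - 1) * e 5) -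
    (q - 1) * (n * (q - 1) * e 6 - n * (q - 1) * e 7) - 2 * (8 * (q - 1)^2 * q * e 8) -
    4 * (2 * n * e 9) - 4 * (q - 1) * (2 * m * e 10) + 4 * (2 * (q - 1)^3 * q * e 11) +
    4 * (n * (q - 1) * e 6 + n * (q - 1) * e 7) + 4 * (q - 1) * (m * (q - 1) * e 4 + m * (q - 1) * e 5) =
    4 * (q - 1)^2 * (2 * q * e 0 + 4 * (- 2 * l * e 1 + l * q * e 2 - l * e 3 + k * l * q * (e 4 - e 5)
      - k * l * (e 6 - e 7) - q * e 8 - (k + 1) * e 9 - q * (k + 1) * e 10 + k * q * e 11
      + 2 * l * (e 6 + e 7) + 2 * l * q * (e 4 + e 5)))"
proof -
  define h where "h = k * (k + 1)"
  have "4 * (q - 1)^2 * q * (2 * e 0) - 4 * (q - 1)^2 * (q + 1) * ((q - 1) * e 1) +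
    2 * (q - 1)^2 * (m * e 2) - 2 * (q - 1) * (n * e 3) +
    (q - 1)^2 * (m * (q - 1) * e 4 - m * (q - 1) * e 5) -
    (q - 1) * (n * (q - 1) * e 6 - n * (q - 1) * e 7) - 2 * (8 * (q - 1)^2 * q * e 8) -
    4 * (2 * n * e 9) - 4 * (q - 1) * (2 * m * e 10) + 4 * (2 * (q - 1)^3 * q * e 11) +
    4 * (n * (q - 1) * e 6 + n * (q - 1) * e 7) + 4 * (q - 1) * (m * (q - 1) * e 4 + m * (q - 1) * e 5) =
    4 * (q - 1)^2 * (2 * q * e 0 + (- 4 * h * e 1 + 2 * h * q * e 2 - 2 * h * e 3 + 2 * k * h * q * (e 4 - e 5)
      - 2 * k * h * (e 6 - e 7) - 4 * q * e 8 - 4 * (k + 1) * e 9 - 4 * q * (k + 1) * e 10 + 4 * k * q * e 11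
      + 4 * h * (e 6 + e 7) + 4 * h * q * (e 4 + e 5)))"
    unfolding h_def m n q by (simp add: algebra_simps power2_eq_square power3_eq_cube)
  \<comment> \<open>Only the evenness of k (k + 1) makes the coefficients such as 2 h q and 2 k h
    multiples of 4; the others already are, apart from 2 q at \<open>e 0\<close>.\<close>
  also have "h = 2 * l" using l by (simp add: h_def)
  finally show ?thesis by (simp add: algebra_simps)
qed

section \<open>The exponential series on eigenvectors\<close>

lemma matrix_power_eigen:
  assumes "A *v w = \<mu> *s w"
  shows "matrix_power A k *v w = \<mu> ^ k *s (w :: 'a::field^'n::finite)"
proof (induction k)
  case (Suc k)
  have "matrix_power A (Suc k) *v w = A *v (matrix_power A k *v w)"
    by (simp add: matrix_vector_mul_assoc)
  also have "\<dots> = \<mu> ^ Suc k *s w"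
    unfolding Suc by (simp add: vector_scalar_commute assms mult.commute)
  finally show ?case .
qed simp

lemma vec_sumsI:
  fixes f :: "nat \<Rightarrow> 'a::real_normed_vector^'n"
  assumes "\<And>i. (\<lambda>k. f k $ i) sums (x $ i)"
  shows "f sums x"
  unfolding sums_def by (rule vec_tendstoI) (use assms in \<open>simp add: sums_def sum_component\<close>)

lemma exp_series_eigen:
  fixes A :: "complex^'n^'n::finite"
  assumes "A *v w = \<mu> *s w"
  shows "(\<lambda>k. (1 / fact k) *\<^sub>R (matrix_power A k *v w)) sums (exp \<mu> *s w)"
proof (rule vec_sumsI)
  fix i
  have "(\<lambda>k. (\<mu> ^ k /\<^sub>R fact k) * w $ i) sums (exp \<mu> * w $ i)"
    by (rule sums_mult2[OF exp_converges])
  then show "(\<lambda>k. ((1 / fact k) *\<^sub>R (matrix_power A k *v w)) $ i) sums ((exp \<mu> *s w) $ i)"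
    by (simp add: matrix_power_eigen[OF assms] divide_inverse)
qed

lemma matrix_vector_mult_axis: "(A *v axis j 1) $ i = (A $ i $ j :: 'a::semiring_1)"
  by (simp add: matrix_vector_mult_def axis_def if_distrib cong: if_cong)

text \<open>Applied to the basis vectors, the hypothesis gives the convergence of every column, so
  the infinite sum in \<open>matrix_exp\<close> is a genuine limit.\<close>

lemma matrix_exp_eqI:
  fixes A W :: "complex^'n^'n::finite"
  assumes "\<And>w. (\<lambda>k. (1 / fact k) *\<^sub>R (matrix_power A k *v w)) sums (W *v w)"
  shows "matrix_exp A = W"
proof -
  have "(\<lambda>k. (1 / fact k) *\<^sub>R matrix_power A k) sums W"
  proof (intro vec_sumsI)
    fix i j
    have "(\<lambda>k. ((1 / fact k) *\<^sub>R (matrix_power A k *v axis j 1)) $ i) sums ((W *v axis j 1) $ i)"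
      using assms[of "axis j 1"] unfolding sums_def
      by (auto dest: tendsto_vec_nth[where i = i] simp: sum_component)
    then show "(\<lambda>k. ((1 / fact k) *\<^sub>R matrix_power A k) $ i $ j) sums (W $ i $ j)"
      by (simp add: matrix_vector_mult_axis)
  qed
  then show ?thesis unfolding matrix_exp_def by (rule sums_unique[symmetric])
qed

text \<open>The multiple of 4 contributes full turns. The rest is a rotation by - \<pi> q e, that
  is, by e half turns as q is odd.\<close>

lemma exp_quarter_period:
  assumes "odd q" "e \<in> {0, 1 :: int}"
  shows "exp (- \<i> * complex_of_real (pi / 2) * of_int (2 * q * e + 4 * j)) = of_int (1 - 2 * e)"
proof -
  obtain r where r: "q = 2 * r + 1" using assms(1) by (auto elim: oddE)
  have eq: "- \<i> * complex_of_real (pi / 2) * of_int (2 * q * e + 4 * j) =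
      of_int e * (- (of_real pi * \<i>)) + 2 * of_int (- (r * e + j)) * of_real pi * \<i>"
    by (simp add: r algebra_simps)
  have one: "exp (2 * of_int (- (r * e + j)) * of_real pi * \<i>) = 1"
    using exp_integer_2pi[of "of_int (- (r * e + j))"] by simp
  have "exp (- \<i> * complex_of_real (pi / 2) * of_int (2 * q * e + 4 * j)) =
      exp (of_int e * (- (of_real pi * \<i>)))" unfolding eq exp_add one by (rule mult_1_right)
  also have "\<dots> = of_int (1 - 2 * e)" using assms(2) by (auto simp: exp_minus)
  finally show ?thesis .
qed

lemma regular_rep_numeral_mult:
  "regular_rep (numeral n * f) *v w = numeral n *s (regular_rep f *v w)"
  using regular_rep_of_int_mult[of "numeral n" f w] by simp

lemma regular_rep_one: "regular_rep 1 *v w = w"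
  by (simp add: regular_rep_of_int[of 1, simplified])

lemma rep_eigen_coefficient:
  assumes "rep_eigen p w"
  shows "\<exists>e\<in>{0, 1}. regular_rep (snd p) *v w = of_int (fst p * e) *s w"
  using assms unfolding rep_eigen_def by (auto simp: vec.scale_zero_left)

text \<open>The bit \<open>e\<close> belongs to \<open>scalar_cf 1 + scalar_cf (- 1)\<close> and
  therefore tells whether the central element -1 acts as 1 or as -1. The outer factor 4 (q - 1) is
  the one between \<open>cay_cf\<close> and the adjacency matrix.\<close>

lemma cay_cf_eigenvalue:
  assumes odd: "odd CARD('a::{field,finite})"
    and w: "\<forall>p\<in>set (spectral_list :: (int \<times> 'a class_fun) list). rep_eigen p w"
  shows "\<exists>e\<in>{0, 1}. \<exists>j. regular_rep (scalar_cf (- 1)) *v w = of_int (2 * e - 1) *s w \<and>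
    regular_rep cay_cf *v w = of_int (4 * (int CARD('a) - 1) * (2 * int CARD('a) * e + 4 * j)) *s w"
proof -
  define q where "q = int CARD('a)"
  define m where "m = q * (q^2 - 1)"
  define n where "n = (q - 1) * (q^2 - 1)"
  obtain k where k: "q = 2 * k + 1" using odd by (auto simp: q_def elim: oddE)
  have "even (k * (k + 1))" by simp
  then obtain l where l: "k * (k + 1) = 2 * l" by (rule evenE)
  have q1: "q - 1 \<noteq> 0" using two_le_CARD_field[where 'a = 'a] by (simp add: q_def)
  let ?L = "spectral_list :: (int \<times> 'a class_fun) list"
  note L = spectral_list_def[where 'a = 'a, unfolded Let_def, folded q_def, folded m_def n_def]
  \<comment> \<open>A choice, because both values qualify when w = 0.\<close>
  define e :: "nat \<Rightarrow> int" where
    "e i = (SOME c. c \<in> {0, 1} \<and> regular_rep (snd (?L ! i)) *v w = of_int (fst (?L ! i) * c) *s w)" for i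
  have e: "e i \<in> {0, 1} \<and> regular_rep (snd (?L ! i)) *v w = of_int (fst (?L ! i) * e i) *s w"
    if "i < 12" for i
  proof -
    have "length ?L = 12" by (simp add: L)
    then have "?L ! i \<in> set ?L" using that by (intro nth_mem) simp
    then have "rep_eigen (?L ! i) w" using w by blast
    from rep_eigen_coefficient[OF this] show ?thesis
      unfolding e_def by (intro someI_ex[where P = "\<lambda>c. c \<in> {0, 1} \<and> regular_rep (snd (?L ! i)) *v w = of_int (fst (?L ! i) * c) *s w"]) blast
  qed
  have e2: "regular_rep (snd (?L ! i)) *v w = of_int (fst (?L ! i) * e i) *s w" if "i < 12" for i
    using e[OF that] by blast
  have act:
    "regular_rep (scalar_cf 1 + scalar_cf (- 1)) *v w = of_int (2 * e 0) *s w"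
    "regular_rep (total_sum scalar_cf) *v w = of_int ((q - 1) * e 1) *s w"
    "regular_rep (det_cf 1) *v w = of_int (m * e 2) *s w"
    "regular_rep (steinberg_cf 1) *v w = of_int (n * e 3) *s w"
    "regular_rep (total_sum det_cf) *v w = of_int (m * (q - 1) * e 4) *s w"
    "regular_rep (sign_sum det_cf) *v w = of_int (m * (q - 1) * e 5) *s w"
    "regular_rep (total_sum steinberg_cf) *v w = of_int (n * (q - 1) * e 6) *s w"
    "regular_rep (sign_sum steinberg_cf) *v w = of_int (n * (q - 1) * e 7) *s w"
    "regular_rep parity_cf *v w = of_int (8 * (q - 1)^2 * q * e 8) *s w"
    "regular_rep (steinberg_cf 1 - steinberg_cf (- 1)) *v w = of_int (2 * n * e 9) *s w"
    "regular_rep (det_cf 1 - det_cf (- 1)) *v w = of_int (2 * m * e 10) *s w"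
    "regular_rep even_principal_cf *v w = of_int (2 * (q - 1)^3 * q * e 11) *s w"
    using e2[of 0] e2[of 1] e2[of 2] e2[of 3] e2[of 4] e2[of 5] e2[of 6] e2[of 7] e2[of 8] e2[of 9] e2[of 10] e2[of 11]
    by (simp_all add: L del: of_int_mult of_int_diff of_int_power of_int_numeral)
  define j where "j = - 2 * l * e 1 + l * q * e 2 - l * e 3 + k * l * q * (e 4 - e 5)
      - k * l * (e 6 - e 7) - q * e 8 - (k + 1) * e 9 - q * (k + 1) * e 10 + k * q * e 11
      + 2 * l * (e 6 + e 7) + 2 * l * q * (e 4 + e 5)"
  have "of_int (q - 1) *s (regular_rep cay_cf *v w) = of_int (4 * (q - 1)^2 * (2 * q * e 0 + 4 * j)) *s w"
  proof -
    have "of_int (q - 1) *s (regular_rep cay_cf *v w) = regular_rep (of_int (q - 1) * cay_cf) *v w"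
      by (rule regular_rep_of_int_mult[symmetric])
    also have "\<dots> = of_int (4 * (q - 1)^2 * q * (2 * e 0) - 4 * (q - 1)^2 * (q + 1) * ((q - 1) * e 1) +
      2 * (q - 1)^2 * (m * e 2) - 2 * (q - 1) * (n * e 3) +
      (q - 1)^2 * (m * (q - 1) * e 4 - m * (q - 1) * e 5) -
      (q - 1) * (n * (q - 1) * e 6 - n * (q - 1) * e 7) - 2 * (8 * (q - 1)^2 * q * e 8) -
      4 * (2 * n * e 9) - 4 * (q - 1) * (2 * m * e 10) + 4 * (2 * (q - 1)^3 * q * e 11) +
      4 * (n * (q - 1) * e 6 + n * (q - 1) * e 7) + 4 * (q - 1) * (m * (q - 1) * e 4 + m * (q - 1) * e 5)) *s w"
      unfolding cay_cf_spectral[OF odd q_def]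
      \<comment> \<open>The instances leave \<open>scalar_cf 1 + scalar_cf (- 1)\<close>,
        \<open>steinberg_cf 1 - steinberg_cf (- 1)\<close> and
        \<open>det_cf 1 - det_cf (- 1)\<close> intact, since \<open>act\<close> gives the
        eigenvalues of these combinations as a whole.\<close>
      unfolding regular_rep_act_diff[of _ parity_cf] regular_rep_act_diff[of "_ - _"] regular_rep_act_diff[of "_ + _"]
        regular_rep_act_diff[of "of_int _ * _"] regular_rep_act_diff[of "total_sum _"] regular_rep_act_add[of _ "_ * _"]
        regular_rep_act_add[of "total_sum _"]
        regular_rep_of_int_mult regular_rep_numeral_mult act
      by (simp add: vec_eq_iff algebra_simps)
    also have "\<dots> = of_int (4 * (q - 1)^2 * (2 * q * e 0 + 4 * j)) *s w"
      unfolding j_def spectral_arithmetic[OF l k m_def n_def] by (rule refl)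
    finally show ?thesis .
  qed
  also have "\<dots> = of_int (q - 1) *s (of_int (4 * (q - 1) * (2 * q * e 0 + 4 * j)) *s w)"
    by (simp add: vec.scale_scale power2_eq_square ac_simps)
  finally have "of_int (q - 1) *s (regular_rep cay_cf *v w) =
      of_int (q - 1) *s (of_int (4 * (q - 1) * (2 * q * e 0 + 4 * j)) *s w)" .
  moreover have "(of_int (q - 1) :: complex) \<noteq> 0" using q1 unfolding of_int_eq_0_iff .
  ultimately have "regular_rep cay_cf *v w = of_int (4 * (q - 1) * (2 * q * e 0 + 4 * j)) *s w"
    using vec.scale_left_imp_eq by blast
  moreover have "regular_rep (scalar_cf (- 1)) *v w = of_int (2 * e 0 - 1) *s w"
    using act(1) unfolding regular_rep_act_add scalar_cf_one regular_rep_one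
    by (simp add: vec_eq_iff algebra_simps)
  moreover have "e 0 \<in> {0, 1}" using e[of 0] by simp
  ultimately show ?thesis unfolding q_def by blast
qed

lemma matrix_vector_mult_scaled:
  assumes "\<And>u v. B $ u $ v = c * A $ u $ v"
  shows "B *v w = c *s (A *v w :: 'a::comm_ring_1^'n)"
  by (simp add: matrix_vector_mult_def vec_eq_iff sum_distrib_left mult.assoc assms)

text \<open>Both sides are additive in the vector they are applied to, so they need to be compared
  only on joint eigenvectors. There the eigenvalue of A is 2 q e + 4 j, and its exponential 1 - 2 e
  is minus the eigenvalue 2 e - 1 of the central element.\<close>

theorem cay_matrix_exp:
  fixes A :: "complex^'a::{field,finite} gl2^'a gl2"
  assumes odd: "odd CARD('a)"
    and A: "\<And>u v. of_int (4 * (int CARD('a) - 1)) * A $ u $ v = cf_apply cay_cf (u \<odot> gl2_inv v)"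
  shows "matrix_exp (\<chi> u v. - \<i> * complex_of_real (pi / 2) * A $ u $ v) = - regular_rep (scalar_cf (- 1))"
proof (rule matrix_exp_eqI)
  fix w0
  define M where "M = (\<chi> u v. - \<i> * complex_of_real (pi / 2) * A $ u $ v)"
  define q where "q = int CARD('a)"
  have q1: "(of_int (4 * (q - 1)) :: complex) \<noteq> 0"
    using two_le_CARD_field[where 'a = 'a] unfolding of_int_eq_0_iff q_def by simp
  show "(\<lambda>k. (1 / fact k) *\<^sub>R (matrix_power M k *v w0)) sums (- regular_rep (scalar_cf (- 1)) *v w0)"
  proof (rule joint_eigen_decomposition[where L = "spectral_list :: (int \<times> 'a class_fun) list" and M = "{}"
        and Q = "\<lambda>w. (\<lambda>k. (1 / fact k) *\<^sub>R (matrix_power M k *v w)) sums (- regular_rep (scalar_cf (- 1)) *v w)"])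
    show "\<forall>(n, B)\<in>set spectral_list. quasi_idem n (B :: 'a class_fun)"
      using quasi_idem_spectral_list[OF odd] by blast
  next
    fix u v
    assume "(\<lambda>k. (1 / fact k) *\<^sub>R (matrix_power M k *v u)) sums (- regular_rep (scalar_cf (- 1)) *v u)"
      "(\<lambda>k. (1 / fact k) *\<^sub>R (matrix_power M k *v v)) sums (- regular_rep (scalar_cf (- 1)) *v v)"
    from sums_add[OF this]
    show "(\<lambda>k. (1 / fact k) *\<^sub>R (matrix_power M k *v (u + v))) sums
        (- regular_rep (scalar_cf (- 1)) *v (u + v))"
      by (simp add: matrix_vector_right_distrib scaleR_right_distrib)
  next
    fix w
    assume "\<forall>p\<in>{} \<union> set (spectral_list :: (int \<times> 'a class_fun) list). rep_eigen p w"
    then have "\<forall>p\<in>set (spectral_list :: (int \<times> 'a class_fun) list). rep_eigen p w" by simp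
    from cay_cf_eigenvalue[OF odd this] obtain e j where e: "e \<in> {0, 1}"
      and t: "regular_rep (scalar_cf (- 1)) *v w = of_int (2 * e - 1) *s w"
      and c: "regular_rep cay_cf *v w = of_int (4 * (q - 1) * (2 * q * e + 4 * j)) *s w"
      unfolding q_def by blast
    have "regular_rep cay_cf *v w = of_int (4 * (q - 1)) *s (A *v w)"
      by (rule matrix_vector_mult_scaled) (simp only: regular_rep_def vec_lambda_beta A q_def)
    then have "of_int (4 * (q - 1)) *s (A *v w) = of_int (4 * (q - 1)) *s (of_int (2 * q * e + 4 * j) *s w)"
      unfolding c by (simp only: of_int_mult vec.scale_scale)
    then have "A *v w = of_int (2 * q * e + 4 * j) *s w" using q1 by (rule vec.scale_left_imp_eq[rotated])
    moreover have "M *v w = (- \<i> * complex_of_real (pi / 2)) *s (A *v w)"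
      by (rule matrix_vector_mult_scaled) (simp only: M_def vec_lambda_beta)
    ultimately have "M *v w = (- \<i> * complex_of_real (pi / 2) * of_int (2 * q * e + 4 * j)) *s w"
      by (simp only: vec.scale_scale)
    note series = exp_series_eigen[OF this]
    have "odd q" using odd by (simp add: q_def)
    have "(\<lambda>k. (1 / fact k) *\<^sub>R (matrix_power M k *v w)) sums (of_int (1 - 2 * e) *s w)"
      using series unfolding exp_quarter_period[OF \<open>odd q\<close> e] .
    moreover have "- regular_rep (scalar_cf (- 1)) *v w = of_int (1 - 2 * e) *s w"
    proof -
      have "- regular_rep (scalar_cf (- 1)) *v w = - (regular_rep (scalar_cf (- 1)) *v w)"
        by (simp add: vec_eq_iff matrix_vector_mult_def sum_negf)
      then show ?thesis unfolding t by (simp add: vec_eq_iff algebra_simps)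
    qed
    ultimately show "(\<lambda>k. (1 / fact k) *\<^sub>R (matrix_power M k *v w)) sums
        (- regular_rep (scalar_cf (- 1)) *v w)" by simp
  qed simp
qed

section \<open>The connection set\<close>

definition gl2_disc :: "'a::field gl2 \<Rightarrow> 'a" where
  "gl2_disc g = (gl2_trace g)\<^sup>2 - 4 * gl2_det g"

text \<open>The three alternatives are the classes of \<open>c3 1 (- 1)\<close>, of the
  \<open>c2 x\<close>, and of those \<open>c4\<close> whose determinant, the norm of z, is 1 or a
  nonsquare.\<close>

definition cay_class :: "'a::field gl2 \<Rightarrow> bool" where
  "cay_class g \<longleftrightarrow> \<not> scalar_mat (mat_of_gl2 g) \<and>
    (gl2_trace g = 0 \<and> gl2_det g = - 1 \<or> gl2_disc g = 0 \<or>
     gl2_disc g \<in> nonsquares \<and> (gl2_det g = 1 \<or> gl2_det g \<in> nonsquares))"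

text \<open>Completing the square in e^2 - t e + d = 0; e = 0 is no root because \<open>d\<close> is
  not zero.\<close>

lemma root_sum_iff:
  fixes t d e :: "'a::field"
  assumes "(2::'a) \<noteq> 0" "d \<noteq> 0"
  shows "e \<noteq> 0 \<and> t = e + d / e \<longleftrightarrow> (2 * e - t)\<^sup>2 = t\<^sup>2 - 4 * d"
proof -
  have "(2 * e - t)\<^sup>2 - (t\<^sup>2 - 4 * d) = 2 * (2 * (e * e + d - t * e))"
    by (simp add: power2_eq_square algebra_simps)
  then have "(2 * e - t)\<^sup>2 = t\<^sup>2 - 4 * d \<longleftrightarrow> 2 * (2 * (e * e + d - t * e)) = 0"
    by (metis right_minus_eq)
  also have "\<dots> \<longleftrightarrow> e * e + d - t * e = 0"
    by (simp only: mult_eq_0_iff assms(1) simp_thms)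
  also have "\<dots> \<longleftrightarrow> t * e = e * e + d" by auto
  finally have *: "(2 * e - t)\<^sup>2 = t\<^sup>2 - 4 * d \<longleftrightarrow> t * e = e * e + d" .
  show ?thesis
  proof (cases "e = 0")
    case True
    then show ?thesis unfolding * using assms(2) by simp
  next
    case False
    have eq: "e + d / e = (e * e + d) / e" using False by (simp add: add_divide_distrib)
    show ?thesis unfolding * eq nonzero_eq_divide_eq[OF False] using False by blast
  qed
qed

text \<open>The number of eigenvalues of a matrix with trace t and determinant d. Discriminant 0
  stands apart since \<open>qchar 0 = 1\<close> would count the double root twice.\<close>

lemma root_count:
  fixes t d :: "'a::{field,finite}"
  assumes odd: "odd CARD('a)" and "d \<noteq> 0"
  shows "(\<Sum>e\<in>- {0}. of_bool (t = e + d / e)) = (if t\<^sup>2 - 4 * d = 0 then 1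
    else 1 + of_int (qchar (t\<^sup>2 - 4 * d)) :: complex)"
proof -
  define D where "D = t\<^sup>2 - 4 * d"
  have two: "(2::'a) \<noteq> 0" by (rule odd_CARD_two_neq_zero[OF odd])
  have "- {0} \<inter> {e. t = e + d / e} = {e. (2 * e - t)\<^sup>2 = D}"
    using root_sum_iff[OF two assms(2), of _ t] unfolding D_def by auto
  then have sum: "(\<Sum>e\<in>- {0}. of_bool (t = e + d / e)) = (of_nat (card {e. (2 * e - t)\<^sup>2 = D}) :: complex)"
    by (subst sum_of_bool_eq) simp_all
  have half: "2 * e - t = b \<longleftrightarrow> e = (t + b) / 2" for e b
    unfolding nonzero_eq_divide_eq[OF two] diff_eq_eq by (simp only: mult.commute add.commute)
  show ?thesis
  proof (cases "\<exists>b. D = b\<^sup>2")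
    case True
    then obtain b where b: "D = b\<^sup>2" by blast
    have set: "{e. (2 * e - t)\<^sup>2 = D} = {(t + b) / 2, (t + - b) / 2}"
      unfolding b power2_eq_iff half by auto
    have "(t + b) / 2 = (t + - b) / 2 \<longleftrightarrow> b = - b"
      by (simp only: divide_cancel_right two add_left_cancel simp_thms)
    also have "\<dots> \<longleftrightarrow> b = 0" using two by (simp only: eq_neg_iff_add_eq_0 mult_2[symmetric] mult_eq_0_iff simp_thms)
    finally have "card {e. (2 * e - t)\<^sup>2 = D} = (if b = 0 then 1 else 2)"
      unfolding set using two by (simp add: card_insert_if)
    moreover have "D = 0 \<longleftrightarrow> b = 0" by (simp add: b)
    moreover have "qchar D = 1" using True by (simp add: qchar_def)
    ultimately show ?thesis unfolding sum D_def[symmetric] by simp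
  next
    case False
    then have "{e. (2 * e - t)\<^sup>2 = D} = {}" by auto
    moreover have "D \<noteq> 0" using False by (metis power_zero_numeral)
    moreover have "qchar D = - 1" using False by (simp add: qchar_def)
    ultimately show ?thesis unfolding sum D_def[symmetric] by simp
  qed
qed

lemma cf_apply_total_scalar:
  "cf_apply (total_sum scalar_cf) g = of_bool (scalar_mat (mat_of_gl2 g))"
  for g :: "'a::{field,finite} gl2"
proof (cases "scalar_mat (mat_of_gl2 g)")
  case True
  then obtain c where c: "mat_of_gl2 g = mat c" unfolding scalar_mat_def by blast
  then have "c \<noteq> 0" using gl2_det_nz[of g] by (auto simp: det_scalar)
  have "(\<Sum>a\<in>- {0}. cf_apply (scalar_cf a) g) = (\<Sum>a\<in>- {0}. if a = c then 1 else 0)"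
    by (rule sum.cong[OF refl]) (auto simp: cf_apply_scalar c mat_eq_mk2 mk2_eq_iff)
  then show ?thesis using True \<open>c \<noteq> 0\<close> by (simp add: total_sum_def)
next
  case False
  then show ?thesis by (auto simp: total_sum_def cf_apply_scalar scalar_mat_def intro!: sum.neutral)
qed

text \<open>The factor \<open>1 - qchar\<close> is twice the indicator of a nonsquare
  determinant.\<close>

lemma cf_apply_total_minus_sign:
  fixes g :: "'a::{field,finite} gl2"
  assumes "\<And>a. a \<noteq> 0 \<Longrightarrow> cf_apply (\<Phi> a) g = of_bool (gl2_det g = a) * y"
  shows "cf_apply (total_sum \<Phi> - sign_sum \<Phi>) g = (1 - of_int (qchar (gl2_det g))) * y"
proof -
  have "cf_apply (total_sum \<Phi> - sign_sum \<Phi>) g = (\<Sum>a\<in>- {0}. (1 - of_int (qchar a)) * cf_apply (\<Phi> a) g)"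
    by (simp add: total_sum_def sign_sum_def left_diff_distrib sum_subtractf)
  also have "\<dots> = (\<Sum>a\<in>- {0}. if a = gl2_det g then (1 - of_int (qchar (gl2_det g))) * y else 0)"
    by (rule sum.cong[OF refl]) (auto simp: assms)
  finally show ?thesis by simp
qed

text \<open>This explains the coefficients of \<open>cay_cf\<close>. On nonscalar elements the
  determinant terms give 4 (q - 1) whenever the determinant is 1 or a nonsquare, and the
  \<open>eig_sum\<close> terms cancel this if there are two eigenvalues, leaving trace 0 and
  determinant -1 to \<open>eig_cf 1 (- 1)\<close>. For a double eigenvalue the diagonal sum gives 4
  (q - 1), and \<open>eig_cf 1 1\<close> and \<open>eig_cf (- 1) (- 1)\<close> repair determinant 1.
  The \<open>scalar_cf\<close> terms make the total vanish on the centre.\<close>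

lemma cay_cf_apply:
  fixes g :: "'a::{field,finite} gl2"
  assumes odd: "odd CARD('a)"
  shows "cf_apply cay_cf g = of_int (4 * (int CARD('a) - 1)) * of_bool (cay_class g)"
proof -
  define q where "q = int CARD('a)"
  define d where "d = gl2_det g"
  define t where "t = gl2_trace g"
  define D where "D = t\<^sup>2 - 4 * d"
  \<comment> \<open>The number of eigenvectors for each eigenvalue of g in the base field;
    \<open>r\<close> below is the number of such eigenvalues.\<close>
  define w where "w = (if scalar_mat (mat_of_gl2 g) then q^2 - 1 else q - 1)"
  define r where "r = (if D = 0 then 1 else 1 + qchar D)"
  have two: "(2::'a) \<noteq> 0" by (rule odd_CARD_two_neq_zero[OF odd])
  have four: "(4::'a) \<noteq> 0" using two by (metis mult_2 mult_eq_0_iff numeral_Bit0 numeral_plus_numeral semiring_norm(2))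
  have d0: "d \<noteq> 0" by (simp add: d_def)
  have eig: "cf_apply (eig_cf a b) g = of_bool (d = a * b \<and> t = a + b) * of_int w" if "a \<noteq> 0" for a b
    unfolding cf_apply_eig_explicit[OF odd that] d_def t_def w_def q_def by (rule refl)
  have eigs: "cf_apply (eig_sum a) g = of_bool (d = a) * (of_int w * of_int r)" for a
  proof -
    have "cf_apply (eig_sum a) g = (\<Sum>e\<in>- {0}. of_bool (d = a) * of_int w * of_bool (t = e + d / e))"
      unfolding eig_sum_def cf_apply_sum by (rule sum.cong[OF refl]) (auto simp: eig)
    also have "\<dots> = of_bool (d = a) * of_int w * (\<Sum>e\<in>- {0}. of_bool (t = e + d / e))"
      by (rule sum_distrib_left[symmetric])
    finally show ?thesis unfolding root_count[OF odd d0] r_def D_def by simp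
  qed
  have diag: "cf_apply (total_sum (\<lambda>c. eig_cf c c)) g = of_bool (D = 0) * of_int w"
  proof -
    define h where "h = t / 2"
    have half: "d = c * c \<and> t = c + c \<longleftrightarrow> c = h \<and> D = 0" for c
    proof -
      have "t = c + c \<longleftrightarrow> c = h"
        using two unfolding h_def nonzero_eq_divide_eq[OF two] mult_2_right by auto
      moreover have "d = c * c \<longleftrightarrow> D = 0" if "t = c + c"
      proof -
        have "D = 4 * (c * c - d)" unfolding D_def that by (simp add: power2_eq_square algebra_simps)
        then show ?thesis using four by auto
      qed
      ultimately show ?thesis by blast
    qed
    have h0: "h \<noteq> 0" if "D = 0" using that d0 four two by (auto simp: D_def h_def)
    have "cf_apply (total_sum (\<lambda>c. eig_cf c c)) g = (\<Sum>c\<in>- {0}. if c = h then of_bool (D = 0) * of_int w else 0)"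
      unfolding total_sum_def cf_apply_sum
    proof (rule sum.cong[OF refl])
      fix c :: 'a assume "c \<in> - {0}"
      then have "c \<noteq> 0" by simp
      show "cf_apply (eig_cf c c) g = (if c = h then of_bool (D = 0) * of_int w else 0)"
        unfolding eig[OF \<open>c \<noteq> 0\<close>] half by simp
    qed
    then show ?thesis using h0 by (cases "D = 0") simp_all
  qed
  have dets: "cf_apply (total_sum det_cf - sign_sum det_cf) g = (1 - of_int (qchar d)) * 1"
    unfolding d_def by (rule cf_apply_total_minus_sign) (simp add: cf_apply_det)
  have eigss: "cf_apply (total_sum eig_sum - sign_sum eig_sum) g = (1 - of_int (qchar d)) * (of_int w * of_int r)"
    unfolding d_def by (rule cf_apply_total_minus_sign) (simp add: eigs d_def)
  define s where "s = (of_bool (mat_of_gl2 g = mat 1) + of_bool (mat_of_gl2 g = mat (- 1)) :: int)"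
  have val: "cf_apply cay_cf g = of_int (4 * (q - 1) * q * s - 4 * (q^2 - 1) * of_bool (scalar_mat (mat_of_gl2 g)) +
      4 * (q - 1) * of_bool (d = 1) + 2 * (q - 1) * (1 - qchar d) + 4 * (of_bool (d = - 1 \<and> t = 0) * w) -
      2 * (of_bool (d = 1 \<and> t = 2) * w + of_bool (d = 1 \<and> t = - 2) * w) + 4 * (of_bool (D = 0) * w) -
      2 * (of_bool (d = 1) * (w * r)) - (1 - qchar d) * (w * r))"
    unfolding cay_cf_def Let_def q_def[symmetric] cf_apply_simps cf_apply_of_int_mult cf_apply_numeral_mult
      cf_apply_total_scalar dets[unfolded cf_apply_simps] eigss[unfolded cf_apply_simps] diag
    by (simp add: eig eigs cf_apply_scalar cf_apply_det s_def d_def[symmetric])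
  have class_eq: "cay_class g \<longleftrightarrow> \<not> scalar_mat (mat_of_gl2 g) \<and>
    (t = 0 \<and> d = - 1 \<or> D = 0 \<or> D \<in> nonsquares \<and> (d = 1 \<or> d \<in> nonsquares))"
    unfolding cay_class_def gl2_disc_def D_def t_def d_def by (rule refl)
  have D0: "qchar d = 1 \<and> (d = 1 \<longleftrightarrow> t = 2 \<or> t = - 2)" if "D = 0"
  proof -
    have t4: "t\<^sup>2 = 4 * d" using that by (simp add: D_def)
    then have "d = (t / 2)\<^sup>2" using four by (simp add: power_divide)
    then have "qchar d = 1" by (metis qchar_square)
    moreover have "d = 1 \<longleftrightarrow> t\<^sup>2 = 2\<^sup>2" unfolding t4 using four by simp
    ultimately show ?thesis unfolding power2_eq_iff by blast
  qed
  have trace0: "D \<noteq> 0 \<and> qchar D = 1" if "t = 0" "d = - 1"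
  proof -
    have D: "D = 2\<^sup>2" by (simp add: D_def that)
    show ?thesis unfolding D by (intro conjI power_not_zero two qchar_square)
  qed
  have unip: "D = 0" if "d = 1" "t = 2 \<or> t = - 2" using that by (auto simp: D_def)
  \<comment> \<open>Thus t = 2 and t = -2 exclude each other, and for D = 0 their indicators add up
    to that of d = 1.\<close>
  have two_neq: "(2::'a) \<noteq> - 2" using four by (simp add: eq_neg_iff_add_eq_0)
  show ?thesis
  proof (cases "scalar_mat (mat_of_gl2 g)")
    case False
    then have w: "w = q - 1" and s: "s = 0"
      by (auto simp: w_def s_def scalar_mat_def)
    consider "D = 0" | "D \<noteq> 0" "qchar D = 1" | "D \<noteq> 0" "qchar D = - 1" using qchar_cases[of D] by blast
    then show ?thesis
    proof cases
      case 1
      have c: "cay_class g" using False 1 unfolding class_eq by blast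
      have r: "r = 1" using 1 by (simp add: r_def)
      have z: "of_bool (d = - 1 \<and> t = 0) = (0 :: int)" using trace0 1 by auto
      have "of_bool (d = 1 \<and> t = 2) + of_bool (d = 1 \<and> t = - 2) = (of_bool (d = 1) :: int)"
        using D0[OF 1] two_neq by auto
      then have u: "of_bool (d = 1 \<and> t = 2) * w + of_bool (d = 1 \<and> t = - 2) * w = of_bool (d = 1) * w"
        by (simp only: distrib_right[symmetric])
      show ?thesis unfolding val q_def[symmetric] z u r using c False D0[OF 1] 1
        by (simp add: w s)
    next
      case 2
      have c: "cay_class g \<longleftrightarrow> d = - 1 \<and> t = 0" using False 2 unfolding class_eq by (auto simp: mem_nonsquares)
      have r: "r = 2" using 2 by (simp add: r_def)
      have z: "of_bool (d = 1 \<and> t = 2) = (0 :: int)" "of_bool (d = 1 \<and> t = - 2) = (0 :: int)"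
        using unip 2 by auto
      show ?thesis unfolding val q_def[symmetric] c z r using False 2
        by (simp add: w s algebra_simps)
    next
      case 3
      have c: "cay_class g \<longleftrightarrow> d = 1 \<or> qchar d = - 1"
        using False 3 trace0 d0 unfolding class_eq by (auto simp: mem_nonsquares)
      have r: "r = 0" using 3 by (simp add: r_def)
      have z: "of_bool (d = 1 \<and> t = 2) = (0 :: int)" "of_bool (d = 1 \<and> t = - 2) = (0 :: int)"
        "of_bool (d = - 1 \<and> t = 0) = (0 :: int)"
        using unip trace0 3 by auto
      show ?thesis unfolding val q_def[symmetric] c z r using False 3 qchar_cases[of d]
        by (auto simp: w s algebra_simps)
    qed
  next
    case True
    then obtain c where c: "mat_of_gl2 g = mat c" unfolding scalar_mat_def by blast
    have tc: "t = 2 * c" and dc: "d = c\<^sup>2" by (simp_all add: t_def d_def c trace_scalar det_scalar)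
    have 1: "D = 0" unfolding D_def tc dc by (simp add: power_mult_distrib)
    have "mat_of_gl2 g = mat 1 \<longleftrightarrow> c = 1" "mat_of_gl2 g = mat (- 1) \<longleftrightarrow> c = - 1"
      unfolding c by (auto simp: mat_eq_mk2 mk2_eq_iff)
    moreover have "d = 1 \<longleftrightarrow> c = 1 \<or> c = - 1" unfolding dc by (simp add: power2_eq_1_iff)
    moreover have "(1::'a) \<noteq> - 1" using two by (simp add: eq_neg_iff_add_eq_0)
    ultimately have s: "s = of_bool (d = 1)" by (auto simp: s_def)
    have w: "w = q^2 - 1" using True by (simp add: w_def)
    have r: "r = 1" using 1 by (simp add: r_def)
    have t0: "\<not> (d = - 1 \<and> t = 0)" using trace0 1 by blast
    have "of_bool (d = 1 \<and> t = 2) + of_bool (d = 1 \<and> t = - 2) = (of_bool (d = 1) :: int)"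
      using D0[OF 1] two_neq by auto
    then have u: "of_bool (d = 1 \<and> t = 2) * w + of_bool (d = 1 \<and> t = - 2) * w = of_bool (d = 1) * w"
      by (simp only: distrib_right[symmetric])
    have "\<not> cay_class g" using True unfolding class_eq by blast
    then show ?thesis unfolding val u s r q_def[symmetric] using True D0[OF 1] 1 t0
      by (simp add: w algebra_simps power2_eq_square)
  qed
qed

section \<open>The norm of the quadratic extension in coordinates\<close>

locale quadratic_extension =
  fixes \<iota> :: "'a::{field,finite} \<Rightarrow> 'b::{field,finite}" and \<Delta> :: 'a and s :: 'b
  assumes primepow_card: "primepow CARD('a)" and odd_card: "odd CARD('a)"
    and card_ext: "CARD('b) = CARD('a)\<^sup>2"
    and emb_1: "\<iota> 1 = 1"
    and emb_add: "\<And>x y. \<iota> (x + y) = \<iota> x + \<iota> y"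
    and emb_mult: "\<And>x y. \<iota> (x * y) = \<iota> x * \<iota> y"
    and nonsquare: "\<Delta> \<in> nonsquares" and sqrt: "s\<^sup>2 = \<iota> \<Delta>"
begin

lemma emb_0 [simp]: "\<iota> 0 = 0"
proof -
  have "\<iota> 0 + \<iota> 0 = \<iota> 0 + 0" using emb_add[of 0 0] by simp
  then show ?thesis by (simp only: add_left_cancel)
qed

lemma emb_minus: "\<iota> (- x) = - \<iota> x"
  using emb_add[of x "- x"] by (simp add: eq_neg_iff_add_eq_0 add.commute)

lemma emb_diff: "\<iota> (x - y) = \<iota> x - \<iota> y"
  using emb_add[of x "- y"] by (simp add: emb_minus)

lemma emb_eq_0 [simp]: "\<iota> x = 0 \<longleftrightarrow> x = 0"
proof
  assume "\<iota> x = 0"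
  show "x = 0"
  proof (rule ccontr)
    assume "x \<noteq> 0"
    then have "\<iota> x * \<iota> (inverse x) = 1" using emb_mult[of x "inverse x"] emb_1 by simp
    then show False using \<open>\<iota> x = 0\<close> by simp
  qed
qed simp

lemma emb_eq_iff [simp]: "\<iota> x = \<iota> y \<longleftrightarrow> x = y"
  using emb_eq_0[of "x - y"] unfolding emb_diff by simp

lemma emb_power: "\<iota> (x ^ n) = \<iota> x ^ n"
  by (induction n) (simp_all add: emb_1 emb_mult)

lemma sqrt_not_in_range: "s \<noteq> \<iota> b"
proof
  assume "s = \<iota> b"
  then have "\<iota> (b\<^sup>2) = \<iota> \<Delta>" using sqrt by (simp add: emb_power)
  then show False using nonsquare by (auto simp: nonsquares_def)
qed

lemma coords_0:
  assumes "\<iota> x + \<iota> y * s = 0"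
  shows "x = 0 \<and> y = 0"
proof -
  have "y = 0"
  proof (rule ccontr)
    assume y: "y \<noteq> 0"
    have "\<iota> (- x / y) * \<iota> y = \<iota> (- x)" using y by (simp flip: emb_mult)
    also have "\<dots> = s * \<iota> y" using assms unfolding emb_minus by (simp add: add_eq_0_iff mult.commute)
    finally have "s = \<iota> (- x / y)" using y by simp
    then show False using sqrt_not_in_range by blast
  qed
  then show ?thesis using assms by simp
qed

lemma coords_unique:
  assumes "\<iota> x + \<iota> y * s = \<iota> x' + \<iota> y' * s"
  shows "x = x' \<and> y = y'"
proof -
  have "\<iota> (x - x') + \<iota> (y - y') * s = (\<iota> x + \<iota> y * s) - (\<iota> x' + \<iota> y' * s)"
    by (simp add: emb_diff algebra_simps)
  then have "\<iota> (x - x') + \<iota> (y - y') * s = 0" unfolding assms by simp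
  from coords_0[OF this] show ?thesis by simp
qed

text \<open>Surjectivity by counting: the coordinate map is injective between sets of size
  q^2.\<close>

lemma coords_exist: "\<exists>x y. z = \<iota> x + \<iota> y * s"
proof -
  let ?f = "\<lambda>(x, y). \<iota> x + \<iota> y * s"
  have "inj ?f" using coords_unique by (auto simp: inj_def)
  then have "card (range ?f) = CARD('a \<times> 'a)" by (rule card_image)
  also have "\<dots> = CARD('b)" by (simp add: card_ext power2_eq_square)
  finally have "range ?f = UNIV" by (intro card_subset_eq) auto
  then have "z \<in> range ?f" by simp
  then show ?thesis by auto
qed

lemma quad_coords_eq: "quad_coords \<iota> s (\<iota> x + \<iota> y * s) = (x, y)"
  unfolding quad_coords_def
proof (rule the_equality)
  fix p assume "case p of (x', y') \<Rightarrow> \<iota> x + \<iota> y * s = \<iota> x' + \<iota> y' * s"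
  then show "p = (x, y)" using coords_unique by (cases p) fastforce
qed simp

lemma c4_eq: "c4 \<Delta> \<iota> s (\<iota> x + \<iota> y * s) = mk2 x (\<Delta> * y) y x"
  by (simp add: c4_def quad_coords_eq mk2_def)

lemma coords_in_range: "\<iota> x + \<iota> y * s \<in> range \<iota> \<longleftrightarrow> y = 0"
proof
  assume "\<iota> x + \<iota> y * s \<in> range \<iota>"
  then obtain w where "\<iota> x + \<iota> y * s = \<iota> w + \<iota> 0 * s" by auto
  from coords_unique[OF this] show "y = 0" by simp
qed simp

text \<open>The characteristic of the extension is the prime whose power is q, because it divides
  q^2.\<close>

lemma frobenius_add: "(x + y :: 'b) ^ CARD('a) = x ^ CARD('a) + y ^ CARD('a)"
proof -
  obtain p n where pn: "prime p" "CARD('a) = p ^ n"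
    using primepow_card by (auto simp: primepow_def)
  have "CHAR('b) > 0" by (rule finite_imp_CHAR_pos) simp
  then have "prime CHAR('b)" by (rule prime_CHAR_semidom)
  moreover have "CHAR('b) dvd p ^ (n * 2)"
    using CHAR_dvd_CARD[where 'a = 'b] unfolding card_ext pn(2) power_mult .
  ultimately have "CHAR('b) dvd p" by (rule prime_dvd_power)
  then have "CHAR('b) = p" using \<open>prime CHAR('b)\<close> pn(1) by (simp add: primes_dvd_imp_eq)
  then show ?thesis using \<open>prime CHAR('b)\<close> pn(2) by (intro freshmans_dream'[of _ n]) simp_all
qed

lemma frobenius_coords: "(\<iota> x + \<iota> y * s) ^ CARD('a) = \<iota> x + \<iota> y * s ^ CARD('a)"
  unfolding frobenius_add power_mult_distrib by (simp add: finite_field_power_card flip: emb_power)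

text \<open>The power is a square root of \<Delta>, hence s or -s. If s were fixed, so would be
  every element of the extension, and the polynomial X^q - X would have q^2 roots.\<close>

lemma frobenius_sqrt: "s ^ CARD('a) = - s"
proof -
  have "(s ^ CARD('a))\<^sup>2 = (s\<^sup>2) ^ CARD('a)" by (simp add: power_mult[symmetric] mult.commute)
  also have "\<dots> = s\<^sup>2" unfolding sqrt by (simp add: finite_field_power_card flip: emb_power)
  finally have "s ^ CARD('a) = s \<or> s ^ CARD('a) = - s" by (rule power2_eq_iff[THEN iffD1])
  moreover have "s ^ CARD('a) \<noteq> s"
  proof
    assume fixed: "s ^ CARD('a) = s"
    have all: "z ^ CARD('a) = z" for z :: 'b
      using coords_exist[of z] frobenius_coords fixed by metis
    define P :: "'b poly" where "P = Polynomial.monom 1 (CARD('a)) - Polynomial.monom 1 1"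
    have q: "1 < CARD('a)" using two_le_CARD_field[where 'a = 'a] by simp
    have "Polynomial.coeff P (CARD('a)) = 1" using q by (simp add: P_def)
    then have "P \<noteq> 0" by auto
    from card_poly_roots_bound[OF this] have "CARD('b) \<le> degree P"
      by (simp add: P_def poly_monom all)
    also have "\<dots> \<le> CARD('a)" unfolding P_def
      by (rule degree_diff_le) (use q in \<open>auto intro: order.trans[OF degree_monom_le]\<close>)
    finally show False using q unfolding card_ext power2_eq_square by simp
  qed
  ultimately show ?thesis by blast
qed

text \<open>The q-th power map is the conjugation s to -s, so the power q + 1 is the product of an
  element with its conjugate; it is also the determinant of \<open>c4\<close>.\<close>

lemma norm_coords: "(\<iota> x + \<iota> y * s) ^ (CARD('a) + 1) = \<iota> (x\<^sup>2 - \<Delta> * y\<^sup>2)"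
proof -
  have "(\<iota> x + \<iota> y * s) ^ (CARD('a) + 1) = (\<iota> x + \<iota> y * s) * (\<iota> x - \<iota> y * s)"
    by (simp add: frobenius_coords frobenius_sqrt)
  also have "\<dots> = (\<iota> x)\<^sup>2 - (\<iota> y)\<^sup>2 * s\<^sup>2" by (simp add: power2_eq_square algebra_simps)
  also have "\<dots> = \<iota> (x\<^sup>2 - \<Delta> * y\<^sup>2)" unfolding sqrt by (simp add: emb_diff emb_mult emb_power mult.commute)
  finally show ?thesis .
qed

lemma connection_reps_iff: "C \<in> connection_reps \<Delta> \<iota> s \<longleftrightarrow> C = mk2 1 0 0 (- 1) \<or>
  (\<exists>x. x \<noteq> 0 \<and> C = mk2 x 1 0 x) \<or>
  (\<exists>x y. y \<noteq> 0 \<and> C = mk2 x (\<Delta> * y) y x \<and> (x\<^sup>2 - \<Delta> * y\<^sup>2 = 1 \<or> x\<^sup>2 - \<Delta> * y\<^sup>2 \<in> nonsquares))"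
proof -
  have norm: "z ^ (CARD('a) + 1) \<in> {1} \<union> \<iota> ` nonsquares \<longleftrightarrow> x\<^sup>2 - \<Delta> * y\<^sup>2 = 1 \<or> x\<^sup>2 - \<Delta> * y\<^sup>2 \<in> nonsquares"
    if "z = \<iota> x + \<iota> y * s" for x y z
  proof -
    have "\<iota> d \<in> {1} \<union> \<iota> ` nonsquares \<longleftrightarrow> d = 1 \<or> d \<in> nonsquares" for d
      using emb_eq_iff[of d 1] unfolding emb_1 by (auto simp del: emb_eq_iff dest: emb_eq_iff[THEN iffD1])
    then show ?thesis unfolding that norm_coords .
  qed
  have "(\<exists>z. z \<noteq> 0 \<and> z \<notin> range \<iota> \<and> z ^ (CARD('a) + 1) \<in> {1} \<union> \<iota> ` nonsquares \<and> C = c4 \<Delta> \<iota> s z) \<longleftrightarrow>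
    (\<exists>x y. y \<noteq> 0 \<and> C = mk2 x (\<Delta> * y) y x \<and> (x\<^sup>2 - \<Delta> * y\<^sup>2 = 1 \<or> x\<^sup>2 - \<Delta> * y\<^sup>2 \<in> nonsquares))"
    (is "?L \<longleftrightarrow> ?R")
  proof
    assume ?L
    then obtain z where z: "z \<notin> range \<iota>" "z ^ (CARD('a) + 1) \<in> {1} \<union> \<iota> ` nonsquares" "C = c4 \<Delta> \<iota> s z"
      by blast
    obtain x y where xy: "z = \<iota> x + \<iota> y * s" using coords_exist by blast
    have "y \<noteq> 0" using z(1) unfolding xy coords_in_range .
    moreover have "C = mk2 x (\<Delta> * y) y x" using z(3) unfolding xy c4_eq .
    ultimately show ?R using z(2) norm[OF xy] by blast
  next
    assume ?R
    then obtain x y where xy: "y \<noteq> 0" "C = mk2 x (\<Delta> * y) y x"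
      "x\<^sup>2 - \<Delta> * y\<^sup>2 = 1 \<or> x\<^sup>2 - \<Delta> * y\<^sup>2 \<in> nonsquares" by blast
    define z where "z = \<iota> x + \<iota> y * s"
    have "z \<notin> range \<iota>" unfolding z_def coords_in_range using xy(1) by simp
    moreover from this have "z \<noteq> 0" using emb_0 by (metis rangeI)
    moreover have "z ^ (CARD('a) + 1) \<in> {1} \<union> \<iota> ` nonsquares" using norm[OF z_def] xy(3) by blast
    moreover have "C = c4 \<Delta> \<iota> s z" unfolding z_def c4_eq by (rule xy(2))
    ultimately show ?L by blast
  qed
  then show ?thesis
    unfolding connection_reps_def c2_def c3_def mk2_def[symmetric] by auto
qed

end

text \<open>The condition of \<open>cay_class\<close> for matrices not known to be invertible, such
  as the representatives in \<open>connection_reps\<close>.\<close>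

definition cay_matrix :: "'a::field^2^2 \<Rightarrow> bool" where
  "cay_matrix A \<longleftrightarrow> \<not> scalar_mat A \<and>
    (trace A = 0 \<and> det A = - 1 \<or> (trace A)\<^sup>2 - 4 * det A = 0 \<or>
     (trace A)\<^sup>2 - 4 * det A \<in> nonsquares \<and> (det A = 1 \<or> det A \<in> nonsquares))"

lemma cay_class_eq: "cay_class g \<longleftrightarrow> cay_matrix (mat_of_gl2 g)"
  by (simp add: cay_class_def cay_matrix_def gl2_disc_def)

lemma nonsquares_times_square:
  fixes n b :: "'a::{field,finite}"
  assumes "odd CARD('a)" "n \<in> nonsquares" "b \<noteq> 0"
  shows "n * b\<^sup>2 \<in> nonsquares"
  unfolding nonsquares_eq_times[OF assms(1,2)] using assms(3) by blast

lemma cay_class_conj: "cay_class (h \<odot> c \<odot> gl2_inv h) \<longleftrightarrow> cay_class c"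
proof -
  have inv: "gl2_inv h \<odot> (h \<odot> c) = c" by simp
  have "trace (mat_of_gl2 (h \<odot> c \<odot> gl2_inv h)) = trace (mat_of_gl2 (gl2_inv h \<odot> (h \<odot> c)))"
    unfolding GL2_simps(2)[of "h \<odot> c"] GL2_simps(2)[of "gl2_inv h"] by (rule trace_mul_sym)
  then have tr: "trace (mat_of_gl2 (h \<odot> c \<odot> gl2_inv h)) = trace (mat_of_gl2 c)" unfolding inv .
  have dt: "gl2_det (h \<odot> c \<odot> gl2_inv h) = gl2_det c" by simp
  have sc: "scalar_mat (mat_of_gl2 (h \<odot> c \<odot> gl2_inv h)) \<longleftrightarrow> scalar_mat (mat_of_gl2 c)"
    unfolding scalar_mat_def gl2_scalar_swap[of "h \<odot> c"] inv by (rule refl)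
  show ?thesis unfolding cay_class_eq cay_matrix_def tr dt sc by (rule refl)
qed

context quadratic_extension
begin

lemma connection_reps_cay:
  assumes "C \<in> connection_reps \<Delta> \<iota> s"
  shows "cay_matrix C"
proof -
  have two: "(2::'a) \<noteq> 0" by (rule odd_CARD_two_neq_zero[OF odd_card])
  then have one: "(1::'a) \<noteq> - 1" by (simp add: eq_neg_iff_add_eq_0)
  consider "C = mk2 1 0 0 (- 1)" | x where "C = mk2 x 1 0 x"
    | x y where "y \<noteq> 0" "C = mk2 x (\<Delta> * y) y x" "x\<^sup>2 - \<Delta> * y\<^sup>2 = 1 \<or> x\<^sup>2 - \<Delta> * y\<^sup>2 \<in> nonsquares"
    using assms unfolding connection_reps_iff by blast
  then show ?thesis
  proof cases
    case 1
    then show ?thesis using one by (simp add: cay_matrix_def scalar_mk2 trace_mk2 det_mk2)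
  next
    case (2 x)
    have "(x + x)\<^sup>2 - 4 * (x * x) = 0" by (simp add: power2_eq_square algebra_simps)
    then show ?thesis unfolding 2 cay_matrix_def scalar_mk2 trace_mk2 det_mk2 by simp
  next
    case (3 x y)
    have "(x + x)\<^sup>2 - 4 * (x * x - \<Delta> * y * y) = \<Delta> * (2 * y)\<^sup>2" by (simp add: power2_eq_square algebra_simps)
    then have "(x + x)\<^sup>2 - 4 * (x * x - \<Delta> * y * y) \<in> nonsquares"
      using nonsquares_times_square[OF odd_card nonsquare, of "2 * y"] two 3(1) by simp
    then show ?thesis using 3(1,3) unfolding 3(2) cay_matrix_def scalar_mk2 trace_mk2 det_mk2
      by (simp add: power2_eq_square mult.assoc)
  qed
qed

text \<open>In the last two cases x is half the trace. A nonsquare discriminant has the form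
  \<Delta> b^2, and y = b / 2 makes \<open>c4\<close> have that discriminant.\<close>

lemma cay_matrix_rep:
  assumes "cay_matrix A" "det A \<noteq> 0"
  shows "\<exists>C\<in>connection_reps \<Delta> \<iota> s. trace C = trace A \<and> det C = det A"
proof -
  have two: "(2::'a) \<noteq> 0" by (rule odd_CARD_two_neq_zero[OF odd_card])
  have four: "(4::'a) \<noteq> 0"
  proof -
    have "(4::'a) = 2 * 2" by simp
    then show ?thesis by (simp only: mult_eq_0_iff two simp_thms)
  qed
  define x where "x = trace A / 2"
  have tr: "trace A = x + x" using two by (simp add: x_def)
  consider "trace A = 0" "det A = - 1" | "(trace A)\<^sup>2 - 4 * det A = 0"
    | "(trace A)\<^sup>2 - 4 * det A \<in> nonsquares" "det A = 1 \<or> det A \<in> nonsquares"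
    using assms(1) unfolding cay_matrix_def by blast
  then show ?thesis
  proof cases
    case 1
    have "mk2 1 0 0 (- 1) \<in> connection_reps \<Delta> \<iota> s" unfolding connection_reps_iff by blast
    then show ?thesis using 1 by (intro bexI[of _ "mk2 1 0 0 (- 1)"]) (simp_all add: trace_mk2 det_mk2)
  next
    case 2
    have "4 * (x * x - det A) = 0" using 2 unfolding tr by (simp add: power2_eq_square algebra_simps)
    then have dt: "det A = x * x" using four by simp
    then have "x \<noteq> 0" using assms(2) by auto
    then have "mk2 x 1 0 x \<in> connection_reps \<Delta> \<iota> s" unfolding connection_reps_iff by blast
    then show ?thesis by (rule bexI[rotated]) (simp add: trace_mk2 det_mk2 tr dt)
  next
    case 3
    then obtain b where b: "(trace A)\<^sup>2 - 4 * det A = \<Delta> * b\<^sup>2" "b \<noteq> 0"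
      using nonsquares_eq_times[OF odd_card nonsquare] by auto
    define y where "y = b / 2"
    have y: "b = y + y" "y \<noteq> 0" using two b(2) by (simp_all add: y_def)
    have "4 * (x * x - det A - \<Delta> * y * y) = 0"
      using b(1) unfolding tr y(1) by (simp add: power2_eq_square algebra_simps)
    then have "x * x - det A - \<Delta> * y * y = 0" using four by (simp only: mult_eq_0_iff simp_thms)
    then have dt: "det A = x * x - \<Delta> * y * y" by (simp add: algebra_simps)
    then have "x\<^sup>2 - \<Delta> * y\<^sup>2 = det A" by (simp add: power2_eq_square mult.assoc)
    then have "x\<^sup>2 - \<Delta> * y\<^sup>2 = 1 \<or> x\<^sup>2 - \<Delta> * y\<^sup>2 \<in> nonsquares" using 3(2) by (simp only:)
    then have "mk2 x (\<Delta> * y) y x \<in> connection_reps \<Delta> \<iota> s"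
      unfolding connection_reps_iff using y(2) by blast
    then show ?thesis by (rule bexI[rotated]) (simp add: trace_mk2 det_mk2 tr dt)
  qed
qed

text \<open>All representatives and all elements of the class are nonscalar, so equal trace and
  determinant already give a conjugating matrix.\<close>

lemma mem_connection_set_iff: "g \<in> connection_set \<Delta> \<iota> s \<longleftrightarrow> cay_class g"
proof
  assume "g \<in> connection_set \<Delta> \<iota> s"
  then obtain h c where "g = h \<odot> c \<odot> gl2_inv h" "mat_of_gl2 c \<in> connection_reps \<Delta> \<iota> s"
    unfolding connection_set_def by blast
  then show "cay_class g" using connection_reps_cay by (simp only: cay_class_conj) (simp add: cay_class_eq)
next
  assume g: "cay_class g"
  then obtain C where C: "C \<in> connection_reps \<Delta> \<iota> s" "trace C = gl2_trace g" "det C = gl2_det g"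
    using cay_matrix_rep[of "mat_of_gl2 g"] unfolding cay_class_eq by auto
  obtain c where c: "mat_of_gl2 c = C" using gl2_obtain_matrix[of C] C(3) by auto
  have "\<not> scalar_mat C" using connection_reps_cay[OF C(1)] unfolding cay_matrix_def by blast
  moreover have "\<not> scalar_mat (mat_of_gl2 g)" using g unfolding cay_class_def by blast
  ultimately obtain P where P: "det P \<noteq> 0" "mat_of_gl2 g ** P = P ** C"
    using nonscalar_similar[of "mat_of_gl2 g" C] C by auto
  obtain h where h: "mat_of_gl2 h = P" using gl2_obtain_matrix[OF P(1)] by blast
  have "g \<odot> h = h \<odot> c" unfolding mat_of_gl2_inject[symmetric] GL2_simps h c by (rule P(2))
  then have "g \<odot> h \<odot> gl2_inv h = h \<odot> c \<odot> gl2_inv h" by (rule arg_cong)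
  then have "g = h \<odot> c \<odot> gl2_inv h" by simp
  then show "g \<in> connection_set \<Delta> \<iota> s" unfolding connection_set_def using C(1) c by blast
qed

end

section \<open>Connectedness and perfect state transfer\<close>

lemma gl2_scalar_inv:
  assumes "scalar_mat (mat_of_gl2 g)"
  shows "scalar_mat (mat_of_gl2 (gl2_inv g))"
proof -
  obtain c where c: "mat_of_gl2 g = mat c" using assms unfolding scalar_mat_def by blast
  then have "c \<noteq> 0" using gl2_det_nz[of g] by (auto simp: det_scalar)
  from ex_scalar[OF this] obtain s where s: "mat_of_gl2 s = mat c" "\<forall>v. gl2_inv s \<bullet>\<^sub>v v = inverse c *s v" by blast
  have "g = s" using c s(1) by (simp flip: mat_of_gl2_inject)
  then have "mat_of_gl2 (gl2_inv g) = mat (inverse c)" using s(2) unfolding gl2_eq_mat_iff by simp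
  then show ?thesis unfolding scalar_mat_def by blast
qed

text \<open>The inverse times the determinant is the adjugate, which has the same trace.\<close>

lemma gl2_trace_inv: "gl2_det g * gl2_trace (gl2_inv g) = gl2_trace g"
proof -
  obtain a b c d where A: "mat_of_gl2 g = mk2 a b c d" by (rule mk2_cases)
  obtain a' b' c' d' where B: "mat_of_gl2 (gl2_inv g) = mk2 a' b' c' d'" by (rule mk2_cases)
  have "mat_of_gl2 (gl2_inv g \<odot> g) = mat 1" by (simp add: GL2_simps)
  then have "mk2 a' b' c' d' ** mk2 a b c d = mk2 1 0 0 1" unfolding GL2_simps A B mat_eq_mk2 .
  then have e: "a' * a + b' * c = 1" "a' * b + b' * d = 0" "c' * a + d' * c = 0" "c' * b + d' * d = 1"
    unfolding mk2_mult mk2_eq_iff by blast+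
  have "(a * d - b * c) * a' = d * (a' * a + b' * c) - c * (a' * b + b' * d)"
    "(a * d - b * c) * d' = a * (c' * b + d' * d) - b * (c' * a + d' * c)" by (simp_all add: algebra_simps)
  then have "(a * d - b * c) * a' = d" "(a * d - b * c) * d' = a" unfolding e by simp_all
  then show ?thesis unfolding A B det_mk2 trace_mk2 by (simp add: distrib_left add.commute)
qed

lemma nonsquares_divide_square:
  fixes n b :: "'a::{field,finite}"
  assumes "odd CARD('a)" "b \<noteq> 0"
  shows "n * (inverse b)\<^sup>2 \<in> nonsquares \<longleftrightarrow> n \<in> nonsquares"
proof
  assume "n * (inverse b)\<^sup>2 \<in> nonsquares"
  from nonsquares_times_square[OF assms(1) this assms(2)] show "n \<in> nonsquares"
    using assms(2) by (simp add: mult.assoc flip: power_mult_distrib)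
next
  assume "n \<in> nonsquares"
  from nonsquares_times_square[OF assms(1) this, of "inverse b"] show "n * (inverse b)\<^sup>2 \<in> nonsquares"
    using assms(2) by simp
qed

text \<open>Inversion divides the trace by d and the discriminant by d^2, so squareness is
  unaffected, and 1 and -1 are their own inverses.\<close>

lemma cay_class_inv:
  fixes g :: "'a::{field,finite} gl2"
  assumes odd: "odd CARD('a)"
  shows "cay_class (gl2_inv g) \<longleftrightarrow> cay_class g"
proof -
  have "cay_class (gl2_inv g)" if g: "cay_class g" for g :: "'a gl2"
  proof -
    define d where "d = gl2_det g"
    have d0: "d \<noteq> 0" by (simp add: d_def)
    have tr: "gl2_trace (gl2_inv g) = gl2_trace g * inverse d"
    proof -
      have "gl2_trace (gl2_inv g) = d * gl2_trace (gl2_inv g) * inverse d" using d0 by simp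
      then show ?thesis using gl2_trace_inv[of g] by (simp only: d_def)
    qed
    have dt: "gl2_det (gl2_inv g) = d * (inverse d)\<^sup>2" using d0 by (simp add: d_def power2_eq_square)
    have disc: "gl2_disc (gl2_inv g) = gl2_disc g * (inverse d)\<^sup>2"
      unfolding gl2_disc_def tr dt d_def[symmetric] by (simp add: power_mult_distrib algebra_simps)
    have "scalar_mat (mat_of_gl2 (gl2_inv (gl2_inv g))) \<longrightarrow> scalar_mat (mat_of_gl2 g)" by simp
    then have sc: "\<not> scalar_mat (mat_of_gl2 (gl2_inv g))"
      using gl2_scalar_inv[of "gl2_inv g"] g unfolding cay_class_def by blast
    have "d * (inverse d)\<^sup>2 = inverse d" using d0 by (simp add: power2_eq_square flip: mult.assoc)
    then have 1: "d * (inverse d)\<^sup>2 = 1 \<longleftrightarrow> d = 1" "d * (inverse d)\<^sup>2 = - 1 \<longleftrightarrow> d = - 1"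
      using inverse_eq_iff_eq[of d 1] inverse_eq_iff_eq[of d "- 1"] by simp_all
    from g show ?thesis
      unfolding cay_class_def dt disc tr nonsquares_divide_square[OF odd d0] 1 d_def[symmetric]
      using sc d0 by auto
  qed
  from this[of g] this[of "gl2_inv g"] show ?thesis by auto
qed

lemma not_cay_class_one: "\<not> cay_class \<one>\<^bsub>GL2\<^esub>"
  unfolding cay_class_def GL2_simps scalar_mat_def by blast

text \<open>The class contains all nontrivial transvections, which generate the special linear
  group. The elements \<open>c2 x\<close> have determinant x^2 and reach all square determinants;
  one element of nonsquare determinant gives the other half.\<close>

lemma cay_class_generates:
  fixes g :: "'a::{field,finite} gl2"
  assumes odd: "odd CARD('a)" and \<Delta>: "\<Delta> \<in> (nonsquares :: 'a set)"
    and one: "P \<one>\<^bsub>GL2\<^esub>" and gen: "\<And>g :: 'a gl2. cay_class g \<Longrightarrow> P g"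
    and mult: "\<And>g h. P g \<Longrightarrow> P h \<Longrightarrow> P (g \<odot> h)"
  shows "P g"
proof -
  have two: "(2::'a) \<noteq> 0" by (rule odd_CARD_two_neq_zero[OF odd])
  have unip: "P g" if "mat_of_gl2 g = mk2 1 b 0 1 \<or> mat_of_gl2 g = mk2 1 0 b 1" for g b
  proof (cases "b = 0")
    case True
    then have "g = \<one>\<^bsub>GL2\<^esub>" using that unfolding mat_of_gl2_inject[symmetric] GL2_simps mat_eq_mk2 by auto
    then show ?thesis using one by simp
  next
    case False
    have "cay_matrix (mat_of_gl2 g)"
      using that False by (auto simp: cay_matrix_def scalar_mk2 trace_mk2 det_mk2)
    then show ?thesis using gen cay_class_eq by blast
  qed
  have prod: "P g" if AB: "mat_of_gl2 g = A ** B" "det A \<noteq> 0" "det B \<noteq> 0"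
    "\<And>h. mat_of_gl2 h = A \<Longrightarrow> P h" "\<And>h. mat_of_gl2 h = B \<Longrightarrow> P h" for g A B
  proof -
    obtain h k where hk: "mat_of_gl2 h = A" "mat_of_gl2 k = B"
      using gl2_obtain_matrix[OF AB(2)] gl2_obtain_matrix[OF AB(3)] by blast
    then have "g = h \<odot> k" using AB(1) unfolding mat_of_gl2_inject[symmetric] GL2_simps by simp
    then show ?thesis using mult AB(4,5) hk by blast
  qed
  \<comment> \<open>With a nonzero lower left entry, three transvections suffice: upper, lower,
    upper, where x and y are read off from the diagonal entries.\<close>
  have sl2_aux: "P g" if g: "mat_of_gl2 g = mk2 a b c d" "a * d - b * c = 1" "c \<noteq> 0" for g a b c d
  proof -
    define x where "x = (a - 1) / c"
    define y where "y = (d - 1) / c"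
    have "x * c = a - 1" "y * c = d - 1" using g(3) by (simp_all add: x_def y_def)
    then have xy: "1 + x * c = a" "c * y + 1 = d" by (simp_all add: mult.commute)
    have "(a * y + x) * c = b * c"
    proof -
      have "(a * y + x) * c = a * (y * c) + x * c" by (simp add: algebra_simps)
      also have "\<dots> = a * d - 1" unfolding \<open>x * c = a - 1\<close> \<open>y * c = d - 1\<close> by (simp add: algebra_simps)
      finally show ?thesis using g(2) by (simp add: algebra_simps)
    qed
    then have b: "a * y + x = b" using g(3) by simp
    have eq: "mk2 a b c d = (mk2 1 x 0 1 ** mk2 1 0 c 1) ** mk2 1 y 0 1"
      unfolding mk2_mult mk2_eq_iff using xy b by (simp add: add.commute)
    show ?thesis
    proof (rule prod[OF g(1)[unfolded eq]])
      show "P h" if "mat_of_gl2 h = mk2 1 x 0 1 ** mk2 1 0 c 1" for h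
        by (rule prod[OF that]) (auto simp: det_mk2 intro: unip)
    qed (auto simp: det_mul det_mk2 intro: unip)
  qed
  have sl2: "P g" if dt: "gl2_det g = 1" for g
  proof -
    obtain a b c d where g: "mat_of_gl2 g = mk2 a b c d" by (rule mk2_cases)
    have dt': "a * d - b * c = 1" using dt by (simp add: g det_mk2)
    show ?thesis
    proof (cases "c = 0")
      case False
      then show ?thesis using sl2_aux[OF g dt'] by blast
    next
      case True
      then have a: "a \<noteq> 0" using dt' by auto
      \<comment> \<open>Adding the first row to the second makes the lower left entry nonzero, as a
        is not zero.\<close>
      have eq: "mat_of_gl2 g = mk2 1 0 (- 1) 1 ** mk2 a b (a + c) (b + d)"
        unfolding g mk2_mult by (simp add: mk2_eq_iff)
      show ?thesis
      proof (rule prod[OF eq])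
        have "a * (b + d) - b * (a + c) = 1" using dt' by (simp add: algebra_simps)
        then show "det (mk2 a b (a + c) (b + d)) \<noteq> 0" "\<And>h. mat_of_gl2 h = mk2 a b (a + c) (b + d) \<Longrightarrow> P h"
          using sl2_aux a True by (auto simp: det_mk2)
      qed (auto simp: det_mk2 intro: unip)
    qed
  qed
  have square: "P g" if sq: "qchar (gl2_det g) = 1" for g
  proof -
    obtain x where x: "gl2_det g = x\<^sup>2" using sq unfolding qchar_def by (metis one_neq_neg_one)
    then have x0: "x \<noteq> 0" using gl2_det_nz[of g] by auto
    then have "det (mk2 x 1 0 x) \<noteq> 0" by (simp add: det_mk2)
    from gl2_obtain_matrix[OF this] obtain s where s: "mat_of_gl2 s = mk2 x 1 0 x" by blast
    have "(x + x)\<^sup>2 - 4 * (x * x) = 0" by (simp add: power2_eq_square algebra_simps)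
    then have "cay_matrix (mat_of_gl2 s)" unfolding s cay_matrix_def scalar_mk2 trace_mk2 det_mk2 by simp
    then have "P s" using gen cay_class_eq by blast
    moreover have "P (gl2_inv s \<odot> g)"
    proof (rule sl2)
      have "inverse (x * x) * (x * x) = 1" by (rule left_inverse) (use x0 in simp)
      then show "gl2_det (gl2_inv s \<odot> g) = 1"
        unfolding gl2_det_mult gl2_det_inv s det_mk2 x power2_eq_square by (simp only: mult_zero_right diff_zero)
    qed
    ultimately have "P (s \<odot> (gl2_inv s \<odot> g))" by (rule mult)
    then show ?thesis by simp
  qed
  show ?thesis
  proof (cases "qchar (gl2_det g) = 1")
    case True
    then show ?thesis by (rule square)
  next
    case False
    then have dg: "qchar (gl2_det g) = - 1" using qchar_cases by blast
    \<comment> \<open>If -1 is a nonsquare, \<open>c3 1 (- 1)\<close> serves. Otherwise - \<Delta>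
      is a nonsquare, and the matrix of multiplication by a square root of \<Delta> has determinant
      - \<Delta> and discriminant 4 \<Delta>.\<close>
    have "\<exists>A :: 'a^2^2. cay_matrix A \<and> det A \<in> nonsquares"
    proof (cases "(- 1 :: 'a) \<in> nonsquares")
      case True
      have "(1::'a) \<noteq> - 1" using two by (simp add: eq_neg_iff_add_eq_0)
      then show ?thesis using True
        by (intro exI[of _ "mk2 1 0 0 (- 1)"]) (simp add: cay_matrix_def scalar_mk2 trace_mk2 det_mk2)
    next
      case False
      then obtain i where i: "(- 1 :: 'a) = i\<^sup>2" by (auto simp: nonsquares_def)
      then have "i \<noteq> 0" by auto
      have "\<Delta> * i\<^sup>2 \<in> nonsquares" "\<Delta> * 2\<^sup>2 \<in> nonsquares"
        using nonsquares_times_square[OF odd \<Delta>] \<open>i \<noteq> 0\<close> two by blast+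
      then have "- \<Delta> \<in> nonsquares" "4 * \<Delta> \<in> nonsquares" unfolding i[symmetric] by (simp_all add: mult.commute)
      then show ?thesis
        by (intro exI[of _ "mk2 0 \<Delta> 1 0"]) (simp add: cay_matrix_def scalar_mk2 trace_mk2 det_mk2)
    qed
    then obtain A :: "'a^2^2" where A: "cay_matrix A" "det A \<in> nonsquares" by blast
    then have "det A \<noteq> 0" by (simp add: nonsquares_def)
    from gl2_obtain_matrix[OF this] obtain s where s: "mat_of_gl2 s = A" by blast
    have "cay_matrix (mat_of_gl2 s)" using A(1) by (simp only: s)
    then have "P s" using gen cay_class_eq by blast
    moreover have "P (gl2_inv s \<odot> g)"
    proof (rule square)
      have ds: "qchar (gl2_det s) = - 1" using A(2) by (simp add: s mem_nonsquares)
      have "qchar (gl2_det s * gl2_det (gl2_inv s)) = qchar (gl2_det s) * qchar (gl2_det (gl2_inv s))"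
        by (rule qchar_mult[OF odd]) (rule gl2_det_nz)+
      then have "qchar (gl2_det (gl2_inv s)) = - 1" unfolding ds by simp
      then show "qchar (gl2_det (gl2_inv s \<odot> g)) = 1"
        unfolding gl2_det_mult by (subst qchar_mult[OF odd]) (simp_all only: gl2_det_nz dg, simp_all)
    qed
    ultimately have "P (s \<odot> (gl2_inv s \<odot> g))" by (rule mult)
    then show ?thesis by simp
  qed
qed

theorem theorem4p8:
  fixes q :: nat
    and \<Delta> :: "'a::{field, finite}"
    and \<iota> :: "'a \<Rightarrow> 'b::{field, finite}"
    and s :: 'b
    and t :: "'a gl2"
    and \<Gamma> :: "'a gl2 pair_pre_digraph"
  assumes "primepow q" and "odd q"
    and "CARD('a) = q" and "CARD('b) = q\<^sup>2"
    and "\<iota> 1 = 1"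
    and "\<And>x y. \<iota> (x + y) = \<iota> x + \<iota> y"
    and "\<And>x y. \<iota> (x * y) = \<iota> x * \<iota> y"
    and "\<Delta> \<in> nonsquares" and "s\<^sup>2 = \<iota> \<Delta>"
    and "mat_of_gl2 t = vector [vector [- 1, 0], vector [0, - 1]]"
    and "\<Gamma> = Cay GL2 (connection_set \<Delta> \<iota> s)"
  shows "pair_graph \<Gamma> \<and> Digraph_Component.connected (with_proj \<Gamma>) \<and>
    (\<forall>x\<in>carrier GL2. \<exists>\<tau>. perfect_state_transfer \<Gamma> \<tau> x (x \<otimes>\<^bsub>GL2\<^esub> t))"
proof -
  interpret quadratic_extension \<iota> \<Delta> s
    by unfold_locales (use assms in auto)
  have verts: "pverts \<Gamma> = UNIV"
    by (simp add: assms(11) Cay_def GL2_simps)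
  have arcs: "(u, v) \<in> parcs \<Gamma> \<longleftrightarrow> cay_class (v \<odot> gl2_inv u)" for u v
    by (simp add: assms(11) Cay_def GL2_simps mem_connection_set_iff)
  have flip: "cay_class (v \<odot> gl2_inv u) \<longleftrightarrow> cay_class (u \<odot> gl2_inv v)" for u v :: "'a gl2"
    using cay_class_inv[OF odd_card, of "v \<odot> gl2_inv u"] by (simp add: gl2_inv_mult)
  have graph: "pair_graph \<Gamma>"
  proof (unfold_locales)
    show "symmetric (with_proj \<Gamma>)"
      unfolding symmetric_def sym_def arcs_ends_conv using arcs flip by auto
    fix e assume "e \<in> parcs \<Gamma>"
    then have "cay_class (snd e \<odot> gl2_inv (fst e))" using arcs[of "fst e" "snd e"] by simp
    then show "fst e \<noteq> snd e" using not_cay_class_one by auto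
  qed (simp_all add: verts)
  then interpret pair_graph \<Gamma> .
  have "\<forall>u. u \<rightarrow>\<^sup>*\<^bsub>with_proj \<Gamma>\<^esub> (g \<odot> u)" for g
  proof (rule cay_class_generates[OF odd_card nonsquare, where P = "\<lambda>g. \<forall>u. u \<rightarrow>\<^sup>*\<^bsub>with_proj \<Gamma>\<^esub> (g \<odot> u)"])
    show "\<forall>u. u \<rightarrow>\<^sup>*\<^bsub>with_proj \<Gamma>\<^esub> (\<one>\<^bsub>GL2\<^esub> \<odot> u)" by (simp add: verts)
    show "\<forall>u. u \<rightarrow>\<^sup>*\<^bsub>with_proj \<Gamma>\<^esub> (g \<odot> u)" if "cay_class g" for g
      using that arcs by (intro allI reachable_adjI) simp
    show "\<forall>u. u \<rightarrow>\<^sup>*\<^bsub>with_proj \<Gamma>\<^esub> (g \<odot> h \<odot> u)"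
      if "\<forall>u. u \<rightarrow>\<^sup>*\<^bsub>with_proj \<Gamma>\<^esub> (g \<odot> u)" "\<forall>u. u \<rightarrow>\<^sup>*\<^bsub>with_proj \<Gamma>\<^esub> (h \<odot> u)" for g h
      using that reachable_trans by (metis gl2.m_assoc UNIV_I)
  qed
  then have "u \<rightarrow>\<^sup>*\<^bsub>with_proj \<Gamma>\<^esub> v" for u v by (metis gl2_inv_cancel(3))
  then have "u \<rightarrow>\<^sup>*\<^bsub>mk_symmetric (with_proj \<Gamma>)\<^esub> v" for u v by (intro reachable_mk_symmetricI)
  then have conn: "Digraph_Component.connected (with_proj \<Gamma>)"
    unfolding Digraph_Component.connected_def strongly_connected_def by (simp add: verts)
  \<comment> \<open>Arcs are tested on \<open>v \<odot> gl2_inv u\<close>, the regular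
    representation on \<open>u \<odot> gl2_inv v\<close>; \<open>flip\<close> reconciles
    them.\<close>
  have "of_int (4 * (int CARD('a) - 1)) * adjacency_matrix \<Gamma> $ u $ v = cf_apply cay_cf (u \<odot> gl2_inv v)" for u v
    unfolding cay_cf_apply[OF odd_card] adjacency_matrix_def using arcs flip by simp
  from cay_matrix_exp[OF odd_card this]
  have exp: "matrix_exp (\<chi> u v. - \<i> * complex_of_real (pi / 2) * adjacency_matrix \<Gamma> $ u $ v) =
    - regular_rep (scalar_cf (- 1))" .
  have t: "mat_of_gl2 t = mat (- 1)" using assms(10) by (simp add: mat_eq_mk2 mk2_def)
  have pst: "perfect_state_transfer \<Gamma> (pi / 2) x (x \<odot> t)" for x
  proof -
    have central: "x \<odot> t = t \<odot> x"
    proof -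
      obtain a b c d where "mat_of_gl2 x = mk2 a b c d" by (rule mk2_cases)
      then show ?thesis
        unfolding mat_of_gl2_inject[symmetric] GL2_simps t mat_eq_mk2 by (simp add: mk2_mult)
    qed
    \<comment> \<open>Column x of the regular representation of t has its only nonzero entry at t x,
      which is x t because t is central. The phase is therefore -1 for every x.\<close>
    have "(- regular_rep (scalar_cf (- 1)) *v axis x 1) = (- 1) *s axis (x \<odot> t) (1::complex)"
    proof (rule vec_eq_iff[THEN iffD2], rule allI)
      fix u
      have "mat_of_gl2 (u \<odot> gl2_inv x) = mat (- 1) \<longleftrightarrow> u \<odot> gl2_inv x = t"
        unfolding t[symmetric] by (rule mat_of_gl2_inject)
      also have "\<dots> \<longleftrightarrow> u = x \<odot> t"
        unfolding central by (metis gl2_inv_cancel(3,4))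
      finally show "(- regular_rep (scalar_cf (- 1)) *v axis x 1) $ u = ((- 1) *s axis (x \<odot> t) (1::complex)) $ u"
        unfolding matrix_vector_mult_axis by (simp add: regular_rep_def cf_apply_scalar axis_def)
    qed
    then show ?thesis unfolding perfect_state_transfer_def exp by (intro exI[of _ "- 1"]) simp
  qed
  show ?thesis using graph conn pst by blast
qed

end
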